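(* The RTLSG structures for $\mathfrak{gl}(1,1)$ (on the Harish-Chandra superpair $(\mathbb K^2,\mathfrak{gl}(1,1))$) are parametrized by eight parameters $c_1^{C^\ast},c_1^{D^\ast},d_1^{C^\ast},d_1^{D^\ast},c^z,c^w,d^z,d^w\in\mathbb K$ with $$M_C=\begin{pmatrix}c_1^{D^\ast}c^z&-c_1^{C^\ast}c^z\\c_1^{D^\ast}c^w&-c_1^{C^\ast}c^w\end{pmatrix}\quad\text{and}\quad M_D=\begin{pmatrix}d_1^{D^\ast}d^z&-d_1^{C^\ast}d^z\\d_1^{D^\ast}d^w&-d_1^{C^\ast}d^w\end{pmatrix}$$ satisfying $$\det\begin{pmatrix}c_1^{C^\ast}&c_1^{D^\ast}\\d_1^{C^\ast}&d_1^{D^\ast}\end{pmatrix}(d^z-c^z)=\det\begin{pmatrix}c_1^{C^\ast}&c_1^{D^\ast}\\d_1^{C^\ast}&d_1^{D^\ast}\end{pmatrix}(d^w-c^w)=1 .$$ That is, each RTLSG structure determines a unique such tuple, and each such tuple arises from exactly one RTLSG structure.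
   Context: $\mathbb K$ is $\mathbb R$ or $\mathbb C$ (smooth, resp. holomorphic setting). $\mathfrak{gl}(1,1)$ is the Lie superalgebra of $2\times2$ matrices over $\mathbb K$ with supercommutator; even basis $A=\begin{pmatrix}1&0\\0&0\end{pmatrix},B=\begin{pmatrix}0&0\\0&1\end{pmatrix}$, odd basis $C=\begin{pmatrix}0&1\\0&0\end{pmatrix},D=\begin{pmatrix}0&0\\1&0\end{pmatrix}$; $C^\ast,D^\ast$ is the dual basis of $C,D$. Let $G=\mathbb K^2$ be the simply connected Lie group with Lie algebra $\mathfrak g_{\bar0}=\mathbb KA+\mathbb KB$, and $\mathcal O_G$ its sheaf of smooth, resp. holomorphic, functions. An RTLSG (representation-theoretical Lie supergroup) structure on $(\mathbb K^2,\mathfrak g=\mathfrak{gl}(1,1))$ is a Lie superalgebra representation $\rho:\mathfrak g\to\mathrm{Der}(\mathcal F)$, written $X.f=\rho(X)(f)$, by superderivations of $\mathcal F=\mathcal O_G\otimes\Lambda\mathfrak g_{\bar1}^\ast$ such that $X\in\mathfrak g_{\bar0}$ acts on $\mathcal O_G$ by left-invariant derivation and on $\alpha\in\mathfrak g_{\bar1}^\ast$ by $X.\alpha=\alpha([\cdot,X])$, and such that $f\in\mathcal F$ with $X.f\equiv0$ for all $X\in\mathfrak g$ implies $f\in\mathbb K$. For $n,m\in\mathbb Z$ let $f_{n,m}$ be the function on $G$ with $A.f_{n,m}=nf_{n,m}$, $B.f_{n,m}=mf_{n,m}$, $f_{n,m}(e)=1$. Every such structure has unique constants in $\mathbb K$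 with $C.f_{1,0}=c_{C^\ast}^zf_{3,-2}C^\ast+c_{D^\ast}^zf_{1,0}D^\ast$, $C.f_{0,1}=c_{C^\ast}^wf_{2,-1}C^\ast+c_{D^\ast}^wf_{0,1}D^\ast$, $D.f_{1,0}=d_{C^\ast}^zf_{1,0}C^\ast+d_{D^\ast}^zf_{-1,2}D^\ast$, $D.f_{0,1}=d_{C^\ast}^wf_{0,1}C^\ast+d_{D^\ast}^wf_{-2,3}D^\ast$, $C.C^\ast=c_1^{C^\ast}+c_\wedge^{C^\ast}C^\ast\wedge D^\ast$, $C.D^\ast=f_{2,-2}(c_1^{D^\ast}+c_\wedge^{D^\ast}C^\ast\wedge D^\ast)$, $D.C^\ast=f_{-2,2}(d_1^{C^\ast}+d_\wedge^{C^\ast}C^\ast\wedge D^\ast)$, $D.D^\ast=d_1^{D^\ast}+d_\wedge^{D^\ast}C^\ast\wedge D^\ast$, and $\rho$ is determined by these 16 constants. Set $$M_C:=\begin{pmatrix}c_{C^\ast}^z&c_{D^\ast}^z\\c_{C^\ast}^w&c_{D^\ast}^w\end{pmatrix},\qquad M_D:=\begin{pmatrix}d_{C^\ast}^z&d_{D^\ast}^z\\d_{C^\ast}^w&d_{D^\ast}^w\end{pmatrix}.$$ *)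

theory Defs
  imports "HOL-Analysis.Analysis" "HOL-Library.Function_Algebras"
begin

section \<open>The Lie superalgebra gl(1,1)\<close>

definition mat2 :: "'k \<Rightarrow> 'k \<Rightarrow> 'k \<Rightarrow> 'k \<Rightarrow> 'k::zero^2^2" where
  "mat2 a b c d = vector [vector [a, b], vector [c, d]]"

definition gA :: "'k::zero_neq_one^2^2" where "gA = mat2 1 0 0 0"
definition gB :: "'k::zero_neq_one^2^2" where "gB = mat2 0 0 0 1"
definition gC :: "'k::zero_neq_one^2^2" where "gC = mat2 0 1 0 0"
definition gD :: "'k::zero_neq_one^2^2" where "gD = mat2 0 0 1 0"

text \<open>Degrees are natural numbers read modulo 2.\<close>

definition gl_part :: "nat \<Rightarrow> ('k::zero^2^2) set" where
  "gl_part p = (if even p then {X. X$1$2 = 0 \<and> X$2$1 = 0} else {X. X$1$1 = 0 \<and> X$2$2 = 0})"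

definition even_comp :: "'k::zero^2^2 \<Rightarrow> 'k^2^2" where
  "even_comp X = mat2 (X$1$1) 0 0 (X$2$2)"

definition odd_comp :: "'k::zero^2^2 \<Rightarrow> 'k^2^2" where
  "odd_comp X = mat2 0 (X$1$2) (X$2$1) 0"

text \<open>The bilinear extension of \<open>[X, Y] = X Y - (-1)\<^sup>p\<^sup>q Y X\<close> for homogeneous
  \<open>X, Y\<close> of degrees \<open>p, q\<close>.\<close>

definition scomm :: "'k::comm_ring_1^2^2 \<Rightarrow> 'k^2^2 \<Rightarrow> 'k^2^2" where
  "scomm X Y = X ** Y - (Y ** even_comp X + even_comp Y ** odd_comp X - odd_comp Y ** odd_comp X)"


section \<open>The exterior algebra of the dual of the odd part\<close>

text \<open>\<open>Ext a b c d\<close> stands for \<open>a + b C\<^sup>* + c D\<^sup>* + d C\<^sup>* \<and> D\<^sup>*\<close>; the wedge product is \<open>*\<close>.\<close>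

datatype 'k ext = Ext (x_one: 'k) (x_C: 'k) (x_D: 'k) (x_CD: 'k)

instantiation ext :: (comm_ring_1) ring_1
begin

definition "0 = Ext 0 0 0 0"
definition "1 = Ext 1 0 0 0"
definition "\<omega> + \<eta> =
  Ext (x_one \<omega> + x_one \<eta>) (x_C \<omega> + x_C \<eta>) (x_D \<omega> + x_D \<eta>) (x_CD \<omega> + x_CD \<eta>)"
definition "\<omega> - \<eta> =
  Ext (x_one \<omega> - x_one \<eta>) (x_C \<omega> - x_C \<eta>) (x_D \<omega> - x_D \<eta>) (x_CD \<omega> - x_CD \<eta>)"
definition "- \<omega> = Ext (- x_one \<omega>) (- x_C \<omega>) (- x_D \<omega>) (- x_CD \<omega>)"
definition "\<omega> * \<eta> =
  Ext (x_one \<omega> * x_one \<eta>)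
      (x_one \<omega> * x_C \<eta> + x_C \<omega> * x_one \<eta>)
      (x_one \<omega> * x_D \<eta> + x_D \<omega> * x_one \<eta>)
      (x_one \<omega> * x_CD \<eta> + x_CD \<omega> * x_one \<eta> + x_C \<omega> * x_D \<eta> - x_D \<omega> * x_C \<eta>)"

instance
  by standard
    (auto simp: zero_ext_def one_ext_def plus_ext_def minus_ext_def uminus_ext_def times_ext_def
      algebra_simps)

end

definition scal :: "'k::comm_ring_1 \<Rightarrow> 'k ext \<Rightarrow> 'k ext" where
  "scal a \<omega> = Ext (a * x_one \<omega>) (a * x_C \<omega>) (a * x_D \<omega>) (a * x_CD \<omega>)"

definition Cst :: "'k::comm_ring_1 ext" where "Cst = Ext 0 1 0 0"
definition Dst :: "'k::comm_ring_1 ext" where "Dst = Ext 0 0 1 0"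

definition ext_part :: "nat \<Rightarrow> ('k::zero ext) set" where
  "ext_part p = (if even p then {\<omega>. x_C \<omega> = 0 \<and> x_D \<omega> = 0} else {\<omega>. x_one \<omega> = 0 \<and> x_CD \<omega> = 0})"

text \<open>A functional on the odd part, with coordinates \<open>a, b\<close> in the basis dual to \<open>C, D\<close>;
  and the element of the exterior algebra corresponding to a functional.\<close>

definition odd_functional :: "'k::comm_ring_1 \<Rightarrow> 'k \<Rightarrow> 'k^2^2 \<Rightarrow> 'k" where
  "odd_functional a b Y = a * Y$1$2 + b * Y$2$1"

definition form_of :: "('k::comm_ring_1^2^2 \<Rightarrow> 'k) \<Rightarrow> 'k ext" where
  "form_of \<alpha> = scal (\<alpha> gC) Cst + scal (\<alpha> gD) Dst"


section \<open>Sheaves of functions on the group\<close>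

text \<open>The group is the additive group of pairs. A section over an open set \<open>U\<close> is represented by
  its extension by zero to all pairs, so that sections have unique representatives and the algebra
  operations are the pointwise ones of \<^theory>\<open>HOL-Library.Function_Algebras\<close>. The function
  sheaf is a parameter \<open>Sh\<close>, to be instantiated by \<open>smooth_functions\<close> or
  \<open>holomorphic_functions\<close>.\<close>

type_synonym 'k fun_sheaf = "('k \<times> 'k) set \<Rightarrow> ('k \<times> 'k \<Rightarrow> 'k) set"

type_synonym 'k ssection = "'k \<times> 'k \<Rightarrow> 'k ext"

primrec Ck_on :: "nat \<Rightarrow> (real \<times> real) set \<Rightarrow> (real \<times> real \<Rightarrow> real) \<Rightarrow> bool" where
  "Ck_on 0 U f \<longleftrightarrow> continuous_on U f"
| "Ck_on (Suc k) U f \<longleftrightarrow>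
    (\<exists>g h. (\<forall>x\<in>U. (f has_derivative (\<lambda>v. g x * fst v + h x * snd v)) (at x)) \<and>
      Ck_on k U g \<and> Ck_on k U h)"

definition smooth_functions :: "real fun_sheaf" where
  "smooth_functions U = {f. (\<forall>k. Ck_on k U f) \<and> (\<forall>x. x \<notin> U \<longrightarrow> f x = 0)}"

text \<open>Complex differentiability: the total derivative exists and is complex linear.\<close>

definition holomorphic_functions :: "complex fun_sheaf" where
  "holomorphic_functions U =
    {f. (\<forall>x\<in>U. \<exists>a b. (f has_derivative (\<lambda>v. a * fst v + b * snd v)) (at x)) \<and>
        (\<forall>x. x \<notin> U \<longrightarrow> f x = 0)}"

text \<open>Here \<open>exp (t X) = (t X\<^sub>1\<^sub>1, t X\<^sub>2\<^sub>2)\<close> for even \<open>X\<close>; the derivative is real or complex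
  according to the field.\<close>

definition left_inv_deriv ::
  "'k::real_normed_field^2^2 \<Rightarrow> ('k \<times> 'k) set \<Rightarrow> ('k \<times> 'k \<Rightarrow> 'k) \<Rightarrow> 'k \<times> 'k \<Rightarrow> 'k" where
  "left_inv_deriv X U f =
    (\<lambda>x. if x \<in> U then deriv (\<lambda>t. f (x + (t * X$1$1, t * X$2$2))) 0 else 0)"

definition fnm :: "('k::real_normed_field) fun_sheaf \<Rightarrow> int \<Rightarrow> int \<Rightarrow> 'k \<times> 'k \<Rightarrow> 'k" where
  "fnm Sh n m = (THE f. f \<in> Sh UNIV \<and>
      left_inv_deriv gA UNIV f = (\<lambda>x. of_int n * f x) \<and>
      left_inv_deriv gB UNIV f = (\<lambda>x. of_int m * f x) \<and> f (0, 0) = 1)"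


section \<open>The sheaf of superfunctions and its superderivations\<close>

definition tens :: "('k \<times> 'k \<Rightarrow> 'k) \<Rightarrow> 'k ext \<Rightarrow> ('k::comm_ring_1) ssection" where
  "tens f \<omega> = (\<lambda>x. scal (f x) \<omega>)"

definition smul :: "'k \<Rightarrow> ('k::comm_ring_1) ssection \<Rightarrow> 'k ssection" where
  "smul a f = (\<lambda>x. scal a (f x))"

definition superfunctions :: "('k::comm_ring_1) fun_sheaf \<Rightarrow> ('k \<times> 'k) set \<Rightarrow> 'k ssection set" where
  "superfunctions Sh U =
    {f. x_one \<circ> f \<in> Sh U \<and> x_C \<circ> f \<in> Sh U \<and> x_D \<circ> f \<in> Sh U \<and> x_CD \<circ> f \<in> Sh U}"

definition superfunctions_part ::
  "('k::comm_ring_1) fun_sheaf \<Rightarrow> nat \<Rightarrow> ('k \<times> 'k) set \<Rightarrow> 'k ssection set" where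
  "superfunctions_part Sh p U = {f \<in> superfunctions Sh U. range f \<subseteq> ext_part p}"

definition restr :: "('k \<times> 'k) set \<Rightarrow> ('k::comm_ring_1) ssection \<Rightarrow> 'k ssection" where
  "restr V f = (\<lambda>x. if x \<in> V then f x else 0)"

type_synonym 'k sheaf_op = "('k \<times> 'k) set \<Rightarrow> 'k ssection \<Rightarrow> 'k ssection"

text \<open>Operators are required to be \<^term>\<open>undefined\<close> off their domain, so that equality of
  operators is equality of sheaf morphisms.\<close>

definition sheaf_endos :: "('k::real_normed_field) fun_sheaf \<Rightarrow> 'k sheaf_op set" where
  "sheaf_endos Sh =
    {\<Delta> \<in> (\<Pi>\<^sub>E U\<in>{U. open U}. superfunctions Sh U \<rightarrow>\<^sub>E superfunctions Sh U).
      (\<forall>U. open U \<longrightarrow>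
        (\<forall>f\<in>superfunctions Sh U. \<forall>g\<in>superfunctions Sh U. \<Delta> U (f + g) = \<Delta> U f + \<Delta> U g) \<and>
        (\<forall>a. \<forall>f\<in>superfunctions Sh U. \<Delta> U (smul a f) = smul a (\<Delta> U f)) \<and>
        (\<forall>V. open V \<and> V \<subseteq> U \<longrightarrow>
          (\<forall>f\<in>superfunctions Sh U. \<Delta> V (restr V f) = restr V (\<Delta> U f))))}"

definition superderivations :: "('k::real_normed_field) fun_sheaf \<Rightarrow> nat \<Rightarrow> 'k sheaf_op set" where
  "superderivations Sh p =
    {\<Delta> \<in> sheaf_endos Sh. \<forall>U q. open U \<longrightarrow>
      (\<forall>f\<in>superfunctions_part Sh q U.
        \<Delta> U f \<in> superfunctions_part Sh (p + q) U \<and>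
        (\<forall>g\<in>superfunctions Sh U. \<Delta> U (f * g) = \<Delta> U f * g + (- 1) ^ (p * q) * (f * \<Delta> U g)))}"


section \<open>RTLSG structures\<close>

definition lie_super_rep ::
  "('k::real_normed_field) fun_sheaf \<Rightarrow> ('k^2^2 \<Rightarrow> 'k sheaf_op) \<Rightarrow> bool" where
  "lie_super_rep Sh \<rho> \<longleftrightarrow>
    (\<forall>X. \<rho> X \<in> sheaf_endos Sh) \<and>
    (\<forall>p. \<forall>X\<in>gl_part p. \<rho> X \<in> superderivations Sh p) \<and>
    (\<forall>U. open U \<longrightarrow> (\<forall>f\<in>superfunctions Sh U.
      (\<forall>X Y. \<rho> (X + Y) U f = \<rho> X U f + \<rho> Y U f) \<and>
      (\<forall>a X. \<rho> (\<chi> i j. a * X$i$j) U f = smul a (\<rho> X U f)) \<and>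
      (\<forall>p q. \<forall>X\<in>gl_part p. \<forall>Y\<in>gl_part q.
        \<rho> (scomm X Y) U f = \<rho> X U (\<rho> Y U f) - (- 1) ^ (p * q) * \<rho> Y U (\<rho> X U f))))"

text \<open>The last condition is imposed on sections over connected open sets; over a disconnected
  set the constant sheaf has further sections.\<close>

definition RTLSG :: "('k::real_normed_field) fun_sheaf \<Rightarrow> ('k^2^2 \<Rightarrow> 'k sheaf_op) set" where
  "RTLSG Sh = {\<rho>. lie_super_rep Sh \<rho> \<and>
    (\<forall>X\<in>gl_part 0. \<forall>U. open U \<longrightarrow>
      (\<forall>f\<in>Sh U. \<rho> X U (tens f 1) = tens (left_inv_deriv X U f) 1) \<and>
      (\<forall>a b. let \<alpha> = odd_functional a b in
        \<rho> X U (tens (indicator U) (form_of \<alpha>)) =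
        tens (indicator U) (form_of (\<lambda>Y. \<alpha> (scomm Y X))))) \<and>
    (\<forall>U. open U \<and> connected U \<longrightarrow>
      (\<forall>f\<in>superfunctions Sh U. (\<forall>X. \<rho> X U f = 0) \<longrightarrow> (\<exists>c. f = tens (indicator U) (scal c 1))))}"


section \<open>Structure constants and parameters\<close>

text \<open>In \<open>cz_C\<close>, \<open>cw_D\<close>, \<open>dz_C\<close>, ... the upper index is \<open>z\<close> or \<open>w\<close> and the lower index a dual
  basis vector. In \<open>c1_C\<close>, \<open>cwdg_C\<close>, ... the upper index is the dual basis vector and the lower
  index is \<open>1\<close>, respectively the wedge.\<close>

record 'k structure_constants =
  cz_C :: 'k  cz_D :: 'k  cw_C :: 'k  cw_D :: 'k
  dz_C :: 'k  dz_D :: 'k  dw_C :: 'k  dw_D :: 'k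
  c1_C :: 'k  cwdg_C :: 'k  c1_D :: 'k  cwdg_D :: 'k
  d1_C :: 'k  dwdg_C :: 'k  d1_D :: 'k  dwdg_D :: 'k

definition has_constants ::
  "('k::real_normed_field) fun_sheaf \<Rightarrow> ('k^2^2 \<Rightarrow> 'k sheaf_op) \<Rightarrow> 'k structure_constants \<Rightarrow> bool" where
  "has_constants Sh \<rho> k \<longleftrightarrow> (let f = fnm Sh; one = (\<lambda>_. 1) in
    \<rho> gC UNIV (tens (f 1 0) 1) = tens (f 3 (-2)) (scal (cz_C k) Cst) + tens (f 1 0) (scal (cz_D k) Dst) \<and>
    \<rho> gC UNIV (tens (f 0 1) 1) = tens (f 2 (-1)) (scal (cw_C k) Cst) + tens (f 0 1) (scal (cw_D k) Dst) \<and>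
    \<rho> gD UNIV (tens (f 1 0) 1) = tens (f 1 0) (scal (dz_C k) Cst) + tens (f (-1) 2) (scal (dz_D k) Dst) \<and>
    \<rho> gD UNIV (tens (f 0 1) 1) = tens (f 0 1) (scal (dw_C k) Cst) + tens (f (-2) 3) (scal (dw_D k) Dst) \<and>
    \<rho> gC UNIV (tens one Cst) = tens one (scal (c1_C k) 1 + scal (cwdg_C k) (Cst * Dst)) \<and>
    \<rho> gC UNIV (tens one Dst) = tens (f 2 (-2)) (scal (c1_D k) 1 + scal (cwdg_D k) (Cst * Dst)) \<and>
    \<rho> gD UNIV (tens one Cst) = tens (f (-2) 2) (scal (d1_C k) 1 + scal (dwdg_C k) (Cst * Dst)) \<and>
    \<rho> gD UNIV (tens one Dst) = tens one (scal (d1_D k) 1 + scal (dwdg_D k) (Cst * Dst)))"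

definition M_C :: "'k::zero structure_constants \<Rightarrow> 'k^2^2" where
  "M_C k = mat2 (cz_C k) (cz_D k) (cw_C k) (cw_D k)"

definition M_D :: "'k::zero structure_constants \<Rightarrow> 'k^2^2" where
  "M_D k = mat2 (dz_C k) (dz_D k) (dw_C k) (dw_D k)"

record 'k parameters =
  pc_C :: 'k  pc_D :: 'k  pd_C :: 'k  pd_D :: 'k
  pcz :: 'k  pcw :: 'k  pdz :: 'k  pdw :: 'k

definition admissible :: "'k::comm_ring_1 parameters \<Rightarrow> bool" where
  "admissible t \<longleftrightarrow>
    det (mat2 (pc_C t) (pc_D t) (pd_C t) (pd_D t)) * (pdz t - pcz t) = 1 \<and>
    det (mat2 (pc_C t) (pc_D t) (pd_C t) (pd_D t)) * (pdw t - pcw t) = 1"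

definition has_parameters ::
  "('k::real_normed_field) fun_sheaf \<Rightarrow> ('k^2^2 \<Rightarrow> 'k sheaf_op) \<Rightarrow> 'k parameters \<Rightarrow> bool" where
  "has_parameters Sh \<rho> t \<longleftrightarrow> (\<exists>k. has_constants Sh \<rho> k \<and>
    c1_C k = pc_C t \<and> c1_D k = pc_D t \<and> d1_C k = pd_C t \<and> d1_D k = pd_D t \<and>
    M_C k = mat2 (pc_D t * pcz t) (- pc_C t * pcz t) (pc_D t * pcw t) (- pc_C t * pcw t) \<and>
    M_D k = mat2 (pd_D t * pdz t) (- pd_C t * pdz t) (pd_D t * pdw t) (- pd_C t * pdw t))"

end

theory Submission
  imports Defs "HOL-Complex_Analysis.Cauchy_Integral_Formula"
begin

text \<open>
  Write \<open>x, y\<close> for the coordinates of the group and \<open>\<xi> = C\<^sup>*\<close>, \<open>\<eta> = D\<^sup>*\<close> for the odd generators. By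
  Hadamard's lemma a superderivation of the sheaf of superfunctions is a super vector field: it is
  determined by its values on \<open>x, y, \<xi>, \<eta>\<close> (\<open>superderivation_eq_super_field\<close>). The even part of the
  algebra acts in the same way in all structures. Its brackets with \<open>C\<close> and \<open>D\<close> say that the values of
  \<open>C\<close> and \<open>D\<close> on the generators are eigensections, with known eigenvalues; since an eigensection on the
  connected group is determined by its value at the unit, \<open>C\<close> and \<open>D\<close> are given by finitely many
  constants (\<open>RTLSG_odd_field\<close>).

  Uniqueness is then algebra. Evaluating \<open>C\<^sup>2 = D\<^sup>2 = 0\<close> and \<open>CD + DC = A + B\<close> on the generators at the
  unit gives polynomial equations between the constants (\<open>structure_equations\<close>). Let \<open>(a, b)\<close> and
  \<open>(c, d)\<close> be the constant terms of \<open>C\<xi>, C\<eta>\<close> and of \<open>D\<xi>, D\<eta>\<close>. If both pairs are nonzero, the equations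
  produce the eight parameters, fix all the wedge coefficients and leave exactly the two determinant
  conditions. If one of the pairs is zero, the equations make \<open>d v \<xi> - c v\<^sup>-\<^sup>1 \<eta>\<close>, respectively
  \<open>b v \<xi> - a v\<^sup>-\<^sup>1 \<eta>\<close>, with \<open>v = exp (x - y)\<close>, invariant under the whole algebra; it is not constant, so this is
  excluded by the condition on invariants.

  Existence rests on a closed form of the solution. For an even vector field \<open>V\<close> and the contraction \<open>\<iota>\<close>
  with an odd covector field \<open>(m, n)\<close>, the operator \<open>exp (\<xi>\<eta>V) \<iota> exp (-\<xi>\<eta>V)\<close> is an odd superderivation with square
  zero. Two such operators whose vector fields differ by a multiple \<open>l (A + B)\<close>, with coefficients killed by
  \<open>A + B\<close> and with constant determinant \<open>K\<close>, have anticommutator \<open>K l (A + B)\<close>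
  (\<open>contraction_field_anticommute\<close>). With \<open>V = c\<^sup>z \<partial>\<^sub>x + c\<^sup>w \<partial>\<^sub>y\<close> for \<open>C\<close> and \<open>W = d\<^sup>z \<partial>\<^sub>x + d\<^sup>w \<partial>\<^sub>y\<close> for \<open>D\<close>
  the two determinant conditions say that \<open>W - V = l (A + B)\<close> and \<open>K l = 1\<close>. As \<open>K\<close> is not zero, the contractions
  have no common kernel in the odd part, which leaves only constants as invariants.

  The arguments are carried out once, for a sheaf of functions with partial derivatives and Hadamard's
  lemma (\<open>function_sheaf\<close>). Smooth functions satisfy Hadamard's lemma by averaging derivatives along rays;
  for holomorphic functions of two variables the partial derivatives are first shown to be holomorphic, by
  differentiating Cauchy's integral formula under the integral sign.
\<close>

section \<open>The exterior algebra and the brackets of gl(1,1)\<close>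

lemma ext_components [simp]:
  "x_one (0::'k::comm_ring_1 ext) = 0" "x_C (0::'k ext) = 0" "x_D (0::'k ext) = 0" "x_CD (0::'k ext) = 0"
  "x_one (1::'k ext) = 1" "x_C (1::'k ext) = 0" "x_D (1::'k ext) = 0" "x_CD (1::'k ext) = 0"
  "x_one (\<omega> + \<eta>) = x_one \<omega> + x_one \<eta>" "x_C (\<omega> + \<eta>) = x_C \<omega> + x_C \<eta>"
  "x_D (\<omega> + \<eta>) = x_D \<omega> + x_D \<eta>" "x_CD (\<omega> + \<eta>) = x_CD \<omega> + x_CD \<eta>"
  "x_one (\<omega> - \<eta>) = x_one \<omega> - x_one \<eta>" "x_C (\<omega> - \<eta>) = x_C \<omega> - x_C \<eta>"
  "x_D (\<omega> - \<eta>) = x_D \<omega> - x_D \<eta>" "x_CD (\<omega> - \<eta>) = x_CD \<omega> - x_CD \<eta>"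
  "x_one (- \<omega>) = - x_one \<omega>" "x_C (- \<omega>) = - x_C \<omega>"
  "x_D (- \<omega>) = - x_D \<omega>" "x_CD (- \<omega>) = - x_CD \<omega>"
  "x_one (\<omega> * \<eta>) = x_one \<omega> * x_one \<eta>"
  "x_C (\<omega> * \<eta>) = x_one \<omega> * x_C \<eta> + x_C \<omega> * x_one \<eta>"
  "x_D (\<omega> * \<eta>) = x_one \<omega> * x_D \<eta> + x_D \<omega> * x_one \<eta>"
  "x_CD (\<omega> * \<eta>) = x_one \<omega> * x_CD \<eta> + x_CD \<omega> * x_one \<eta> + x_C \<omega> * x_D \<eta> - x_D \<omega> * x_C \<eta>"
  "x_one (scal r \<omega>) = r * x_one \<omega>" "x_C (scal r \<omega>) = r * x_C \<omega>"
  "x_D (scal r \<omega>) = r * x_D \<omega>" "x_CD (scal r \<omega>) = r * x_CD \<omega>"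
  "x_one (Cst::'k ext) = 0" "x_C (Cst::'k ext) = 1" "x_D (Cst::'k ext) = 0" "x_CD (Cst::'k ext) = 0"
  "x_one (Dst::'k ext) = 0" "x_C (Dst::'k ext) = 0" "x_D (Dst::'k ext) = 1" "x_CD (Dst::'k ext) = 0"
  by (simp_all add: zero_ext_def one_ext_def plus_ext_def minus_ext_def uminus_ext_def times_ext_def
      scal_def Cst_def Dst_def)

lemma ext_eq_iff:
  "\<omega> = \<eta> \<longleftrightarrow> x_one \<omega> = x_one \<eta> \<and> x_C \<omega> = x_C \<eta> \<and> x_D \<omega> = x_D \<eta> \<and> x_CD \<omega> = x_CD \<eta>"
  by (cases \<omega>; cases \<eta>) simp

lemma mat2_entries [simp]:
  "mat2 a b c d $ 1 $ 1 = a" "mat2 a b c d $ 1 $ 2 = b" "mat2 a b c d $ 2 $ 1 = c" "mat2 a b c d $ 2 $ 2 = d"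
  by (simp_all add: mat2_def)

lemma gl_basis_entries [simp]:
  "gA $ 1 $ 1 = 1" "gA $ 1 $ 2 = 0" "gA $ 2 $ 1 = 0" "gA $ 2 $ 2 = 0"
  "gB $ 1 $ 1 = 0" "gB $ 1 $ 2 = 0" "gB $ 2 $ 1 = 0" "gB $ 2 $ 2 = 1"
  "gC $ 1 $ 1 = 0" "gC $ 1 $ 2 = 1" "gC $ 2 $ 1 = 0" "gC $ 2 $ 2 = 0"
  "gD $ 1 $ 1 = 0" "gD $ 1 $ 2 = 0" "gD $ 2 $ 1 = 1" "gD $ 2 $ 2 = 0"
  by (simp_all add: gA_def gB_def gC_def gD_def)

lemma mat_eq_iff: "(X::'k^2^2) = Y \<longleftrightarrow>
    X$1$1 = Y$1$1 \<and> X$1$2 = Y$1$2 \<and> X$2$1 = Y$2$1 \<and> X$2$2 = Y$2$2"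
  by (auto simp: vec_eq_iff forall_2)

lemma minus_one_power_parity:
  "even n \<Longrightarrow> (-1) ^ n = (1::'a::ring_1)" "odd n \<Longrightarrow> (-1) ^ n = (-1::'a::ring_1)"
  by auto

lemma sign_section_apply: "((- 1) ^ n :: 'a \<Rightarrow> 'b::ring_1) x = (- 1) ^ n"
  by (induction n) (simp_all add: fun_Compl_def)

lemma ext_part_add: "\<omega> \<in> ext_part p \<Longrightarrow> \<eta> \<in> ext_part p \<Longrightarrow> \<omega> + \<eta> \<in> ext_part p"
  for \<omega> \<eta> :: "'k::comm_ring_1 ext"
  by (auto simp: ext_part_def)

lemma ext_part_mult: "\<omega> \<in> ext_part p \<Longrightarrow> \<eta> \<in> ext_part q \<Longrightarrow> \<omega> * \<eta> \<in> ext_part (p + q)"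
  for \<omega> \<eta> :: "'k::comm_ring_1 ext"
  by (cases "even p"; cases "even q") (auto simp: ext_part_def)

lemma ext_supercommute:
  "\<omega> \<in> ext_part p \<Longrightarrow> \<eta> \<in> ext_part q \<Longrightarrow> \<omega> * \<eta> = (-1) ^ (p * q) * (\<eta> * \<omega>)"
  for \<omega> \<eta> :: "'k::comm_ring_1 ext"
  by (cases "even p"; cases "even q") (auto simp: ext_part_def ext_eq_iff minus_one_power_parity)

text \<open>The left derivatives by \<open>C\<^sup>*\<close> and \<open>D\<^sup>*\<close>: moving \<open>D\<^sup>*\<close> to the front of \<open>C\<^sup>* \<and> D\<^sup>*\<close> costs a sign.\<close>

definition odd_deriv_C :: "'k::comm_ring_1 ext \<Rightarrow> 'k ext" where
  "odd_deriv_C \<omega> = Ext (x_C \<omega>) 0 (x_CD \<omega>) 0"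

definition odd_deriv_D :: "'k::comm_ring_1 ext \<Rightarrow> 'k ext" where
  "odd_deriv_D \<omega> = Ext (x_D \<omega>) (- x_CD \<omega>) 0 0"

lemma odd_deriv_leibniz:
  fixes \<omega> \<eta> :: "'k::comm_ring_1 ext"
  assumes "\<omega> \<in> ext_part q"
  shows "odd_deriv_C (\<omega> * \<eta>) = odd_deriv_C \<omega> * \<eta> + (-1) ^ q * (\<omega> * odd_deriv_C \<eta>)"
    "odd_deriv_D (\<omega> * \<eta>) = odd_deriv_D \<omega> * \<eta> + (-1) ^ q * (\<omega> * odd_deriv_D \<eta>)"
  using assms
  by (cases "even q"; auto simp: ext_part_def odd_deriv_C_def odd_deriv_D_def ext_eq_iff minus_one_power_parity algebra_simps)+

lemma odd_deriv_linear:
  "odd_deriv_C (\<omega> + \<eta>) = odd_deriv_C \<omega> + odd_deriv_C \<eta>" "odd_deriv_D (\<omega> + \<eta>) = odd_deriv_D \<omega> + odd_deriv_D \<eta>"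
  "odd_deriv_C (scal r \<omega>) = scal r (odd_deriv_C \<omega>)" "odd_deriv_D (scal r \<omega>) = scal r (odd_deriv_D \<omega>)"
  "odd_deriv_C 0 = 0" "odd_deriv_D 0 = 0"
  by (auto simp: odd_deriv_C_def odd_deriv_D_def ext_eq_iff)

lemma ext_part_odd_deriv:
  "\<omega> \<in> ext_part q \<Longrightarrow> odd_deriv_C \<omega> \<in> ext_part (Suc q)" "\<omega> \<in> ext_part q \<Longrightarrow> odd_deriv_D \<omega> \<in> ext_part (Suc q)"
  for \<omega> :: "'k::comm_ring_1 ext"
  by (auto simp: ext_part_def odd_deriv_C_def odd_deriv_D_def)

lemma matrix_mult_2: "(X ** Y) $ i $ j = X $ i $ 1 * Y $ 1 $ j + X $ i $ 2 * Y $ 2 $ (j::2)"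
  for X :: "'k::comm_ring_1^2^2"
  by (simp add: matrix_matrix_mult_def sum_2)

lemma odd_even_comp_entries [simp]:
  "even_comp X $ 1 $ 1 = X $ 1 $ 1" "even_comp X $ 1 $ 2 = 0" "even_comp X $ 2 $ 1 = 0" "even_comp X $ 2 $ 2 = X $ 2 $ 2"
  "odd_comp X $ 1 $ 1 = 0" "odd_comp X $ 1 $ 2 = X $ 1 $ 2" "odd_comp X $ 2 $ 1 = X $ 2 $ 1" "odd_comp X $ 2 $ 2 = 0"
  by (simp_all add: even_comp_def odd_comp_def)

lemma scomm_entries:
  fixes X Y :: "'k::comm_ring_1^2^2"
  shows "scomm X Y $ 1 $ 1 = X$1$2 * Y$2$1 + Y$1$2 * X$2$1"
    "scomm X Y $ 2 $ 2 = X$2$1 * Y$1$2 + Y$2$1 * X$1$2"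
    "scomm X Y $ 1 $ 2 = (X$1$1 - X$2$2) * Y$1$2 - (Y$1$1 - Y$2$2) * X$1$2"
    "scomm X Y $ 2 $ 1 = (X$2$2 - X$1$1) * Y$2$1 - (Y$2$2 - Y$1$1) * X$2$1"
  by (simp_all add: scomm_def matrix_mult_2 algebra_simps)

lemma gl_part_iff:
  "X \<in> gl_part p \<longleftrightarrow> (if even p then X$1$2 = 0 \<and> X$2$1 = 0 else X$1$1 = 0 \<and> X$2$2 = 0)"
  by (simp add: gl_part_def)

section \<open>Function sheaves with a Hadamard lemma\<close>

text \<open>Total derivatives are written by their two partial derivatives; for a field that is not the reals this
  also records linearity over the field.\<close>

lemma left_inv_deriv_eqI:
  fixes f :: "'k::real_normed_field \<times> 'k \<Rightarrow> 'k"
  assumes "x \<in> U" "(f has_derivative (\<lambda>v. g * fst v + h * snd v)) (at x)"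
  shows "left_inv_deriv X U f x = X$1$1 * g + X$2$2 * h"
proof -
  have "((\<lambda>t. x + (t * X$1$1, t * X$2$2)) has_derivative (\<lambda>s. (s * X$1$1, s * X$2$2))) (at 0)"
    by (auto intro!: derivative_eq_intros)
  then have "((\<lambda>t. f (x + (t * X$1$1, t * X$2$2))) has_derivative
      (\<lambda>s. g * fst (s * X$1$1, s * X$2$2) + h * snd (s * X$1$1, s * X$2$2))) (at 0)"
    by (rule has_derivative_compose) (use assms(2) in \<open>simp add: zero_prod_def[symmetric]\<close>)
  also have "(\<lambda>s. g * fst (s * X$1$1, s * X$2$2) + h * snd (s * X$1$1, s * X$2$2)) =
      (*) (X$1$1 * g + X$2$2 * h)"
    by (auto simp: algebra_simps)
  finally show ?thesis
    using assms(1) DERIV_imp_deriv by (auto simp: left_inv_deriv_def has_field_derivative_def)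
qed

lemma has_derivative_exp_linear:
  fixes n m :: "'k::{real_normed_field,banach}"
  shows "((\<lambda>x. exp (n * fst x + m * snd x)) has_derivative
    (\<lambda>v. (n * exp (n * fst x + m * snd x)) * fst v + (m * exp (n * fst x + m * snd x)) * snd v)) (at x)"
  by (rule has_derivative_eq_rhs[OF has_derivative_compose[OF _ DERIV_exp[unfolded has_field_derivative_def]]])
    (auto intro!: derivative_eq_intros simp: algebra_simps)

text \<open>The common properties of the smooth and the holomorphic functions. Sections vanish outside their
  domain, so restrictions and constants are cut off by a case distinction. The last axiom is Hadamard's
  lemma; it is what makes derivations of the sheaf first order differential operators.\<close>

locale function_sheaf =
  fixes Sh :: "('k::{real_normed_field,euclidean_space}) fun_sheaf"
  assumes vanish: "f \<in> Sh U \<Longrightarrow> x \<notin> U \<Longrightarrow> f x = 0"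
    and const_in: "open U \<Longrightarrow> (\<lambda>x. if x \<in> U then c else 0) \<in> Sh U"
    and add_in: "f \<in> Sh U \<Longrightarrow> g \<in> Sh U \<Longrightarrow> (\<lambda>x. f x + g x) \<in> Sh U"
    and mult_in: "f \<in> Sh U \<Longrightarrow> g \<in> Sh U \<Longrightarrow> (\<lambda>x. f x * g x) \<in> Sh U"
    and restrict_in: "open V \<Longrightarrow> V \<subseteq> U \<Longrightarrow> f \<in> Sh U \<Longrightarrow> (\<lambda>x. if x \<in> V then f x else 0) \<in> Sh V"
    and fst_in: "fst \<in> Sh UNIV"
    and snd_in: "snd \<in> Sh UNIV"
    and exp_in: "(\<lambda>x. exp (n * fst x + m * snd x)) \<in> Sh UNIV"
    and partials_in: "open U \<Longrightarrow> f \<in> Sh U \<Longrightarrow>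
      \<exists>g\<in>Sh U. \<exists>h\<in>Sh U. \<forall>x\<in>U. (f has_derivative (\<lambda>v. g x * fst v + h x * snd v)) (at x)"
    and hadamard: "open U \<Longrightarrow> f \<in> Sh U \<Longrightarrow> p \<in> U \<Longrightarrow>
      \<exists>V. open V \<and> p \<in> V \<and> V \<subseteq> U \<and> (\<exists>g\<in>Sh V. \<exists>h\<in>Sh V. \<forall>x\<in>V.
        f x = f p + (fst x - fst p) * g x + (snd x - snd p) * h x)"
begin

lemma left_inv_deriv_outside: "x \<notin> U \<Longrightarrow> left_inv_deriv X U f x = 0"
  by (simp add: left_inv_deriv_def)

lemma has_derivative_sheaf:
  assumes "open U" "f \<in> Sh U" "x \<in> U"
  shows "(f has_derivative (\<lambda>v. left_inv_deriv gA U f x * fst v + left_inv_deriv gB U f x * snd v)) (at x)"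
proof -
  obtain g h where "(f has_derivative (\<lambda>v. g x * fst v + h x * snd v)) (at x)"
    using partials_in[OF assms(1,2)] assms(3) by blast
  with left_inv_deriv_eqI[OF assms(3) this] show ?thesis by simp
qed

lemma left_inv_deriv_entries:
  assumes "open U" "f \<in> Sh U"
  shows "left_inv_deriv X U f x = X$1$1 * left_inv_deriv gA U f x + X$2$2 * left_inv_deriv gB U f x"
proof (cases "x \<in> U")
  case True
  from left_inv_deriv_eqI[OF this has_derivative_sheaf[OF assms this]] show ?thesis .
qed (simp add: left_inv_deriv_outside)

lemma const_UNIV_in [simp, intro]: "(\<lambda>_. c) \<in> Sh UNIV"
  using const_in[of UNIV c] by simp

lemma zero_in: "open U \<Longrightarrow> (\<lambda>_. 0) \<in> Sh U"
  using const_in[of U 0] by simp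

lemma mult_global_in:
  assumes "open U" "m \<in> Sh UNIV" "f \<in> Sh U"
  shows "(\<lambda>x. m x * f x) \<in> Sh U"
proof -
  have "(\<lambda>x. (if x \<in> U then m x else 0) * f x) \<in> Sh U"
    using assms by (intro mult_in restrict_in[of U UNIV]) auto
  also have "(\<lambda>x. (if x \<in> U then m x else 0) * f x) = (\<lambda>x. m x * f x)"
    using vanish[OF assms(3)] by auto
  finally show ?thesis .
qed

lemma cmult_in: "open U \<Longrightarrow> f \<in> Sh U \<Longrightarrow> (\<lambda>x. c * f x) \<in> Sh U"
  by (rule mult_global_in) auto

lemma uminus_in: "open U \<Longrightarrow> f \<in> Sh U \<Longrightarrow> (\<lambda>x. - f x) \<in> Sh U"
  using cmult_in[of U f "-1"] by simp

lemma diff_in: "open U \<Longrightarrow> f \<in> Sh U \<Longrightarrow> g \<in> Sh U \<Longrightarrow> (\<lambda>x. f x - g x) \<in> Sh U"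
  using add_in[OF _ uminus_in, of f U g] by simp

lemma left_inv_deriv_in:
  assumes "open U" "f \<in> Sh U"
  shows "left_inv_deriv X U f \<in> Sh U"
proof -
  obtain g h where gh: "g \<in> Sh U" "h \<in> Sh U"
      "\<And>x. x \<in> U \<Longrightarrow> (f has_derivative (\<lambda>v. g x * fst v + h x * snd v)) (at x)"
    using partials_in[OF assms] by blast
  have "left_inv_deriv X U f = (\<lambda>x. X$1$1 * g x + X$2$2 * h x)"
  proof
    fix x show "left_inv_deriv X U f x = X$1$1 * g x + X$2$2 * h x"
      by (cases "x \<in> U") (simp_all add: left_inv_deriv_eqI gh(3) left_inv_deriv_outside vanish[OF gh(1)] vanish[OF gh(2)])
  qed
  then show ?thesis using assms gh by (simp add: add_in cmult_in)
qed

lemma left_inv_deriv_const: "left_inv_deriv X U (\<lambda>_. c) x = 0"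
proof (cases "x \<in> U")
  case True
  from left_inv_deriv_eqI[OF this, of "\<lambda>_. c" 0 0 X] show ?thesis by simp
qed (simp add: left_inv_deriv_outside)

lemma left_inv_deriv_add:
  assumes "open U" "f \<in> Sh U" "g \<in> Sh U"
  shows "left_inv_deriv X U (\<lambda>x. f x + g x) x = left_inv_deriv X U f x + left_inv_deriv X U g x"
proof (cases "x \<in> U")
  case True
  have "((\<lambda>x. f x + g x) has_derivative (\<lambda>v. (left_inv_deriv gA U f x + left_inv_deriv gA U g x) * fst v
      + (left_inv_deriv gB U f x + left_inv_deriv gB U g x) * snd v)) (at x)"
    by (rule has_derivative_eq_rhs[OF has_derivative_add[OF has_derivative_sheaf has_derivative_sheaf]])
      (use assms True in \<open>auto simp: algebra_simps\<close>)
  from left_inv_deriv_eqI[OF True this] show ?thesis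
    by (simp add: left_inv_deriv_entries[of U f X] left_inv_deriv_entries[of U g X] assms algebra_simps)
qed (simp add: left_inv_deriv_outside)

lemma left_inv_deriv_mult:
  assumes "open U" "f \<in> Sh U" "g \<in> Sh U"
  shows "left_inv_deriv X U (\<lambda>x. f x * g x) x = left_inv_deriv X U f x * g x + f x * left_inv_deriv X U g x"
proof (cases "x \<in> U")
  case True
  have "((\<lambda>x. f x * g x) has_derivative (\<lambda>v. (left_inv_deriv gA U f x * g x + f x * left_inv_deriv gA U g x) * fst v
      + (left_inv_deriv gB U f x * g x + f x * left_inv_deriv gB U g x) * snd v)) (at x)"
    by (rule has_derivative_eq_rhs[OF has_derivative_mult[OF has_derivative_sheaf has_derivative_sheaf]])
      (use assms True in \<open>auto simp: algebra_simps\<close>)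
  from left_inv_deriv_eqI[OF True this] show ?thesis
    by (simp add: left_inv_deriv_entries[of U f X] left_inv_deriv_entries[of U g X] assms algebra_simps)
qed (simp add: left_inv_deriv_outside)

lemma left_inv_deriv_cong:
  assumes "open V" "V \<subseteq> U" "open U" "f \<in> Sh U" "x \<in> V" "\<And>y. y \<in> V \<Longrightarrow> g y = f y"
  shows "left_inv_deriv X V g x = left_inv_deriv X U f x"
proof -
  have "(f has_derivative (\<lambda>v. left_inv_deriv gA U f x * fst v + left_inv_deriv gB U f x * snd v)) (at x)"
    using assms by (intro has_derivative_sheaf) auto
  then have "(g has_derivative (\<lambda>v. left_inv_deriv gA U f x * fst v + left_inv_deriv gB U f x * snd v)) (at x)"
    by (rule has_derivative_transform_within_open[OF _ assms(1,5)]) (simp add: assms(6))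
  from left_inv_deriv_eqI[OF assms(5) this] show ?thesis
    by (simp add: left_inv_deriv_entries[of U f X] assms)
qed

lemma left_inv_deriv_restrict:
  assumes "open V" "V \<subseteq> U" "open U" "f \<in> Sh U"
  shows "left_inv_deriv X V (\<lambda>x. if x \<in> V then f x else 0) x = (if x \<in> V then left_inv_deriv X U f x else 0)"
  using left_inv_deriv_cong[OF assms, of x] by (auto simp: left_inv_deriv_outside)

text \<open>Coefficients of operators are global functions, which multiply sections over any open set.\<close>

lemma left_inv_deriv_mult_global:
  assumes "open U" "m \<in> Sh UNIV" "f \<in> Sh U"
  shows "left_inv_deriv X U (\<lambda>x. m x * f x) x = left_inv_deriv X UNIV m x * f x + m x * left_inv_deriv X U f x"
proof (cases "x \<in> U")
  case True
  have "left_inv_deriv X U (\<lambda>x. m x * f x) x = left_inv_deriv X U (\<lambda>x. (if x \<in> U then m x else 0) * f x) x"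
    using True assms by (intro left_inv_deriv_cong mult_in restrict_in[of U UNIV]) auto
  also have "\<dots> = left_inv_deriv X UNIV m x * f x + m x * left_inv_deriv X U f x"
    using assms True by (simp add: left_inv_deriv_mult restrict_in[of U UNIV] left_inv_deriv_restrict[of U UNIV])
  finally show ?thesis .
qed (simp add: left_inv_deriv_outside vanish[OF assms(3)])

lemma left_inv_deriv_cmult:
  "open U \<Longrightarrow> f \<in> Sh U \<Longrightarrow> left_inv_deriv X U (\<lambda>x. c * f x) x = c * left_inv_deriv X U f x"
  by (simp add: left_inv_deriv_mult_global left_inv_deriv_const)

lemma left_inv_deriv_uminus:
  "open U \<Longrightarrow> f \<in> Sh U \<Longrightarrow> left_inv_deriv X U (\<lambda>x. - f x) x = - left_inv_deriv X U f x"
  using left_inv_deriv_cmult[of U f X "-1" x] by simp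

lemma left_inv_deriv_diff:
  "open U \<Longrightarrow> f \<in> Sh U \<Longrightarrow> g \<in> Sh U \<Longrightarrow>
    left_inv_deriv X U (\<lambda>x. f x - g x) x = left_inv_deriv X U f x - left_inv_deriv X U g x"
  using left_inv_deriv_add[of U f "\<lambda>x. - g x" X x] by (simp add: uminus_in left_inv_deriv_uminus)

lemma left_inv_deriv_fst: "left_inv_deriv X UNIV fst x = X$1$1"
  and left_inv_deriv_snd: "left_inv_deriv X UNIV snd x = X$2$2"
  using left_inv_deriv_eqI[of x UNIV fst 1 0 X] left_inv_deriv_eqI[of x UNIV snd 0 1 X]
    has_derivative_fst[OF has_derivative_ident, of "at x"] has_derivative_snd[OF has_derivative_ident, of "at x"]
  by simp_all

lemma left_inv_deriv_exp:
  "left_inv_deriv X UNIV (\<lambda>x. exp (n * fst x + m * snd x)) x = (n * X$1$1 + m * X$2$2) * exp (n * fst x + m * snd x)"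
  using left_inv_deriv_eqI[OF _ has_derivative_exp_linear, of x UNIV X n m] by (simp add: algebra_simps)

text \<open>Differentiating \<open>f = f p + (x - p\<^sub>1) g + (y - p\<^sub>2) h\<close> once at \<open>p\<close> identifies \<open>g p\<close> and \<open>h p\<close>. Differentiating
  twice gives both mixed derivatives of \<open>f\<close> at \<open>p\<close> the same value \<open>\<partial>\<^sub>y g + \<partial>\<^sub>x h\<close>, so that the symmetry of second
  derivatives is a consequence of Hadamard's lemma.\<close>

lemma hadamard_derivatives:
  assumes "open U" "f \<in> Sh U" "p \<in> U"
  obtains V g h where "open V" "p \<in> V" "V \<subseteq> U" "g \<in> Sh V" "h \<in> Sh V"
    "\<And>x. x \<in> V \<Longrightarrow> f x = f p + (fst x - fst p) * g x + (snd x - snd p) * h x"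
    "g p = left_inv_deriv gA U f p" "h p = left_inv_deriv gB U f p"
    "left_inv_deriv gA U (left_inv_deriv gB U f) p = left_inv_deriv gB V g p + left_inv_deriv gA V h p"
    "left_inv_deriv gB U (left_inv_deriv gA U f) p = left_inv_deriv gB V g p + left_inv_deriv gA V h p"
proof -
  obtain V g h where V: "open V" "p \<in> V" "V \<subseteq> U" "g \<in> Sh V" "h \<in> Sh V"
    and eq: "\<And>x. x \<in> V \<Longrightarrow> f x = f p + (fst x - fst p) * g x + (snd x - snd p) * h x"
    using hadamard[OF assms] by blast
  let ?F = "\<lambda>x. f p + (fst x - fst p) * g x + (snd x - snd p) * h x"
  have der: "left_inv_deriv X U f x = X$1$1 * g x + (fst x - fst p) * left_inv_deriv X V g x
      + (X$2$2 * h x + (snd x - snd p) * left_inv_deriv X V h x)" if "x \<in> V" for x X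
  proof -
    have "(g has_derivative (\<lambda>v. left_inv_deriv gA V g x * fst v + left_inv_deriv gB V g x * snd v)) (at x)"
      "(h has_derivative (\<lambda>v. left_inv_deriv gA V h x * fst v + left_inv_deriv gB V h x * snd v)) (at x)"
      using V that by (auto intro: has_derivative_sheaf)
    then have "(?F has_derivative (\<lambda>v.
        (g x + (fst x - fst p) * left_inv_deriv gA V g x + (snd x - snd p) * left_inv_deriv gA V h x) * fst v +
        (h x + (fst x - fst p) * left_inv_deriv gB V g x + (snd x - snd p) * left_inv_deriv gB V h x) * snd v)) (at x)"
      by (auto intro!: derivative_eq_intros simp: algebra_simps)
    then have "(f has_derivative (\<lambda>v.
        (g x + (fst x - fst p) * left_inv_deriv gA V g x + (snd x - snd p) * left_inv_deriv gA V h x) * fst v +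
        (h x + (fst x - fst p) * left_inv_deriv gB V g x + (snd x - snd p) * left_inv_deriv gB V h x) * snd v)) (at x)"
      by (rule has_derivative_transform_within_open[OF _ V(1) that]) (simp add: eq[symmetric])
    from left_inv_deriv_eqI[OF _ this, of U X] that V show ?thesis
      by (simp add: left_inv_deriv_entries[of V g X] left_inv_deriv_entries[of V h X] subsetD algebra_simps)
  qed
  have mixed: "left_inv_deriv Y U (left_inv_deriv X U f) p = X$1$1 * left_inv_deriv Y V g p + Y$1$1 * left_inv_deriv X V g p
      + (X$2$2 * left_inv_deriv Y V h p + Y$2$2 * left_inv_deriv X V h p)" for X Y
  proof -
    have d: "(F has_derivative (\<lambda>v. left_inv_deriv gA V F p * fst v + left_inv_deriv gB V F p * snd v)) (at p)"
      if "F \<in> Sh V" for F using V that by (auto intro: has_derivative_sheaf)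
    have "((\<lambda>x. X$1$1 * g x + (fst x - fst p) * left_inv_deriv X V g x
      + (X$2$2 * h x + (snd x - snd p) * left_inv_deriv X V h x)) has_derivative (\<lambda>v.
        (X$1$1 * left_inv_deriv gA V g p + left_inv_deriv X V g p + X$2$2 * left_inv_deriv gA V h p) * fst v +
        (X$1$1 * left_inv_deriv gB V g p + X$2$2 * left_inv_deriv gB V h p + left_inv_deriv X V h p) * snd v)) (at p)"
      using d[OF V(4)] d[OF V(5)] d[OF left_inv_deriv_in[OF V(1) V(4)], of X] d[OF left_inv_deriv_in[OF V(1) V(5)], of X]
      by (auto intro!: derivative_eq_intros simp: algebra_simps)
    then have "(left_inv_deriv X U f has_derivative (\<lambda>v.
        (X$1$1 * left_inv_deriv gA V g p + left_inv_deriv X V g p + X$2$2 * left_inv_deriv gA V h p) * fst v +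
        (X$1$1 * left_inv_deriv gB V g p + X$2$2 * left_inv_deriv gB V h p + left_inv_deriv X V h p) * snd v)) (at p)"
      by (rule has_derivative_transform_within_open[OF _ V(1,2)]) (simp add: der)
    from left_inv_deriv_eqI[OF assms(3) this, of Y] show ?thesis
      using V by (simp add: left_inv_deriv_entries[of V g Y] left_inv_deriv_entries[of V h Y] algebra_simps)
  qed
  show thesis
    by (rule that[OF V eq]) (use V in \<open>simp_all add: der mixed\<close>)
qed

lemma left_inv_deriv_commute:
  assumes "open U" "f \<in> Sh U"
  shows "left_inv_deriv X U (left_inv_deriv Y U f) x = left_inv_deriv Y U (left_inv_deriv X U f) x"
proof (cases "x \<in> U")
  case True
  have AB: "left_inv_deriv gA U (left_inv_deriv gB U f) x = left_inv_deriv gB U (left_inv_deriv gA U f) x"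
    using hadamard_derivatives[OF assms True] by metis
  have "left_inv_deriv X U (left_inv_deriv Y U f) x =
      X$1$1 * (Y$1$1 * left_inv_deriv gA U (left_inv_deriv gA U f) x + Y$2$2 * left_inv_deriv gA U (left_inv_deriv gB U f) x) +
      X$2$2 * (Y$1$1 * left_inv_deriv gB U (left_inv_deriv gA U f) x + Y$2$2 * left_inv_deriv gB U (left_inv_deriv gB U f) x)"
    for X Y
  proof -
    have "left_inv_deriv Y U f = (\<lambda>x. Y$1$1 * left_inv_deriv gA U f x + Y$2$2 * left_inv_deriv gB U f x)"
      by (rule ext) (rule left_inv_deriv_entries[OF assms])
    then show ?thesis
      using assms by (simp add: left_inv_deriv_entries[of U "left_inv_deriv gA U f" X]
          left_inv_deriv_entries[of U "left_inv_deriv gB U f" X] left_inv_deriv_in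
          left_inv_deriv_add cmult_in left_inv_deriv_cmult) (simp add: algebra_simps)
  qed
  from this[of X Y] this[of Y X] AB show ?thesis by (simp add: algebra_simps)
qed (simp add: left_inv_deriv_outside)

lemma constant_if_derivatives_vanish:
  assumes "open U" "connected U" "f \<in> Sh U"
    "\<And>x. left_inv_deriv gA U f x = 0" "\<And>x. left_inv_deriv gB U f x = 0" "x \<in> U" "y \<in> U"
  shows "f x = f y"
proof (rule has_derivative_zero_unique_connected[OF assms(1,2) _ assms(6,7)])
  fix x assume "x \<in> U"
  from has_derivative_sheaf[OF assms(1,3) this] show "(f has_derivative (\<lambda>x. 0)) (at x)"
    using assms(4,5) by simp
qed

section \<open>Super vector fields\<close>

lemma superfunctions_iff:
  "F \<in> superfunctions Sh U \<longleftrightarrow> (\<lambda>x. x_one (F x)) \<in> Sh U \<and> (\<lambda>x. x_C (F x)) \<in> Sh U \<and>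
    (\<lambda>x. x_D (F x)) \<in> Sh U \<and> (\<lambda>x. x_CD (F x)) \<in> Sh U"
  by (simp add: superfunctions_def comp_def)

lemma superfunctions_vanish: "F \<in> superfunctions Sh U \<Longrightarrow> x \<notin> U \<Longrightarrow> F x = 0"
  using vanish[of "\<lambda>x. x_one (F x)" U x] vanish[of "\<lambda>x. x_C (F x)" U x]
    vanish[of "\<lambda>x. x_D (F x)" U x] vanish[of "\<lambda>x. x_CD (F x)" U x]
  by (simp add: superfunctions_iff ext_eq_iff)

lemma superfunctions_add:
  "F \<in> superfunctions Sh U \<Longrightarrow> G \<in> superfunctions Sh U \<Longrightarrow> F + G \<in> superfunctions Sh U"
  by (auto simp: superfunctions_iff add_in)

lemma superfunctions_smul:
  "open U \<Longrightarrow> F \<in> superfunctions Sh U \<Longrightarrow> smul a F \<in> superfunctions Sh U"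
  by (auto simp: superfunctions_iff smul_def cmult_in)

lemma superfunctions_mult:
  "open U \<Longrightarrow> F \<in> superfunctions Sh U \<Longrightarrow> G \<in> superfunctions Sh U \<Longrightarrow> F * G \<in> superfunctions Sh U"
  by (auto simp: superfunctions_iff intro!: add_in diff_in mult_in)

lemma superfunctions_mult_global:
  "open U \<Longrightarrow> F \<in> superfunctions Sh UNIV \<Longrightarrow> G \<in> superfunctions Sh U \<Longrightarrow>
    (\<lambda>x. F x * G x) \<in> superfunctions Sh U"
  by (auto simp: superfunctions_iff intro!: add_in diff_in mult_global_in)

lemma superfunctions_restr:
  assumes "open V" "V \<subseteq> U" "F \<in> superfunctions Sh U"
  shows "restr V F \<in> superfunctions Sh V"
proof -
  have "(\<lambda>x. c (restr V F x)) = (\<lambda>x. if x \<in> V then c (F x) else 0)" if "c 0 = (0::'k)" for c :: "'k ext \<Rightarrow> 'k"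
    using that by (auto simp: restr_def)
  then show ?thesis using assms by (simp add: superfunctions_iff restrict_in)
qed

lemma superfunctions_tens: "open U \<Longrightarrow> f \<in> Sh U \<Longrightarrow> tens f \<omega> \<in> superfunctions Sh U"
  using cmult_in[of U f] by (auto simp: superfunctions_iff tens_def mult.commute)

lemma superfunctions_const: "(\<lambda>_. \<omega>) \<in> superfunctions Sh UNIV"
  by (simp add: superfunctions_iff)

definition section_deriv :: "'k^2^2 \<Rightarrow> ('k \<times> 'k) set \<Rightarrow> 'k ssection \<Rightarrow> 'k ssection" where
  "section_deriv X U F = (\<lambda>x. Ext (left_inv_deriv X U (\<lambda>x. x_one (F x)) x) (left_inv_deriv X U (\<lambda>x. x_C (F x)) x)
    (left_inv_deriv X U (\<lambda>x. x_D (F x)) x) (left_inv_deriv X U (\<lambda>x. x_CD (F x)) x))"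

lemma section_deriv_in: "open U \<Longrightarrow> F \<in> superfunctions Sh U \<Longrightarrow> section_deriv X U F \<in> superfunctions Sh U"
  by (simp add: superfunctions_iff section_deriv_def left_inv_deriv_in)

lemma section_deriv_add:
  "open U \<Longrightarrow> F \<in> superfunctions Sh U \<Longrightarrow> G \<in> superfunctions Sh U \<Longrightarrow>
    section_deriv X U (F + G) x = section_deriv X U F x + section_deriv X U G x"
  by (auto simp: superfunctions_iff section_deriv_def ext_eq_iff left_inv_deriv_add)

lemma section_deriv_smul:
  "open U \<Longrightarrow> F \<in> superfunctions Sh U \<Longrightarrow> section_deriv X U (smul a F) x = scal a (section_deriv X U F x)"
  by (auto simp: superfunctions_iff section_deriv_def smul_def ext_eq_iff left_inv_deriv_cmult)

lemma section_deriv_mult: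
  "open U \<Longrightarrow> F \<in> superfunctions Sh U \<Longrightarrow> G \<in> superfunctions Sh U \<Longrightarrow>
    section_deriv X U (F * G) x = section_deriv X U F x * G x + F x * section_deriv X U G x"
  by (auto simp: superfunctions_iff section_deriv_def ext_eq_iff left_inv_deriv_add left_inv_deriv_diff
      left_inv_deriv_mult add_in diff_in mult_in algebra_simps)

lemma section_deriv_restr:
  assumes "open V" "V \<subseteq> U" "open U" "F \<in> superfunctions Sh U"
  shows "section_deriv X V (restr V F) = restr V (section_deriv X U F)"
proof -
  have "(\<lambda>x. c (restr V F x)) = (\<lambda>x. if x \<in> V then c (F x) else 0)" if "c 0 = (0::'k)" for c :: "'k ext \<Rightarrow> 'k"
    using that by (auto simp: restr_def)
  then show ?thesis using assms
    by (auto simp: superfunctions_iff section_deriv_def left_inv_deriv_restrict restr_def ext_eq_iff)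
qed

lemma section_deriv_parity:
  assumes "range F \<subseteq> ext_part q"
  shows "section_deriv X U F x \<in> ext_part q"
proof -
  have "F x \<in> ext_part q" for x using assms by blast
  then show ?thesis
    by (cases "even q") (simp_all add: ext_part_def section_deriv_def left_inv_deriv_const)
qed

text \<open>The super vector field with values \<open>X, Y\<close> on the coordinates and \<open>\<Xi>, H\<close> on \<open>C\<^sup>*, D\<^sup>*\<close>. The values stand to the left
  of the derivatives, so the same formula serves both parities.\<close>

definition super_field ::
  "'k ssection \<Rightarrow> 'k ssection \<Rightarrow> 'k ssection \<Rightarrow> 'k ssection \<Rightarrow> 'k sheaf_op" where
  "super_field X Y \<Xi> H U F = (\<lambda>x. X x * section_deriv gA U F x + Y x * section_deriv gB U F x
    + \<Xi> x * odd_deriv_C (F x) + H x * odd_deriv_D (F x))"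

text \<open>Sheaf morphisms are undefined off their domain; the formulas for operators are not.\<close>

definition as_morphism :: "'k sheaf_op \<Rightarrow> 'k sheaf_op" where
  "as_morphism T = (\<lambda>U\<in>{U. open U}. \<lambda>F\<in>superfunctions Sh U. T U F)"

lemma as_morphism_apply: "open U \<Longrightarrow> F \<in> superfunctions Sh U \<Longrightarrow> as_morphism T U F = T U F"
  by (simp add: as_morphism_def)

lemma superfunctions_odd_deriv:
  "open U \<Longrightarrow> F \<in> superfunctions Sh U \<Longrightarrow> (\<lambda>x. odd_deriv_C (F x)) \<in> superfunctions Sh U"
  "open U \<Longrightarrow> F \<in> superfunctions Sh U \<Longrightarrow> (\<lambda>x. odd_deriv_D (F x)) \<in> superfunctions Sh U"
  by (auto simp: superfunctions_iff odd_deriv_C_def odd_deriv_D_def zero_in uminus_in)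

lemma super_field_in:
  assumes "open U" "F \<in> superfunctions Sh U" "X \<in> superfunctions Sh UNIV" "Y \<in> superfunctions Sh UNIV"
    "\<Xi> \<in> superfunctions Sh UNIV" "H \<in> superfunctions Sh UNIV"
  shows "super_field X Y \<Xi> H U F \<in> superfunctions Sh U"
proof -
  have "super_field X Y \<Xi> H U F = (\<lambda>x. X x * section_deriv gA U F x) + (\<lambda>x. Y x * section_deriv gB U F x)
    + (\<lambda>x. \<Xi> x * odd_deriv_C (F x)) + (\<lambda>x. H x * odd_deriv_D (F x))"
    by (auto simp: super_field_def)
  then show ?thesis using assms
    by (simp add: superfunctions_add superfunctions_mult_global section_deriv_in superfunctions_odd_deriv)
qed

lemma scal_distrib: "scal a (\<omega> * \<eta>) = \<omega> * scal a \<eta>" "scal a (\<omega> + \<eta>) = scal a \<omega> + scal a \<eta>"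
  for \<omega> \<eta> :: "'a::comm_ring_1 ext"
  by (auto simp: ext_eq_iff algebra_simps)

lemma super_field_linear:
  assumes "open U" "F \<in> superfunctions Sh U"
  shows "G \<in> superfunctions Sh U \<Longrightarrow> super_field X Y \<Xi> H U (F + G) = super_field X Y \<Xi> H U F + super_field X Y \<Xi> H U G"
    and "super_field X Y \<Xi> H U (smul a F) = smul a (super_field X Y \<Xi> H U F)"
proof -
  show "super_field X Y \<Xi> H U (F + G) = super_field X Y \<Xi> H U F + super_field X Y \<Xi> H U G"
    if "G \<in> superfunctions Sh U"
    using assms that
    by (intro ext) (simp add: super_field_def section_deriv_add odd_deriv_linear algebra_simps)
  show "super_field X Y \<Xi> H U (smul a F) = smul a (super_field X Y \<Xi> H U F)"
    using assms by (auto simp: super_field_def section_deriv_smul) (auto simp: odd_deriv_linear scal_distrib smul_def)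
qed

lemma super_field_sheaf_endo:
  assumes "X \<in> superfunctions Sh UNIV" "Y \<in> superfunctions Sh UNIV"
    "\<Xi> \<in> superfunctions Sh UNIV" "H \<in> superfunctions Sh UNIV"
  shows "as_morphism (super_field X Y \<Xi> H) \<in> sheaf_endos Sh"
  unfolding sheaf_endos_def
proof (intro CollectI conjI allI impI ballI)
  show "as_morphism (super_field X Y \<Xi> H) \<in> (\<Pi>\<^sub>E U\<in>{U. open U}. superfunctions Sh U \<rightarrow>\<^sub>E superfunctions Sh U)"
    using super_field_in assms by (auto simp: as_morphism_def)
next
  fix U :: "('k \<times> 'k) set" and F G assume U: "open U" and F: "F \<in> superfunctions Sh U"
  show "as_morphism (super_field X Y \<Xi> H) U (F + G) =
      as_morphism (super_field X Y \<Xi> H) U F + as_morphism (super_field X Y \<Xi> H) U G"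
    if G: "G \<in> superfunctions Sh U"
    using U F G super_field_linear(1)[OF U F G]
    by (simp add: as_morphism_apply superfunctions_add[unfolded plus_fun_def] plus_fun_def)
  show "as_morphism (super_field X Y \<Xi> H) U (smul a F) = smul a (as_morphism (super_field X Y \<Xi> H) U F)" for a
    using U F by (simp add: as_morphism_apply superfunctions_smul super_field_linear(2))
  show "as_morphism (super_field X Y \<Xi> H) V (restr V F) = restr V (as_morphism (super_field X Y \<Xi> H) U F)"
    if "open V \<and> V \<subseteq> U" for V
    using U F that by (auto simp: as_morphism_apply superfunctions_restr super_field_def section_deriv_restr)
      (auto simp: restr_def odd_deriv_linear)
qed

text \<open>The even derivations satisfy the ordinary Leibniz rule and the odd ones the signed rule; moving the
  coefficient, of degree \<open>p\<close> or \<open>p + 1\<close>, past the first factor supplies the missing sign.\<close>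

lemma super_field_superderivation:
  assumes "X \<in> superfunctions_part Sh p UNIV" "Y \<in> superfunctions_part Sh p UNIV"
    "\<Xi> \<in> superfunctions_part Sh (Suc p) UNIV" "H \<in> superfunctions_part Sh (Suc p) UNIV"
  shows "as_morphism (super_field X Y \<Xi> H) \<in> superderivations Sh p"
  unfolding superderivations_def
proof (intro CollectI conjI allI impI ballI)
  have coeff: "X \<in> superfunctions Sh UNIV" "Y \<in> superfunctions Sh UNIV"
    "\<Xi> \<in> superfunctions Sh UNIV" "H \<in> superfunctions Sh UNIV"
    using assms by (auto simp: superfunctions_part_def)
  then show "as_morphism (super_field X Y \<Xi> H) \<in> sheaf_endos Sh"
    by (rule super_field_sheaf_endo)
  have par: "X x \<in> ext_part p" "Y x \<in> ext_part p" "\<Xi> x \<in> ext_part (Suc p)" "H x \<in> ext_part (Suc p)" for x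
    using assms by (auto simp: superfunctions_part_def)
  fix U :: "('k \<times> 'k) set" and q F assume U: "open U" and F: "F \<in> superfunctions_part Sh q U"
  then have F': "F \<in> superfunctions Sh U" "F x \<in> ext_part q" "section_deriv Z U F x \<in> ext_part q" for x Z
    by (auto simp: superfunctions_part_def section_deriv_parity)
  have "super_field X Y \<Xi> H U F x \<in> ext_part (p + q)" for x
  proof -
    have "ext_part (Suc p + Suc q) = (ext_part (p + q) :: 'k ext set)"
      by (simp add: ext_part_def)
    then have "\<Xi> x * odd_deriv_C (F x) \<in> ext_part (p + q)" "H x * odd_deriv_D (F x) \<in> ext_part (p + q)"
      using ext_part_mult[OF par(3) ext_part_odd_deriv(1)[OF F'(2)]] ext_part_mult[OF par(4) ext_part_odd_deriv(2)[OF F'(2)]]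
      by simp_all
    then show ?thesis
      unfolding super_field_def by (intro ext_part_add ext_part_mult[OF par(1) F'(3)] ext_part_mult[OF par(2) F'(3)])
  qed
  then show "as_morphism (super_field X Y \<Xi> H) U F \<in> superfunctions_part Sh (p + q) U"
    using U F' coeff by (auto simp: superfunctions_part_def as_morphism_apply super_field_in)
  fix G assume G: "G \<in> superfunctions Sh U"
  show "as_morphism (super_field X Y \<Xi> H) U (F * G) = as_morphism (super_field X Y \<Xi> H) U F * G
      + (- 1) ^ (p * q) * (F * as_morphism (super_field X Y \<Xi> H) U G)"
  proof
    fix x
    have comm: "\<omega> * (F x * \<eta>) = (-1) ^ (r * q) * (F x * (\<omega> * \<eta>))" if "\<omega> \<in> ext_part r" for \<omega> \<eta> r
      using ext_supercommute[OF that F'(2)[of x]] by (metis mult.assoc)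
    \<comment> \<open>The sign \<open>(p + 1) q\<close> of an odd coefficient combines with the sign \<open>q\<close> of the odd derivative to \<open>p q\<close>.\<close>
    have comm': "\<omega> * ((-1) ^ q * (F x * \<eta>)) = (-1) ^ (p * q) * (F x * (\<omega> * \<eta>))"
      if "\<omega> \<in> ext_part (Suc p)" for \<omega> \<eta>
      using comm[OF that, of \<eta>] by (cases "even p"; cases "even q") (auto simp: minus_one_power_parity)
    show "as_morphism (super_field X Y \<Xi> H) U (F * G) x = (as_morphism (super_field X Y \<Xi> H) U F * G
      + (- 1) ^ (p * q) * (F * as_morphism (super_field X Y \<Xi> H) U G)) x"
      using U F' G par
      by (simp add: as_morphism_apply superfunctions_mult super_field_def section_deriv_mult sign_section_apply
          odd_deriv_leibniz[OF F'(2)] distrib_left distrib_right comm[OF par(1)] comm[OF par(2)]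
          comm'[OF par(3)] comm'[OF par(4)] mult.assoc)
  qed
qed

section \<open>Superderivations are super vector fields\<close>

lemma superderivationD:
  assumes "\<Delta> \<in> superderivations Sh p" "open U"
  shows superderivation_in: "F \<in> superfunctions Sh U \<Longrightarrow> \<Delta> U F \<in> superfunctions Sh U"
    and superderivation_add: "F \<in> superfunctions Sh U \<Longrightarrow> G \<in> superfunctions Sh U \<Longrightarrow> \<Delta> U (F + G) = \<Delta> U F + \<Delta> U G"
    and superderivation_smul: "F \<in> superfunctions Sh U \<Longrightarrow> \<Delta> U (smul a F) = smul a (\<Delta> U F)"
    and superderivation_restr: "open V \<Longrightarrow> V \<subseteq> U \<Longrightarrow> F \<in> superfunctions Sh U \<Longrightarrow> \<Delta> V (restr V F) = restr V (\<Delta> U F)"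
    and superderivation_parity: "F \<in> superfunctions_part Sh q U \<Longrightarrow> \<Delta> U F \<in> superfunctions_part Sh (p + q) U"
    and superderivation_mult: "F \<in> superfunctions_part Sh q U \<Longrightarrow> G \<in> superfunctions Sh U \<Longrightarrow>
      \<Delta> U (F * G) = \<Delta> U F * G + (- 1) ^ (p * q) * (F * \<Delta> U G)"
proof -
  have "\<Delta> \<in> (\<Pi>\<^sub>E U\<in>{U. open U}. superfunctions Sh U \<rightarrow>\<^sub>E superfunctions Sh U)"
    using assms(1) by (simp add: superderivations_def sheaf_endos_def)
  then have "\<Delta> U \<in> superfunctions Sh U \<rightarrow>\<^sub>E superfunctions Sh U"
    using assms(2) by (auto dest: PiE_mem)
  then show "F \<in> superfunctions Sh U \<Longrightarrow> \<Delta> U F \<in> superfunctions Sh U"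
    by (auto dest: PiE_mem)
qed (use assms in \<open>simp_all add: superderivations_def sheaf_endos_def\<close>)

lemma superfunctions_part_const: "\<omega> \<in> ext_part q \<Longrightarrow> restr U (\<lambda>_. \<omega>) \<in> superfunctions_part Sh q U" if "open U"
  using that superfunctions_restr[OF that _ superfunctions_const[of \<omega>]]
  by (auto simp: superfunctions_part_def restr_def ext_part_def)

lemma superfunctions_part_tens: "open U \<Longrightarrow> f \<in> Sh U \<Longrightarrow> \<omega> \<in> ext_part q \<Longrightarrow> tens f \<omega> \<in> superfunctions_part Sh q U"
  by (auto simp: superfunctions_part_def superfunctions_tens) (auto simp: tens_def ext_part_def split: if_splits)

lemma superfunctions_part_mult:
  assumes "open U" "F \<in> superfunctions_part Sh p U" "G \<in> superfunctions_part Sh q U"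
  shows "F * G \<in> superfunctions_part Sh (p + q) U"
proof -
  have "(F * G) x \<in> ext_part (p + q)" for x
    using assms(2,3) by (auto simp: superfunctions_part_def intro!: ext_part_mult)
  then show ?thesis using assms by (auto simp: superfunctions_part_def superfunctions_mult simp del: times_fun_apply)
qed

text \<open>The unit is idempotent, so its image is twice itself.\<close>

lemma superderivation_one:
  assumes D: "\<Delta> \<in> superderivations Sh p" and U: "open U"
  shows "\<Delta> U (restr U (\<lambda>_. 1)) = 0"
proof
  fix x
  let ?e = "restr U (\<lambda>_. 1) :: 'k ssection"
  have e: "?e \<in> superfunctions_part Sh 0 U" by (rule superfunctions_part_const[OF U]) (simp add: ext_part_def)
  then have e': "?e \<in> superfunctions Sh U" by (simp add: superfunctions_part_def)
  have "?e * ?e = ?e" by (auto simp: restr_def)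
  with superderivation_mult[OF D U e e'] have "\<Delta> U ?e = \<Delta> U ?e * ?e + ?e * \<Delta> U ?e" by simp
  from fun_cong[OF this, of x] have "\<Delta> U ?e x = \<Delta> U ?e x * ?e x + ?e x * \<Delta> U ?e x"
    unfolding plus_fun_apply times_fun_apply .
  then show "\<Delta> U ?e x = 0 x"
    by (cases "x \<in> U") (simp_all add: restr_def)
qed

text \<open>Near \<open>q\<close> write \<open>f\<close> by Hadamard's lemma as a constant plus products \<open>(x - q\<^sub>1) g\<close> and \<open>(y - q\<^sub>2) h\<close>. The
  constant is killed, and in the Leibniz rule for the products the terms that contain an undifferentiated
  factor \<open>x - q\<^sub>1\<close> or \<open>y - q\<^sub>2\<close> vanish at \<open>q\<close>.\<close>

lemma superderivation_function:
  assumes D: "\<Delta> \<in> superderivations Sh p" and U: "open U" "f \<in> Sh U" "q \<in> U"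
  shows "\<Delta> U (tens f 1) q = scal (left_inv_deriv gA U f q) (\<Delta> UNIV (tens fst 1) q)
    + scal (left_inv_deriv gB U f q) (\<Delta> UNIV (tens snd 1) q)"
proof -
  obtain V g h where V: "open V" "q \<in> V" "V \<subseteq> U" "g \<in> Sh V" "h \<in> Sh V"
    and eq: "\<And>x. x \<in> V \<Longrightarrow> f x = f q + (fst x - fst q) * g x + (snd x - snd q) * h x"
    and gh: "g q = left_inv_deriv gA U f q" "h q = left_inv_deriv gB U f q"
    using hadamard_derivatives[OF U] by metis
  have one: "1 \<in> ext_part 0" by (simp add: ext_part_def)
  let ?e = "restr V (\<lambda>_. 1) :: 'k ssection"
  note e = superfunctions_part_const[OF V(1) one]
  have coord: "\<exists>a. a \<in> superfunctions_part Sh 0 V \<and> \<Delta> V a q = \<Delta> UNIV (tens c 1) q \<and>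
      (\<forall>x. a x = (if x \<in> V then scal (c x - c q) 1 else 0))" if c: "c \<in> Sh UNIV" for c
  proof (intro exI conjI)
    let ?a = "restr V (tens c 1) + smul (- c q) ?e"
    have t: "tens c 1 \<in> superfunctions Sh UNIV" using c by (simp add: superfunctions_tens)
    have r: "restr V (tens c 1) \<in> superfunctions Sh V"
      by (rule superfunctions_restr[OF V(1) _ t]) simp
    have e': "?e \<in> superfunctions Sh V" using e by (simp add: superfunctions_part_def)
    show val: "\<forall>x. ?a x = (if x \<in> V then scal (c x - c q) 1 else 0)"
      by (auto simp: restr_def tens_def smul_def ext_eq_iff)
    have "?a \<in> superfunctions Sh V" using r e' V by (simp add: superfunctions_add superfunctions_smul)
    then show "?a \<in> superfunctions_part Sh 0 V"
      using val by (auto simp: superfunctions_part_def ext_part_def simp del: plus_fun_apply)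
    have "\<Delta> V ?a = restr V (\<Delta> UNIV (tens c 1)) + smul (- c q) (\<Delta> V ?e)"
      using r e' V t superderivation_restr[OF D open_UNIV V(1) subset_UNIV t]
      by (simp add: superderivation_add[OF D V(1)] superderivation_smul[OF D V(1)] superfunctions_smul)
    then show "\<Delta> V ?a q = \<Delta> UNIV (tens c 1) q"
      unfolding superderivation_one[OF D V(1)] using V(2) by (simp add: restr_def smul_def ext_eq_iff)
  qed
  obtain a where a: "a \<in> superfunctions_part Sh 0 V" "\<Delta> V a q = \<Delta> UNIV (tens fst 1) q"
    "\<And>x. a x = (if x \<in> V then scal (fst x - fst q) 1 else 0)" using coord[OF fst_in] by blast
  obtain b where b: "b \<in> superfunctions_part Sh 0 V" "\<Delta> V b q = \<Delta> UNIV (tens snd 1) q"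
    "\<And>x. b x = (if x \<in> V then scal (snd x - snd q) 1 else 0)" using coord[OF snd_in] by blast
  have t: "tens g 1 \<in> superfunctions Sh V" "tens h 1 \<in> superfunctions Sh V"
    using V by (simp_all add: superfunctions_tens)
  have ab: "a \<in> superfunctions Sh V" "b \<in> superfunctions Sh V" "?e \<in> superfunctions Sh V"
    using a b e by (auto simp: superfunctions_part_def)
  have split: "restr V (tens f 1) = smul (f q) ?e + (a * tens g 1 + b * tens h 1)"
  proof
    fix x show "restr V (tens f 1) x = (smul (f q) ?e + (a * tens g 1 + b * tens h 1)) x"
      using eq[of x] by (auto simp: restr_def tens_def smul_def ext_eq_iff a(3) b(3))
  qed
  have "\<Delta> U (tens f 1) q = \<Delta> V (restr V (tens f 1)) q"
    using superderivation_restr[OF D U(1) V(1,3) superfunctions_tens[OF U(1,2)]] V(2) by (simp add: restr_def)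
  also have "\<dots> = (smul (f q) (\<Delta> V ?e) + ((\<Delta> V a * tens g 1 + a * \<Delta> V (tens g 1))
      + (\<Delta> V b * tens h 1 + b * \<Delta> V (tens h 1)))) q"
    using t ab V(1) superderivation_mult[OF D V(1) a(1) t(1)] superderivation_mult[OF D V(1) b(1) t(2)]
    by (simp add: split superderivation_add[OF D V(1)] superderivation_smul[OF D V(1)]
        superfunctions_add superfunctions_smul superfunctions_mult)
  also have "\<dots> = scal (g q) (\<Delta> UNIV (tens fst 1) q) + scal (h q) (\<Delta> UNIV (tens snd 1) q)"
    using V(2) by (simp add: superderivation_one[OF D V(1)] smul_def a b tens_def ext_eq_iff mult.commute)
  finally show ?thesis by (simp add: gh)
qed

text \<open>A section is \<open>f\<^sub>0 + f\<^sub>1 C\<^sup>* + f\<^sub>2 D\<^sup>* + f\<^sub>3 C\<^sup>* D\<^sup>*\<close>, and superderivations commute with restriction, so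
  the images of \<open>C\<^sup>*\<close> and \<open>D\<^sup>*\<close> over all of the group suffice.\<close>

theorem superderivation_eq_super_field:
  assumes D: "\<Delta> \<in> superderivations Sh p" and U: "open U" and F: "F \<in> superfunctions Sh U"
  shows "\<Delta> U F = super_field (\<Delta> UNIV (tens fst 1)) (\<Delta> UNIV (tens snd 1))
    (\<Delta> UNIV (\<lambda>_. Cst)) (\<Delta> UNIV (\<lambda>_. Dst)) U F"
proof
  fix x
  let ?X = "\<Delta> UNIV (tens fst 1)" and ?Y = "\<Delta> UNIV (tens snd 1)"
  let ?Xi = "\<Delta> UNIV (\<lambda>_. Cst)" and ?H = "\<Delta> UNIV (\<lambda>_. Dst)"
  show "\<Delta> U F x = super_field ?X ?Y ?Xi ?H U F x"
  proof (cases "x \<in> U")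
    case False
    then show ?thesis
      using superfunctions_vanish[OF superderivation_in[OF D U F]] superfunctions_vanish[OF F]
      by (simp add: super_field_def section_deriv_def left_inv_deriv_outside odd_deriv_linear
          zero_ext_def[symmetric])
  next
    case x: True
    define f0 f1 f2 f3 where "f0 = (\<lambda>x. x_one (F x))" and "f1 = (\<lambda>x. x_C (F x))"
      and "f2 = (\<lambda>x. x_D (F x))" and "f3 = (\<lambda>x. x_CD (F x))"
    have f: "f0 \<in> Sh U" "f1 \<in> Sh U" "f2 \<in> Sh U" "f3 \<in> Sh U"
      using F by (auto simp: superfunctions_iff f0_def f1_def f2_def f3_def)
    have odd: "Cst \<in> ext_part 1" "Dst \<in> ext_part 1" and ev: "1 \<in> ext_part 0"
      by (simp_all add: ext_part_def)
    let ?c = "restr U (\<lambda>_. Cst) :: 'k ssection" and ?d = "restr U (\<lambda>_. Dst) :: 'k ssection"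
    note c = superfunctions_part_const[OF U odd(1)] and d = superfunctions_part_const[OF U odd(2)]
    note t = superfunctions_part_tens[OF U f(1) ev] superfunctions_part_tens[OF U f(2) ev] superfunctions_part_tens[OF U f(3) ev] superfunctions_part_tens[OF U f(4) ev]
    have [simp]: "G \<in> superfunctions_part Sh q U \<Longrightarrow> G \<in> superfunctions Sh U" for G q
      by (simp add: superfunctions_part_def)
    have s: "tens f0 1 \<in> superfunctions Sh U" "tens f1 1 \<in> superfunctions Sh U" "tens f2 1 \<in> superfunctions Sh U"
      "tens f3 1 \<in> superfunctions Sh U" "?c \<in> superfunctions Sh U" "?d \<in> superfunctions Sh U"
      using t c d by auto
    have tc: "tens f3 1 * ?c \<in> superfunctions_part Sh 1 U"
      using superfunctions_part_mult[OF U t(4) c] by simp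
    have split: "F = tens f0 1 + (tens f1 1 * ?c + (tens f2 1 * ?d + tens f3 1 * ?c * ?d))"
    proof
      fix y show "F y = (tens f0 1 + (tens f1 1 * ?c + (tens f2 1 * ?d + tens f3 1 * ?c * ?d))) y"
        using superfunctions_vanish[OF F, of y]
        by (auto simp: restr_def tens_def ext_eq_iff f0_def f1_def f2_def f3_def)
    qed
    have cd: "\<Delta> U ?c x = ?Xi x" "\<Delta> U ?d x = ?H x"
      using superderivation_restr[OF D open_UNIV U subset_UNIV superfunctions_const] x by (simp_all add: restr_def)
    have val: "tens g 1 x = scal (g x) 1" "?c x = Cst" "?d x = Dst" for g
      using x by (simp_all add: tens_def restr_def)
    have "\<Delta> U F = \<Delta> U (tens f0 1) + ((\<Delta> U (tens f1 1) * ?c + tens f1 1 * \<Delta> U ?c)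
        + ((\<Delta> U (tens f2 1) * ?d + tens f2 1 * \<Delta> U ?d)
        + ((\<Delta> U (tens f3 1) * ?c + tens f3 1 * \<Delta> U ?c) * ?d + (-1) ^ (p * 1) * (tens f3 1 * ?c * \<Delta> U ?d))))"
      using superderivation_mult[OF D U t(2) s(5)] superderivation_mult[OF D U t(3) s(6)]
        superderivation_mult[OF D U t(4) s(5)] superderivation_mult[OF D U tc s(6)]
      by (subst split) (use s U in \<open>simp add: superderivation_add[OF D U] superfunctions_add superfunctions_mult\<close>)
    then have "\<Delta> U F x = \<Delta> U (tens f0 1) x + ((\<Delta> U (tens f1 1) x * Cst + scal (f1 x) 1 * ?Xi x)
        + ((\<Delta> U (tens f2 1) x * Dst + scal (f2 x) 1 * ?H x)
        + ((\<Delta> U (tens f3 1) x * Cst + scal (f3 x) 1 * ?Xi x) * Dst + (-1) ^ p * (scal (f3 x) 1 * Cst * ?H x))))"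
      by (simp add: val cd sign_section_apply)
    moreover have "?H \<in> superfunctions_part Sh (p + 1) UNIV"
      using superderivation_parity[OF D open_UNIV superfunctions_part_const[OF open_UNIV odd(2)]] by (simp add: restr_def)
    then have "?H x \<in> ext_part (p + 1)" by (auto simp: superfunctions_part_def)
    then have "(-1) ^ p * (scal (f3 x) 1 * Cst * ?H x) = ?H x * (- scal (f3 x) Cst)"
      by (cases "even p") (auto simp: ext_part_def minus_one_power_parity ext_eq_iff)
    ultimately show ?thesis
      by (simp add: super_field_def section_deriv_def superderivation_function[OF D U _ x] f odd_deriv_C_def odd_deriv_D_def
          f0_def[symmetric] f1_def[symmetric] f2_def[symmetric] f3_def[symmetric])
        (simp add: ext_eq_iff f1_def f2_def f3_def algebra_simps)
  qed
qed

section \<open>Sections homogeneous under the even part\<close>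

text \<open>The function \<open>f\<^sub>j\<^sub>,\<^sub>-\<^sub>j\<close>. Only these occur in the action, since \<open>A + B\<close> is central in the algebra.\<close>

definition antidiag_char :: "int \<Rightarrow> 'k \<times> 'k \<Rightarrow> 'k" where
  "antidiag_char j x = exp (of_int j * (fst x - snd x))"

lemma antidiag_char_in [simp]: "antidiag_char j \<in> Sh UNIV" and antidiag_char_eta_in [simp]: "(\<lambda>x. antidiag_char j x) \<in> Sh UNIV"
  using exp_in[of "of_int j" "- of_int j"] by (simp_all add: antidiag_char_def[abs_def] algebra_simps)

lemma antidiag_char_mult: "antidiag_char i x * antidiag_char j x = antidiag_char (i + j) x"
  by (simp add: antidiag_char_def exp_add[symmetric] algebra_simps)

lemma antidiag_char_simps [simp]: "antidiag_char 0 x = 1" "antidiag_char j 0 = 1" "antidiag_char j x \<noteq> 0"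
  by (simp_all add: antidiag_char_def)

lemma left_inv_deriv_antidiag_char: "left_inv_deriv X UNIV (antidiag_char j) x = of_int j * (X$1$1 - X$2$2) * antidiag_char j x"
  using left_inv_deriv_exp[of X "of_int j" "- of_int j" x] by (simp add: antidiag_char_def[abs_def] algebra_simps)

lemma weight_function:
  assumes f: "f \<in> Sh UNIV"
    and "\<And>x. left_inv_deriv gA UNIV f x = of_int j * f x" "\<And>x. left_inv_deriv gB UNIV f x = - of_int j * f x"
  shows "f x = f 0 * antidiag_char j x"
proof -
  have "f x * antidiag_char (- j) x = f 0 * antidiag_char (- j) 0"
    by (rule constant_if_derivatives_vanish[where U = UNIV and f = "\<lambda>x. f x * antidiag_char (- j) x"])
      (simp_all add: f mult_in left_inv_deriv_mult left_inv_deriv_antidiag_char assms convex_connected)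
  then show ?thesis using antidiag_char_mult[of "- j" x j] by (simp add: mult.assoc) (metis mult.assoc mult.right_neutral)
qed

text \<open>The section with value \<open>\<omega>\<close> at the unit on which \<open>A\<close> acts by \<open>j\<close> and \<open>B\<close> by \<open>- j\<close>. The exponents are shifted because
  \<open>C\<^sup>*\<close> and \<open>D\<^sup>*\<close> have weights \<open>-1\<close> and \<open>1\<close> themselves.\<close>

definition weight_section :: "int \<Rightarrow> 'k ext \<Rightarrow> 'k ssection" where
  "weight_section j \<omega> = (\<lambda>x. Ext (x_one \<omega> * antidiag_char j x) (x_C \<omega> * antidiag_char (j + 1) x)
    (x_D \<omega> * antidiag_char (j - 1) x) (x_CD \<omega> * antidiag_char j x))"

text \<open>The action of the diagonal part of a matrix: the invariant derivation on the coefficients and the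
  coadjoint action on \<open>C\<^sup>*\<close> and \<open>D\<^sup>*\<close>. It does not depend on the structure.\<close>

definition even_action :: "'k^2^2 \<Rightarrow> 'k sheaf_op" where
  "even_action X U F = (\<lambda>x. section_deriv X U F x
    + scal (X$1$1 - X$2$2) (Ext 0 (- x_C (F x)) (x_D (F x)) 0))"

lemma weight_section_in: "weight_section j \<omega> \<in> superfunctions Sh UNIV"
  by (simp add: superfunctions_iff weight_section_def cmult_in)

lemma section_deriv_weight_section:
  "section_deriv X UNIV (weight_section j \<omega>) = (\<lambda>x. scal (X$1$1 - X$2$2)
    (Ext (of_int j * x_one \<omega> * antidiag_char j x) (of_int (j + 1) * x_C \<omega> * antidiag_char (j + 1) x)
      (of_int (j - 1) * x_D \<omega> * antidiag_char (j - 1) x) (of_int j * x_CD \<omega> * antidiag_char j x)))"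
  by (auto simp: section_deriv_def weight_section_def left_inv_deriv_cmult left_inv_deriv_antidiag_char ext_eq_iff)

lemma even_action_weight_section:
  "even_action X UNIV (weight_section j \<omega>) = smul (of_int j * (X$1$1 - X$2$2)) (weight_section j \<omega>)"
  unfolding even_action_def section_deriv_weight_section
  by (auto simp: smul_def weight_section_def ext_eq_iff algebra_simps)

text \<open>Dividing a coefficient by the character of the same weight gives a function with zero derivatives.\<close>

lemma weight_section_unique:
  assumes F: "F \<in> superfunctions Sh UNIV"
    and A: "even_action gA UNIV F = smul (of_int j) F" and B: "even_action gB UNIV F = smul (- of_int j) F"
  shows "F = weight_section j (F 0)"
proof
  fix x
  have A': "even_action gA UNIV F x = scal (of_int j) (F x)" and B': "even_action gB UNIV F x = scal (- of_int j) (F x)" for x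
    using A B by (simp_all add: smul_def)
  note w = A'[unfolded even_action_def section_deriv_def ext_eq_iff, simplified]
    B'[unfolded even_action_def section_deriv_def ext_eq_iff, simplified]
  have "left_inv_deriv gA UNIV (\<lambda>x. x_C (F x)) x = of_int (j + 1) * x_C (F x)"
    "left_inv_deriv gB UNIV (\<lambda>x. x_C (F x)) x = - of_int (j + 1) * x_C (F x)"
    "left_inv_deriv gA UNIV (\<lambda>x. x_D (F x)) x = of_int (j - 1) * x_D (F x)"
    "left_inv_deriv gB UNIV (\<lambda>x. x_D (F x)) x = - of_int (j - 1) * x_D (F x)" for x
    using w(1)[of x] w(2)[of x] unfolding of_int_add of_int_diff of_int_1 by algebra+
  then have "x_one (F x) = x_one (F 0) * antidiag_char j x" "x_CD (F x) = x_CD (F 0) * antidiag_char j x"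
    "x_C (F x) = x_C (F 0) * antidiag_char (j + 1) x" "x_D (F x) = x_D (F 0) * antidiag_char (j - 1) x"
    using F w
    by (intro weight_function[of "\<lambda>x. x_one (F x)"] weight_function[of "\<lambda>x. x_CD (F x)"]
        weight_function[of "\<lambda>x. x_C (F x)"] weight_function[of "\<lambda>x. x_D (F x)"];
        simp add: superfunctions_iff)+
  then show "F x = weight_section j (F 0) x" by (simp add: weight_section_def ext_eq_iff)
qed

end

section \<open>The equations for the structure constants\<close>

text \<open>The value at the unit of a super vector field applied to the section of weight \<open>j\<close> with value \<open>\<omega>\<close> there. On
  such sections the two partial derivatives are opposite, so the field enters only through the
  difference \<open>W\<close> of its values on the coordinates and through its values \<open>\<Xi>, H\<close> on \<open>C\<^sup>*, D\<^sup>*\<close>.\<close>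

definition value_at_unit :: "'k::comm_ring_1 ext \<Rightarrow> 'k ext \<Rightarrow> 'k ext \<Rightarrow> int \<Rightarrow> 'k ext \<Rightarrow> 'k ext" where
  "value_at_unit W \<Xi> H j \<omega> = W * Ext (of_int j * x_one \<omega>) (of_int (j + 1) * x_C \<omega>) (of_int (j - 1) * x_D \<omega>)
    (of_int j * x_CD \<omega>) + \<Xi> * odd_deriv_C \<omega> + H * odd_deriv_D \<omega>"

lemma value_at_unit_odd_field:
  "value_at_unit (Ext 0 r s 0) (Ext a 0 0 e) (Ext b 0 0 g) j \<omega> =
    Ext (a * x_C \<omega> + b * x_D \<omega>) (of_int j * r * x_one \<omega> - b * x_CD \<omega>) (of_int j * s * x_one \<omega> + a * x_CD \<omega>)
      ((of_int (j - 1) * r + g) * x_D \<omega> - (of_int (j + 1) * s - e) * x_C \<omega>)"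
  by (simp add: value_at_unit_def ext_eq_iff odd_deriv_C_def odd_deriv_D_def algebra_simps)

text \<open>The unknowns are the values of \<open>C\<close> and \<open>D\<close> on the generators at the unit: \<open>C x = (X1, X2)\<close>, \<open>C y = (Y1, Y2)\<close>,
  \<open>C C\<^sup>* = a + e C\<^sup>* D\<^sup>*\<close>, \<open>C D\<^sup>* = b + g C\<^sup>* D\<^sup>*\<close>, and \<open>(Z1, Z2)\<close>, \<open>(W1, W2)\<close>, \<open>c + h C\<^sup>* D\<^sup>*\<close>, \<open>d + i C\<^sup>* D\<^sup>*\<close> for \<open>D\<close>.
  The assumption \<open>nondeg\<close> says that no section \<open>\<gamma> v C\<^sup>* + \<delta> v\<^sup>-\<^sup>1 D\<^sup>*\<close> other than zero is invariant. When \<open>(a, b) = 0\<close> the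
  other equations make \<open>(\<gamma>, \<delta>) = (d, - c)\<close> invariant, and when \<open>(c, d) = 0\<close> they make \<open>(b, - a)\<close> invariant, so
  both vectors are nonzero. The orthogonality relations then give \<open>p, q, P, Q\<close>.\<close>

lemma structure_equations:
  fixes a b c d e g h i X1 X2 Y1 Y2 Z1 Z2 W1 W2 r s R S :: "'k::field"
  assumes rs: "r = X1 - Y1" "s = X2 - Y2" "R = Z1 - W1" "S = Z2 - W2"
    and CC: "a * X1 + b * X2 = 0" "a * Y1 + b * Y2 = 0" "b * e = 0" "a * e = 0"
      "b = 0 \<or> 2 * r = g" "2 * s * b + a * g = 0"
    and DD: "c * Z1 + d * Z2 = 0" "c * W1 + d * W2 = 0" "d * i = 0" "c * i = 0"
      "2 * R * c + d * h = 0" "2 * S * c = c * h"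
    and CD: "a * Z1 + b * Z2 + (c * X1 + d * X2) = 1" "a * W1 + b * W2 + (c * Y1 + d * Y2) = 1"
      "2 * r * c + b * h + d * e = 0" "a * h + c * e = 2 * s * c"
      "2 * R * b = b * i + d * g" "a * i + 2 * S * b + c * g = 0"
    and nondeg: "\<And>\<gamma> \<delta>. a * \<gamma> + b * \<delta> = 0 \<Longrightarrow> c * \<gamma> + d * \<delta> = 0 \<Longrightarrow>
      (e - s) * \<gamma> + (g - r) * \<delta> = 0 \<Longrightarrow> (h - S) * \<gamma> + (i - R) * \<delta> = 0 \<Longrightarrow> \<gamma> = 0 \<and> \<delta> = 0"
  shows "\<exists>p q P Q. X1 = b * p \<and> X2 = - (a * p) \<and> Y1 = b * q \<and> Y2 = - (a * q) \<and>
    Z1 = d * P \<and> Z2 = - (c * P) \<and> W1 = d * Q \<and> W2 = - (c * Q) \<and>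
    (a * d - b * c) * (P - p) = 1 \<and> (a * d - b * c) * (Q - q) = 1 \<and>
    e = 0 \<and> g = 2 * b * (p - q) \<and> h = - (2 * c * (P - Q)) \<and> i = 0"
proof -
  have ab: "\<not> (a = 0 \<and> b = 0)"
  proof
    assume ab: "a = 0 \<and> b = 0"
    then have cd: "\<not> (c = 0 \<and> d = 0)" using CD(1) by auto
    have g: "g = 0" and i: "i = 0" using CD(5,6) DD(3,4) ab cd by auto
    have rs': "c * r + d * s = 0" using CD(1,2) ab unfolding rs by algebra
    have RS': "c * R + d * S = 0" using DD(1,2) unfolding rs by algebra
    have "d = 0 \<and> - c = 0"
    proof (rule nondeg)
      show "(e - s) * d + (g - r) * - c = 0"
      proof (cases "c = 0")
        case True
        then have "d \<noteq> 0" using cd by simp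
        then have "e = 0" "s = 0" using CD(3) rs' ab True by auto
        then show ?thesis using True by simp
      next
        case False
        then have "e = 2 * s" using CD(4) ab by simp
        then show ?thesis using g rs' by (simp add: algebra_simps)
      qed
      show "(h - S) * d + (i - R) * - c = 0"
      proof (cases "c = 0")
        case True
        then have "d \<noteq> 0" using cd by simp
        then have "h = 0" "S = 0" using DD(5) RS' True by auto
        then show ?thesis using True by simp
      next
        case False
        then have "h = 2 * S" using DD(6) by simp
        then show ?thesis using i RS' by (simp add: algebra_simps)
      qed
    qed (use ab in auto)
    with cd show False by simp
  qed
  have cd: "\<not> (c = 0 \<and> d = 0)"
  proof
    assume cd: "c = 0 \<and> d = 0"
    have e: "e = 0" and h: "h = 0" using CD(3,4) CC(3,4) ab cd by auto
    have rs': "a * r + b * s = 0" using CC(1,2) unfolding rs by algebra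
    have RS': "a * R + b * S = 0" using CD(1,2) cd unfolding rs by algebra
    have "b = 0 \<and> - a = 0"
    proof (rule nondeg)
      show "(e - s) * b + (g - r) * - a = 0"
      proof (cases "b = 0")
        case True
        then have "a \<noteq> 0" using ab by simp
        then have "g = 0" "r = 0" using CC(6) rs' True by auto
        then show ?thesis using True by simp
      next
        case False
        then have "g = 2 * r" using CC(5) by simp
        then show ?thesis using e rs' by algebra
      qed
      show "(h - S) * b + (i - R) * - a = 0"
      proof (cases "b = 0")
        case True
        then have "a \<noteq> 0" using ab by simp
        then have "i = 0" "R = 0" using CD(6) RS' True cd by auto
        then show ?thesis using True by simp
      next
        case False
        then have "i = 2 * R" using CD(5) cd by simp
        then show ?thesis using h RS' by algebra
      qed
    qed (use cd in auto)
    with ab show False by simp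
  qed
  have param: "\<exists>p. x = v * p \<and> y = - (u * p)" if "u * x + v * y = 0" "\<not> (u = 0 \<and> v = 0)" for u v x y :: 'k
  proof (cases "v = 0")
    case True
    then have "x = v * (- y / u) \<and> y = - (u * (- y / u))" using that by simp
    then show ?thesis ..
  next
    case False
    have "y = - (u * x) / v" using that(1) False by (simp add: field_simps add_eq_0_iff)
    then have "x = v * (x / v) \<and> y = - (u * (x / v))" using False by simp
    then show ?thesis ..
  qed
  obtain p q P Q where pq: "X1 = b * p" "X2 = - (a * p)" "Y1 = b * q" "Y2 = - (a * q)"
    "Z1 = d * P" "Z2 = - (c * P)" "W1 = d * Q" "W2 = - (c * Q)"
    using param[OF CC(1) ab] param[OF CC(2) ab] param[OF DD(1) cd] param[OF DD(2) cd] by blast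
  have "(a * d - b * c) * (P - p) = 1" "(a * d - b * c) * (Q - q) = 1"
    using CD(1,2) unfolding pq by algebra+
  moreover have "e = 0" "i = 0" using CC(3,4) DD(3,4) ab cd by auto
  moreover have "g = 2 * b * (p - q)"
  proof (cases "b = 0")
    case True
    then show ?thesis using CC(6) ab by simp
  next
    case False
    then have "g = 2 * r" using CC(5) by simp
    then show ?thesis by (simp add: rs pq algebra_simps)
  qed
  moreover have "h = - (2 * c * (P - Q))"
  proof (cases "c = 0")
    case True
    then show ?thesis using DD(5) cd by simp
  next
    case False
    then have "h = 2 * S" using DD(6) by simp
    then show ?thesis by (simp add: rs pq algebra_simps)
  qed
  ultimately show ?thesis using pq by blast
qed

section \<open>The odd operators of an arbitrary structure\<close>

context function_sheaf
begin

lemma super_field_even: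
  assumes "open U" "F \<in> superfunctions Sh U"
  shows "super_field (\<lambda>_. scal (X$1$1) 1) (\<lambda>_. scal (X$2$2) 1) (\<lambda>_. scal (X$2$2 - X$1$1) Cst)
    (\<lambda>_. scal (X$1$1 - X$2$2) Dst) U F = even_action X U F"
proof
  fix x
  have "section_deriv X U F x = scal (X$1$1) (section_deriv gA U F x) + scal (X$2$2) (section_deriv gB U F x)"
    using assms left_inv_deriv_entries[of U _ X x] by (simp add: superfunctions_iff section_deriv_def ext_eq_iff)
  then show "super_field (\<lambda>_. scal (X$1$1) 1) (\<lambda>_. scal (X$2$2) 1) (\<lambda>_. scal (X$2$2 - X$1$1) Cst)
    (\<lambda>_. scal (X$1$1 - X$2$2) Dst) U F x = even_action X U F x"
    by (simp add: super_field_def even_action_def ext_eq_iff odd_deriv_C_def odd_deriv_D_def algebra_simps)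
qed

lemma tens_indicator: "tens (indicator U) \<omega> = restr U (\<lambda>_. \<omega>)"
  by (auto simp: tens_def restr_def ext_eq_iff indicator_def)

lemma tens_one: "tens (\<lambda>_. 1) \<omega> = (\<lambda>_. \<omega>)"
  by (auto simp: tens_def ext_eq_iff)

lemma form_of_odd_functional: "form_of (odd_functional a b) = Ext 0 a b 0"
  by (simp add: form_of_def odd_functional_def ext_eq_iff)

lemma form_of_coadjoint:
  "X \<in> gl_part 0 \<Longrightarrow> form_of (\<lambda>Y. odd_functional a b (scomm Y X)) =
    Ext 0 (a * (X$2$2 - X$1$1)) (b * (X$1$1 - X$2$2)) 0"
  by (simp add: form_of_def odd_functional_def ext_eq_iff scomm_entries gl_part_iff algebra_simps)

lemma RTLSG_superderivation: "\<rho> \<in> RTLSG Sh \<Longrightarrow> X \<in> gl_part p \<Longrightarrow> \<rho> X \<in> superderivations Sh p"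
  by (simp add: RTLSG_def lie_super_rep_def)

lemma RTLSG_even:
  assumes \<rho>: "\<rho> \<in> RTLSG Sh" and X: "X \<in> gl_part 0" and U: "open U" "F \<in> superfunctions Sh U"
  shows "\<rho> X U F = even_action X U F"
proof -
  have fns: "\<rho> X UNIV (tens f 1) = tens (left_inv_deriv X UNIV f) 1" if "f \<in> Sh UNIV" for f
    using \<rho> X that by (simp add: RTLSG_def)
  have forms: "\<rho> X UNIV (\<lambda>_. Ext 0 a b 0) = (\<lambda>_. Ext 0 (a * (X$2$2 - X$1$1)) (b * (X$1$1 - X$2$2)) 0)" for a b
  proof -
    have "\<rho> X UNIV (tens (indicator UNIV) (form_of (odd_functional a b))) =
        tens (indicator UNIV) (form_of (\<lambda>Y. odd_functional a b (scomm Y X)))"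
      using \<rho>[unfolded RTLSG_def mem_Collect_eq Let_def] X open_UNIV by blast
    then show ?thesis by (simp add: form_of_odd_functional form_of_coadjoint[OF X] tens_one)
  qed
  have "\<rho> X UNIV (tens fst 1) = (\<lambda>_. scal (X$1$1) 1)" "\<rho> X UNIV (tens snd 1) = (\<lambda>_. scal (X$2$2) 1)"
    using fns[OF fst_in] fns[OF snd_in] by (simp_all add: tens_def left_inv_deriv_fst left_inv_deriv_snd)
  moreover have "\<rho> X UNIV (\<lambda>_. Cst) = (\<lambda>_. scal (X$2$2 - X$1$1) Cst)"
    "\<rho> X UNIV (\<lambda>_. Dst) = (\<lambda>_. scal (X$1$1 - X$2$2) Dst)"
    using forms[of 1 0] forms[of 0 1] by (simp_all add: Cst_def Dst_def scal_def)
  ultimately show ?thesis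
    using superderivation_eq_super_field[OF RTLSG_superderivation[OF \<rho> X] U] super_field_even[OF U, of X] by simp
qed

lemma RTLSG_bracket:
  assumes "\<rho> \<in> RTLSG Sh" "X \<in> gl_part p" "Y \<in> gl_part q" "open U" "F \<in> superfunctions Sh U"
  shows "\<rho> (scomm X Y) U F = \<rho> X U (\<rho> Y U F) - (- 1) ^ (p * q) * \<rho> Y U (\<rho> X U F)"
  using assms by (simp add: RTLSG_def lie_super_rep_def)

lemma RTLSG_linear:
  assumes "\<rho> \<in> RTLSG Sh" "open U" "F \<in> superfunctions Sh U"
  shows "\<rho> (X + Y) U F = \<rho> X U F + \<rho> Y U F" "\<rho> (\<chi> i j. a * X$i$j) U F = smul a (\<rho> X U F)"
  using assms by (simp_all add: RTLSG_def lie_super_rep_def)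

lemma super_field_weight_section:
  "super_field X Y \<Xi> H UNIV (weight_section j \<omega>) 0 = value_at_unit (X 0 - Y 0) (\<Xi> 0) (H 0) j \<omega>"
  unfolding super_field_def section_deriv_weight_section
  by (simp add: value_at_unit_def weight_section_def ext_eq_iff odd_deriv_C_def odd_deriv_D_def algebra_simps)

lemma weight_section_zero [simp]: "weight_section j \<omega> 0 = \<omega>"
  by (simp add: weight_section_def ext_eq_iff)

lemma weight_section_Cst: "weight_section (-1) Cst = (\<lambda>_. Cst)"
  and weight_section_Dst: "weight_section 1 Dst = (\<lambda>_. Dst)"
  by (auto simp: weight_section_def ext_eq_iff)

text \<open>An odd basis element \<open>Z\<close> of weight \<open>s\<close> raises weights by \<open>s\<close>. The coordinates are not eigensections, but
  the even part maps them to constants, which \<open>Z\<close> kills; hence their images under \<open>Z\<close> are eigensections too.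
  Both basis elements are instances, with \<open>s = 1\<close> for \<open>C\<close> and \<open>s = -1\<close> for \<open>D\<close>.\<close>

lemma RTLSG_odd_field:
  assumes \<rho>: "\<rho> \<in> RTLSG Sh" and Z: "Z \<in> gl_part 1"
    and weight: "\<And>X. X \<in> gl_part 0 \<Longrightarrow> scomm X Z = (\<chi> i j. (of_int s * (X$1$1 - X$2$2)) * Z$i$j)"
  obtains X1 X2 Y1 Y2 a e b g where
    "\<rho> Z UNIV (tens fst 1) = weight_section s (Ext 0 X1 X2 0)"
    "\<rho> Z UNIV (tens snd 1) = weight_section s (Ext 0 Y1 Y2 0)"
    "\<rho> Z UNIV (\<lambda>_. Cst) = weight_section (s - 1) (Ext a 0 0 e)"
    "\<rho> Z UNIV (\<lambda>_. Dst) = weight_section (s + 1) (Ext b 0 0 g)"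
    "\<And>j \<omega>. \<rho> Z UNIV (weight_section j \<omega>) = weight_section (s + j)
      (value_at_unit (Ext 0 (X1 - Y1) (X2 - Y2) 0) (Ext a 0 0 e) (Ext b 0 0 g) j \<omega>)"
proof -
  note D = RTLSG_superderivation[OF \<rho> Z]
  have Z_in: "\<rho> Z UNIV F \<in> superfunctions Sh UNIV" if "F \<in> superfunctions Sh UNIV" for F
    using superderivation_in[OF D open_UNIV that] .
  have comm: "even_action X UNIV (\<rho> Z UNIV F) = \<rho> Z UNIV (even_action X UNIV F)
      + smul (of_int s * (X$1$1 - X$2$2)) (\<rho> Z UNIV F)"
    if X: "X \<in> gl_part 0" and F: "F \<in> superfunctions Sh UNIV" for X F
  proof -
    have "smul (of_int s * (X$1$1 - X$2$2)) (\<rho> Z UNIV F) = even_action X UNIV (\<rho> Z UNIV F) - \<rho> Z UNIV (even_action X UNIV F)"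
      using RTLSG_bracket[OF \<rho> X Z open_UNIV F] weight[OF X] Z_in[OF F]
      by (simp add: RTLSG_linear[OF \<rho> open_UNIV F] RTLSG_even[OF \<rho> X open_UNIV] F)
    then show ?thesis by simp
  qed
  have even_basis: "gA \<in> gl_part 0" "gB \<in> gl_part 0" by (simp_all add: gl_part_iff)
  have weight_image: "\<rho> Z UNIV F = weight_section (s + j) (\<rho> Z UNIV F 0)"
    if F: "F \<in> superfunctions Sh UNIV"
      and ev: "\<And>X. X \<in> gl_part 0 \<Longrightarrow> \<rho> Z UNIV (even_action X UNIV F) = smul (of_int j * (X$1$1 - X$2$2)) (\<rho> Z UNIV F)" for F j
  proof (rule weight_section_unique[OF Z_in[OF F]])
    show "even_action gA UNIV (\<rho> Z UNIV F) = smul (of_int (s + j)) (\<rho> Z UNIV F)"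
      "even_action gB UNIV (\<rho> Z UNIV F) = smul (- of_int (s + j)) (\<rho> Z UNIV F)"
      using comm[OF even_basis(1) F] comm[OF even_basis(2) F] ev[OF even_basis(1)] ev[OF even_basis(2)]
      by (auto simp: fun_eq_iff smul_def ext_eq_iff algebra_simps)
  qed
  have w: "\<rho> Z UNIV (weight_section j \<omega>) = weight_section (s + j) (\<rho> Z UNIV (weight_section j \<omega>) 0)" for j \<omega>
    by (rule weight_image) (simp_all add: weight_section_in even_action_weight_section superderivation_smul[OF D])
  have const: "\<rho> Z UNIV (\<lambda>_. scal c 1) = 0" for c
    using superderivation_one[OF D open_UNIV] superderivation_smul[OF D open_UNIV superfunctions_const, of c 1]
    by (auto simp: restr_def smul_def ext_eq_iff)
  have coord: "\<rho> Z UNIV (tens f 1) = weight_section s (\<rho> Z UNIV (tens f 1) 0)"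
    if f: "f \<in> Sh UNIV" and c: "\<And>X x. left_inv_deriv X UNIV f x = l X" for f l
  proof -
    have "even_action X UNIV (tens f 1) = (\<lambda>_. scal (l X) 1)" for X
      using c by (auto simp: even_action_def section_deriv_def tens_def ext_eq_iff left_inv_deriv_const)
    then show ?thesis
      using weight_image[of "tens f 1" 0] f by (simp add: superfunctions_tens const) (simp add: smul_def ext_eq_iff fun_eq_iff)
  qed
  have part: "\<rho> Z UNIV F 0 \<in> ext_part (1 + q)" if "F \<in> superfunctions_part Sh q UNIV" for F q
    using superderivation_parity[OF D open_UNIV that] by (auto simp: superfunctions_part_def)
  have one: "(1::'k ext) \<in> ext_part 0" and cd: "(Cst::'k ext) \<in> ext_part 1" "(Dst::'k ext) \<in> ext_part 1"
    by (simp_all add: ext_part_def)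
  have odd: "\<omega> = Ext 0 (x_C \<omega>) (x_D \<omega>) 0" if "\<omega> \<in> ext_part (1 + 0)" for \<omega> :: "'k ext"
    using that by (simp add: ext_part_def ext_eq_iff)
  have ev: "\<omega> = Ext (x_one \<omega>) 0 0 (x_CD \<omega>)" if "\<omega> \<in> ext_part (1 + 1)" for \<omega> :: "'k ext"
    using that by (simp add: ext_part_def ext_eq_iff)
  have univ: "restr UNIV F = F" for F :: "'k ssection" by (simp add: restr_def)
  note vals = odd[OF part[OF superfunctions_part_tens[OF open_UNIV fst_in one]]] odd[OF part[OF superfunctions_part_tens[OF open_UNIV snd_in one]]]
    ev[OF part[OF superfunctions_part_const[OF open_UNIV cd(1), unfolded univ]]] ev[OF part[OF superfunctions_part_const[OF open_UNIV cd(2), unfolded univ]]]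
  let ?x = "\<rho> Z UNIV (tens fst 1) 0" and ?y = "\<rho> Z UNIV (tens snd 1) 0"
  let ?c = "\<rho> Z UNIV (\<lambda>_. Cst) 0" and ?d = "\<rho> Z UNIV (\<lambda>_. Dst) 0"
  have xy: "\<rho> Z UNIV (tens fst 1) = weight_section s ?x" "\<rho> Z UNIV (tens snd 1) = weight_section s ?y"
    using coord[OF fst_in left_inv_deriv_fst] coord[OF snd_in left_inv_deriv_snd] .
  have CD: "\<rho> Z UNIV (\<lambda>_. Cst) = weight_section (s - 1) ?c" "\<rho> Z UNIV (\<lambda>_. Dst) = weight_section (s + 1) ?d"
    using w[of "-1" Cst] w[of 1 Dst] by (simp_all add: weight_section_Cst weight_section_Dst)
  have "\<rho> Z UNIV (weight_section j \<omega>) 0 = value_at_unit (?x - ?y) ?c ?d j \<omega>" for j \<omega>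
    using superderivation_eq_super_field[OF D open_UNIV weight_section_in] by (simp add: super_field_weight_section)
  then have sym: "\<rho> Z UNIV (weight_section j \<omega>) = weight_section (s + j) (value_at_unit (?x - ?y) ?c ?d j \<omega>)" for j \<omega>
    using w[of j \<omega>] by simp
  obtain X1 X2 Y1 Y2 a e b g where "?x = Ext 0 X1 X2 0" "?y = Ext 0 Y1 Y2 0" "?c = Ext a 0 0 e" "?d = Ext b 0 0 g"
    using vals by blast
  moreover have "Ext 0 X1 X2 0 - Ext 0 Y1 Y2 0 = Ext 0 (X1 - Y1) (X2 - Y2) 0" by (simp add: ext_eq_iff)
  ultimately show thesis using that[of X1 X2 Y1 Y2 a e b g] xy CD sym by simp
qed

text \<open>The three bracket relations on the four generators, evaluated at the unit, are the hypotheses of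
  \<open>structure_equations\<close>; the condition on invariants, applied to sections of weight zero, gives the
  nondegeneracy.\<close>

lemma RTLSG_constants:
  assumes \<rho>: "\<rho> \<in> RTLSG Sh"
  obtains a b c d p q P Q where
    "\<rho> gC UNIV (tens fst 1) = weight_section 1 (Ext 0 (b * p) (- (a * p)) 0)"
    "\<rho> gC UNIV (tens snd 1) = weight_section 1 (Ext 0 (b * q) (- (a * q)) 0)"
    "\<rho> gC UNIV (\<lambda>_. Cst) = weight_section 0 (Ext a 0 0 0)"
    "\<rho> gC UNIV (\<lambda>_. Dst) = weight_section 2 (Ext b 0 0 (2 * b * (p - q)))"
    "\<rho> gD UNIV (tens fst 1) = weight_section (-1) (Ext 0 (d * P) (- (c * P)) 0)"
    "\<rho> gD UNIV (tens snd 1) = weight_section (-1) (Ext 0 (d * Q) (- (c * Q)) 0)"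
    "\<rho> gD UNIV (\<lambda>_. Cst) = weight_section (-2) (Ext c 0 0 (- (2 * c * (P - Q))))"
    "\<rho> gD UNIV (\<lambda>_. Dst) = weight_section 0 (Ext d 0 0 0)"
    "(a * d - b * c) * (P - p) = 1" "(a * d - b * c) * (Q - q) = 1"
proof -
  have odd: "gC \<in> gl_part 1" "gD \<in> gl_part 1" by (simp_all add: gl_part_iff)
  obtain X1 X2 Y1 Y2 a e b g where C: "\<rho> gC UNIV (tens fst 1) = weight_section 1 (Ext 0 X1 X2 0)"
    "\<rho> gC UNIV (tens snd 1) = weight_section 1 (Ext 0 Y1 Y2 0)"
    "\<rho> gC UNIV (\<lambda>_. Cst) = weight_section (1 - 1) (Ext a 0 0 e)"
    "\<rho> gC UNIV (\<lambda>_. Dst) = weight_section (1 + 1) (Ext b 0 0 g)"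
    and Cw: "\<And>j \<omega>. \<rho> gC UNIV (weight_section j \<omega>) = weight_section (1 + j)
      (value_at_unit (Ext 0 (X1 - Y1) (X2 - Y2) 0) (Ext a 0 0 e) (Ext b 0 0 g) j \<omega>)"
    by (rule RTLSG_odd_field[OF \<rho> odd(1), of 1])
      (auto simp: mat_eq_iff scomm_entries gl_part_iff)
  obtain Z1 Z2 W1 W2 c h d i where D: "\<rho> gD UNIV (tens fst 1) = weight_section (-1) (Ext 0 Z1 Z2 0)"
    "\<rho> gD UNIV (tens snd 1) = weight_section (-1) (Ext 0 W1 W2 0)"
    "\<rho> gD UNIV (\<lambda>_. Cst) = weight_section (-1 - 1) (Ext c 0 0 h)"
    "\<rho> gD UNIV (\<lambda>_. Dst) = weight_section (-1 + 1) (Ext d 0 0 i)"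
    and Dw: "\<And>j \<omega>. \<rho> gD UNIV (weight_section j \<omega>) = weight_section (-1 + j)
      (value_at_unit (Ext 0 (Z1 - W1) (Z2 - W2) 0) (Ext c 0 0 h) (Ext d 0 0 i) j \<omega>)"
    by (rule RTLSG_odd_field[OF \<rho> odd(2), of "-1"])
      (auto simp: mat_eq_iff scomm_entries gl_part_iff)
  have gens: "tens fst 1 \<in> superfunctions Sh UNIV" "tens snd 1 \<in> superfunctions Sh UNIV"
    "(\<lambda>_. Cst) \<in> superfunctions Sh UNIV" "(\<lambda>_. Dst) \<in> superfunctions Sh UNIV"
    by (simp_all add: superfunctions_tens fst_in snd_in superfunctions_const)
  have zero: "\<rho> (scomm X Y) UNIV F = 0" if "F \<in> superfunctions Sh UNIV" "scomm X Y = (\<chi> i j. 0 * gA$i$j)" for F X Y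
    using RTLSG_linear(2)[OF \<rho> open_UNIV that(1), of 0 gA] that(2) by (simp add: smul_def fun_eq_iff ext_eq_iff)
  have sq: "scomm gC gC = ((\<chi> i j. 0 * gA$i$j) :: 'k^2^2)" "scomm gD gD = ((\<chi> i j. 0 * gA$i$j) :: 'k^2^2)"
    by (simp_all add: mat_eq_iff scomm_entries)
  \<comment> \<open>For odd elements the bracket \<open>[C, C]\<close> is \<open>2 C\<^sup>2\<close>, so the relation has to be halved.\<close>
  have double: "F = - F \<Longrightarrow> F = 0" for F :: "'k ssection"
  proof
    fix x assume "F = - F"
    then have "F x = - F x" by (metis fun_Compl_def)
    then show "F x = 0 x" by (simp add: ext_eq_iff)
  qed
  have CC: "\<rho> gC UNIV (\<rho> gC UNIV F) = 0" and DD: "\<rho> gD UNIV (\<rho> gD UNIV F) = 0"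
    if "F \<in> superfunctions Sh UNIV" for F
    using RTLSG_bracket[OF \<rho> odd(1) odd(1) open_UNIV that] zero[OF that sq(1)]
      RTLSG_bracket[OF \<rho> odd(2) odd(2) open_UNIV that] zero[OF that sq(2)]
    by (auto intro!: double simp: eq_neg_iff_add_eq_0)
  have I: "scomm gC gD \<in> gl_part 0" by (simp add: gl_part_iff scomm_entries)
  have CD: "\<rho> gC UNIV (\<rho> gD UNIV F) + \<rho> gD UNIV (\<rho> gC UNIV F) = section_deriv (scomm gC gD) UNIV F"
    if "F \<in> superfunctions Sh UNIV" for F
    using RTLSG_bracket[OF \<rho> odd(1) odd(2) open_UNIV that] RTLSG_even[OF \<rho> I open_UNIV that]
    by (simp add: even_action_def scomm_entries) (simp add: fun_eq_iff ext_eq_iff)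
  have sd: "section_deriv (scomm gC gD) UNIV (tens fst 1) 0 = 1" "section_deriv (scomm gC gD) UNIV (tens snd 1) 0 = 1"
    "section_deriv (scomm gC gD) UNIV (\<lambda>_. \<omega>) 0 = 0" for \<omega>
    by (simp_all add: section_deriv_def tens_def ext_eq_iff left_inv_deriv_const left_inv_deriv_fst
        left_inv_deriv_snd scomm_entries)
  note CC0 = gens[THEN CC, THEN fun_cong, of 0] and DD0 = gens[THEN DD, THEN fun_cong, of 0]
    and CD0 = gens[THEN CD, THEN fun_cong, of 0]
  note eqs = CC0[unfolded C Cw weight_section_zero value_at_unit_odd_field ext_eq_iff, simplified]
    DD0[unfolded D Dw weight_section_zero value_at_unit_odd_field ext_eq_iff, simplified]
    CD0[unfolded C D Cw Dw sd plus_fun_apply weight_section_zero value_at_unit_odd_field ext_eq_iff, simplified]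
  have nondeg: "\<gamma> = 0 \<and> \<delta> = 0"
    if "a * \<gamma> + b * \<delta> = 0" "c * \<gamma> + d * \<delta> = 0"
      "(e - (X2 - Y2)) * \<gamma> + (g - (X1 - Y1)) * \<delta> = 0" "(h - (Z2 - W2)) * \<gamma> + (i - (Z1 - W1)) * \<delta> = 0" for \<gamma> \<delta>
  proof -
    let ?F = "weight_section 0 (Ext 0 \<gamma> \<delta> 0)"
    have F: "?F \<in> superfunctions Sh UNIV" by (rule weight_section_in)
    have z: "weight_section j (Ext 0 0 0 0) = 0" for j by (auto simp: weight_section_def zero_ext_def)
    have "\<rho> gC UNIV ?F = weight_section (1 + 0) (Ext 0 0 0 0)"
      unfolding Cw using that by (simp add: value_at_unit_odd_field algebra_simps)
    moreover have "\<rho> gD UNIV ?F = weight_section (-1 + 0) (Ext 0 0 0 0)"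
      unfolding Dw using that by (simp add: value_at_unit_odd_field algebra_simps)
    ultimately have CD: "\<rho> gC UNIV ?F = 0" "\<rho> gD UNIV ?F = 0" by (simp_all add: z)
    have "\<rho> X UNIV ?F = 0" for X
    proof -
      have E: "even_comp X \<in> gl_part 0" by (simp add: gl_part_iff)
      have "X = even_comp X + ((\<chi> i j. X$1$2 * gC$i$j) + (\<chi> i j. X$2$1 * gD$i$j))"
        by (simp add: mat_eq_iff)
      then have "\<rho> X UNIV ?F = \<rho> (even_comp X) UNIV ?F + (smul (X$1$2) (\<rho> gC UNIV ?F) + smul (X$2$1) (\<rho> gD UNIV ?F))"
        by (metis RTLSG_linear[OF \<rho> open_UNIV F])
      then show ?thesis using RTLSG_even[OF \<rho> E open_UNIV F] CD
        by (simp add: even_action_weight_section) (simp add: smul_def fun_eq_iff ext_eq_iff)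
    qed
    then obtain l where "?F = tens (indicator UNIV) (scal l 1)"
      using \<rho> F open_UNIV convex_connected[OF convex_UNIV] unfolding RTLSG_def by blast
    from fun_cong[OF this, of 0] show ?thesis by (simp add: tens_one ext_eq_iff)
  qed
  have "\<exists>p q P Q. X1 = b * p \<and> X2 = - (a * p) \<and> Y1 = b * q \<and> Y2 = - (a * q) \<and>
    Z1 = d * P \<and> Z2 = - (c * P) \<and> W1 = d * Q \<and> W2 = - (c * Q) \<and>
    (a * d - b * c) * (P - p) = 1 \<and> (a * d - b * c) * (Q - q) = 1 \<and>
    e = 0 \<and> g = 2 * b * (p - q) \<and> h = - (2 * c * (P - Q)) \<and> i = 0"
    by (rule structure_equations[OF refl refl refl refl _ _ _ _ _ _ _ _ _ _ _ _ _ _ _ _ _ _ nondeg])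
      (use eqs in \<open>simp_all add: algebra_simps\<close>)
  then obtain p q P Q where pq: "X1 = b * p" "X2 = - (a * p)" "Y1 = b * q" "Y2 = - (a * q)"
    "Z1 = d * P" "Z2 = - (c * P)" "W1 = d * Q" "W2 = - (c * Q)"
    "(a * d - b * c) * (P - p) = 1" "(a * d - b * c) * (Q - q) = 1"
    "e = 0" "g = 2 * b * (p - q)" "h = - (2 * c * (P - Q))" "i = 0" by blast
  show thesis
    by (rule that[of b p a q d P c Q]) (use C D pq in simp_all)
qed

section \<open>Contractions twisted by an even vector field\<close>

text \<open>For \<open>\<iota> = m \<partial>\<^sub>\<xi> + n \<partial>\<^sub>\<eta>\<close> with \<open>\<xi> = C\<^sup>*\<close>, \<open>\<eta> = D\<^sup>*\<close> this is \<open>exp (\<xi>\<eta>V) \<iota> exp (- \<xi>\<eta>V)\<close>. Indeed \<open>exp (\<plusminus> \<xi>\<eta>V) = 1 \<plusminus> \<xi>\<eta>V\<close>, the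
  first factor to act changes the coefficient \<open>f\<^sub>3\<close> of \<open>\<xi>\<eta>\<close> to \<open>f\<^sub>3 - V f\<^sub>0\<close>, and the last one adds \<open>V (m f\<^sub>1 + n f\<^sub>2) \<xi>\<eta>\<close>.\<close>

definition contraction_field :: "('k \<times> 'k \<Rightarrow> 'k) \<Rightarrow> ('k \<times> 'k \<Rightarrow> 'k) \<Rightarrow> 'k^2^2 \<Rightarrow> 'k sheaf_op" where
  "contraction_field m n V U F = (\<lambda>x. Ext (m x * x_C (F x) + n x * x_D (F x))
    (n x * (left_inv_deriv V U (\<lambda>x. x_one (F x)) x - x_CD (F x)))
    (- (m x * (left_inv_deriv V U (\<lambda>x. x_one (F x)) x - x_CD (F x))))
    (left_inv_deriv V U (\<lambda>x. m x * x_C (F x) + n x * x_D (F x)) x))"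

lemma super_field_contraction:
  assumes U: "open U" and F: "F \<in> superfunctions Sh U" and mn: "m \<in> Sh UNIV" "n \<in> Sh UNIV"
  shows "super_field (\<lambda>x. Ext 0 (V$1$1 * n x) (- (V$1$1 * m x)) 0) (\<lambda>x. Ext 0 (V$2$2 * n x) (- (V$2$2 * m x)) 0)
    (\<lambda>x. Ext (m x) 0 0 (left_inv_deriv V UNIV m x)) (\<lambda>x. Ext (n x) 0 0 (left_inv_deriv V UNIV n x)) U F
    = contraction_field m n V U F"
proof
  fix x
  have f: "(\<lambda>x. x_one (F x)) \<in> Sh U" "(\<lambda>x. x_C (F x)) \<in> Sh U" "(\<lambda>x. x_D (F x)) \<in> Sh U"
    using F by (simp_all add: superfunctions_iff)
  show "super_field (\<lambda>x. Ext 0 (V$1$1 * n x) (- (V$1$1 * m x)) 0) (\<lambda>x. Ext 0 (V$2$2 * n x) (- (V$2$2 * m x)) 0)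
    (\<lambda>x. Ext (m x) 0 0 (left_inv_deriv V UNIV m x)) (\<lambda>x. Ext (n x) 0 0 (left_inv_deriv V UNIV n x)) U F x
    = contraction_field m n V U F x"
    using U mn f f[THEN left_inv_deriv_entries[OF U], of V x]
    by (simp add: contraction_field_def super_field_def section_deriv_def odd_deriv_C_def odd_deriv_D_def ext_eq_iff
        left_inv_deriv_add mult_global_in left_inv_deriv_mult_global algebra_simps)
qed

lemma contraction_field_in:
  assumes "open U" "F \<in> superfunctions Sh U" "m \<in> Sh UNIV" "n \<in> Sh UNIV"
  shows "contraction_field m n V U F \<in> superfunctions Sh U"
  using assms by (simp add: superfunctions_iff contraction_field_def left_inv_deriv_in add_in diff_in uminus_in mult_global_in)

lemma contraction_field_linear:
  assumes "open U" "F \<in> superfunctions Sh U" "G \<in> superfunctions Sh U" "m \<in> Sh UNIV" "n \<in> Sh UNIV"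
  shows "contraction_field m n V U (smul r F + smul s G) = smul r (contraction_field m n V U F) + smul s (contraction_field m n V U G)"
  using assms by (simp add: super_field_contraction[symmetric] superfunctions_smul superfunctions_add super_field_linear)

text \<open>The square of a contraction is zero, and so is its conjugate.\<close>

lemma contraction_field_square:
  "contraction_field m n V U (contraction_field m n V U F) = 0"
proof
  fix x
  have "(\<lambda>x. m x * x_C (contraction_field m n V U F x) + n x * x_D (contraction_field m n V U F x)) = (\<lambda>_. 0)"
    by (auto simp: contraction_field_def algebra_simps)
  from this fun_cong[OF this, of x] show "contraction_field m n V U (contraction_field m n V U F) x = 0 x"
    by (simp add: contraction_field_def[of m n V U "contraction_field m n V U F"] ext_eq_iff left_inv_deriv_const)
      (simp add: contraction_field_def)
qed

text \<open>Conjugating by \<open>exp (\<xi>\<eta>V)\<close> reduces to the case \<open>V = 0\<close>, \<open>W = l E\<close>. As \<open>E\<close> commutes with both contractions, the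
  second field becomes \<open>\<iota>' - l \<iota>'(\<xi>\<eta>) E\<close>, whose anticommutator with \<open>\<iota>\<close> is \<open>- l \<iota>(\<iota>'(\<xi>\<eta>)) E = l K E\<close>. Conjugating back
  changes nothing because \<open>V\<close> and \<open>E\<close> commute. The proof compares coefficients.\<close>

lemma contraction_field_anticommute:
  assumes U: "open U" and F: "F \<in> superfunctions Sh U"
    and sh: "m \<in> Sh UNIV" "n \<in> Sh UNIV" "m' \<in> Sh UNIV" "n' \<in> Sh UNIV"
    and K: "\<And>x. m x * n' x - n x * m' x = K" "K * l = 1"
    and VW: "W$1$1 = V$1$1 + l" "W$2$2 = V$2$2 + l" and E: "E$1$1 = 1" "E$2$2 = 1"
    and inv: "\<And>x. left_inv_deriv E UNIV m x = 0" "\<And>x. left_inv_deriv E UNIV n x = 0"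
      "\<And>x. left_inv_deriv E UNIV m' x = 0" "\<And>x. left_inv_deriv E UNIV n' x = 0"
  shows "contraction_field m n V U (contraction_field m' n' W U F) + contraction_field m' n' W U (contraction_field m n V U F)
    = section_deriv E U F"
proof
  fix x
  define f0 f1 f2 f3 where "f0 = (\<lambda>x. x_one (F x))" and "f1 = (\<lambda>x. x_C (F x))"
    and "f2 = (\<lambda>x. x_D (F x))" and "f3 = (\<lambda>x. x_CD (F x))"
  have f: "f0 \<in> Sh U" "f1 \<in> Sh U" "f2 \<in> Sh U" "f3 \<in> Sh U"
    using F by (auto simp: superfunctions_iff f0_def f1_def f2_def f3_def)
  have fold: "x_one (F x) = f0 x" "x_C (F x) = f1 x" "x_D (F x) = f2 x" "x_CD (F x) = f3 x" for x
    by (simp_all add: f0_def f1_def f2_def f3_def)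
  define M N S T where "M = (\<lambda>x. m x * f1 x + n x * f2 x)" and "N = (\<lambda>x. m' x * f1 x + n' x * f2 x)"
    and "S = (\<lambda>x. left_inv_deriv W U f0 x - f3 x)" and "T = (\<lambda>x. left_inv_deriv V U f0 x - f3 x)"
  note in_rules = left_inv_deriv_in add_in diff_in cmult_in uminus_in mult_global_in
  have MN: "M \<in> Sh U" "N \<in> Sh U" "S \<in> Sh U" "T \<in> Sh U"
    using U f sh by (simp_all add: M_def N_def S_def T_def in_rules)
  have W: "left_inv_deriv W U f x = left_inv_deriv V U f x + l * left_inv_deriv E U f x" if "f \<in> Sh U" for f
    using left_inv_deriv_entries[OF U that, of W x] left_inv_deriv_entries[OF U that, of V x]
      left_inv_deriv_entries[OF U that, of E x] VW E by (simp add: algebra_simps)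
  have C: "contraction_field m n V U F = (\<lambda>x. Ext (M x) (n x * T x) (- (m x * T x)) (left_inv_deriv V U M x))"
    and D: "contraction_field m' n' W U F = (\<lambda>x. Ext (N x) (n' x * S x) (- (m' x * S x)) (left_inv_deriv W U N x))"
    by (simp_all add: contraction_field_def fold M_def N_def S_def T_def)
  have one: "(\<lambda>x. m x * (n' x * S x) + n x * - (m' x * S x)) = (\<lambda>x. K * S x)"
    "(\<lambda>x. m' x * (n x * T x) + n' x * - (m x * T x)) = (\<lambda>x. - K * T x)"
    using K(1) by (auto simp: algebra_simps simp flip: K(1))
  have CD: "contraction_field m n V U (contraction_field m' n' W U F) x =
      Ext (K * S x) (- (n x * (l * left_inv_deriv E U N x))) (m x * (l * left_inv_deriv E U N x)) (K * left_inv_deriv V U S x)"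
    unfolding D contraction_field_def[of m n] ext.sel one fun_cong[OF one(1)]
    using U MN by (simp add: left_inv_deriv_cmult W)
  have DC: "contraction_field m' n' W U (contraction_field m n V U F) x =
      Ext (- K * T x) (n' x * (l * left_inv_deriv E U M x)) (- (m' x * (l * left_inv_deriv E U M x))) (- K * left_inv_deriv W U T x)"
    unfolding C contraction_field_def[of m' n'] ext.sel one fun_cong[OF one(2)]
    using U MN left_inv_deriv_cmult[of U T W "- K"] by (simp add: W)
  have EM: "left_inv_deriv E U M x = m x * left_inv_deriv E U f1 x + n x * left_inv_deriv E U f2 x"
    and EN: "left_inv_deriv E U N x = m' x * left_inv_deriv E U f1 x + n' x * left_inv_deriv E U f2 x"
    using U f sh by (simp_all add: M_def N_def left_inv_deriv_add left_inv_deriv_mult_global inv in_rules)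
  have VS: "left_inv_deriv V U S x = left_inv_deriv V U (left_inv_deriv W U f0) x - left_inv_deriv V U f3 x"
    and WT: "left_inv_deriv W U T x = left_inv_deriv V U (left_inv_deriv W U f0) x - left_inv_deriv W U f3 x"
    using U f left_inv_deriv_commute[OF U f(1), of V W x]
    by (simp_all add: S_def T_def left_inv_deriv_diff in_rules)
  have "K * (S x - T x) = left_inv_deriv E U f0 x"
    using K(2) by (simp add: S_def T_def W[OF f(1)] mult.assoc[symmetric])
  moreover have "n' x * (l * left_inv_deriv E U M x) - n x * (l * left_inv_deriv E U N x) = left_inv_deriv E U f1 x"
    using K(2) K(1)[of x] unfolding EM EN by algebra
  moreover have "m x * (l * left_inv_deriv E U N x) - m' x * (l * left_inv_deriv E U M x) = left_inv_deriv E U f2 x"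
    using K(2) K(1)[of x] unfolding EM EN by algebra
  moreover have "K * left_inv_deriv V U S x - K * left_inv_deriv W U T x = left_inv_deriv E U f3 x"
    using K(2) W[OF f(4)] unfolding VS WT by algebra
  ultimately show "(contraction_field m n V U (contraction_field m' n' W U F)
      + contraction_field m' n' W U (contraction_field m n V U F)) x = section_deriv E U F x"
    by (simp add: CD DC section_deriv_def fold ext_eq_iff algebra_simps)
qed

lemma even_action_in: "open U \<Longrightarrow> F \<in> superfunctions Sh U \<Longrightarrow> even_action X U F \<in> superfunctions Sh U"
  by (simp add: superfunctions_iff even_action_def section_deriv_def left_inv_deriv_in add_in diff_in cmult_in uminus_in)

lemma even_action_linear:
  assumes "open U" "F \<in> superfunctions Sh U" "G \<in> superfunctions Sh U"
  shows "even_action X U (smul r F + smul s G) = smul r (even_action X U F) + smul s (even_action X U G)"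
  using assms by (simp add: super_field_even[symmetric] superfunctions_smul superfunctions_add super_field_linear)

lemma even_action_commute:
  assumes U: "open U" and F: "F \<in> superfunctions Sh U"
  shows "even_action X U (even_action Y U F) = even_action Y U (even_action X U F)"
proof
  fix x
  show "even_action X U (even_action Y U F) x = even_action Y U (even_action X U F) x"
    using U F left_inv_deriv_commute[OF U, of _ X Y x]
    by (simp add: superfunctions_iff even_action_def section_deriv_def left_inv_deriv_in add_in diff_in cmult_in uminus_in
        left_inv_deriv_add left_inv_deriv_diff left_inv_deriv_cmult left_inv_deriv_uminus ext_eq_iff)
      (simp add: algebra_simps)
qed

text \<open>The derivations \<open>\<partial>\<^sub>\<xi>\<close> and \<open>\<partial>\<^sub>\<eta>\<close> have weights \<open>1\<close> and \<open>-1\<close>; the weights of \<open>m\<close> and \<open>n\<close> have to compensate for this to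
  make the contraction homogeneous.\<close>

lemma even_action_contraction_field:
  assumes U: "open U" and F: "F \<in> superfunctions Sh U" and sh: "m \<in> Sh UNIV" "n \<in> Sh UNIV"
    and m: "\<And>x. left_inv_deriv X UNIV m x = (l - (X$1$1 - X$2$2)) * m x"
    and n: "\<And>x. left_inv_deriv X UNIV n x = (l + (X$1$1 - X$2$2)) * n x"
  shows "even_action X U (contraction_field m n V U F) =
    contraction_field m n V U (even_action X U F) + smul l (contraction_field m n V U F)"
proof
  fix x
  define f0 f1 f2 f3 where "f0 = (\<lambda>x. x_one (F x))" and "f1 = (\<lambda>x. x_C (F x))"
    and "f2 = (\<lambda>x. x_D (F x))" and "f3 = (\<lambda>x. x_CD (F x))"
  have f: "f0 \<in> Sh U" "f1 \<in> Sh U" "f2 \<in> Sh U" "f3 \<in> Sh U"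
    using F by (auto simp: superfunctions_iff f0_def f1_def f2_def f3_def)
  have fold: "x_one (F x) = f0 x" "x_C (F x) = f1 x" "x_D (F x) = f2 x" "x_CD (F x) = f3 x" for x
    by (simp_all add: f0_def f1_def f2_def f3_def)
  define k where "k = X$1$1 - X$2$2"
  define M T where "M = (\<lambda>x. m x * f1 x + n x * f2 x)" and "T = (\<lambda>x. left_inv_deriv V U f0 x - f3 x)"
  note in_rules = left_inv_deriv_in add_in diff_in cmult_in uminus_in mult_global_in
  have MT: "M \<in> Sh U" "T \<in> Sh U"
    using U f sh by (simp_all add: M_def T_def in_rules)
  have C: "contraction_field m n V U F = (\<lambda>x. Ext (M x) (n x * T x) (- (m x * T x)) (left_inv_deriv V U M x))"
    by (simp add: contraction_field_def fold M_def T_def)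
  have XF: "even_action X U F = (\<lambda>x. Ext (left_inv_deriv X U f0 x) (left_inv_deriv X U f1 x - k * f1 x)
      (left_inv_deriv X U f2 x + k * f2 x) (left_inv_deriv X U f3 x))"
    by (auto simp: even_action_def section_deriv_def fold ext_eq_iff k_def)
  have M: "m x * (left_inv_deriv X U f1 x - k * f1 x) + n x * (left_inv_deriv X U f2 x + k * f2 x) =
      left_inv_deriv X U M x - l * M x" for x
    using U f sh by (simp add: M_def left_inv_deriv_add left_inv_deriv_mult_global in_rules m n k_def)
      (simp add: algebra_simps)
  have T: "left_inv_deriv V U (left_inv_deriv X U f0) x - left_inv_deriv X U f3 x = left_inv_deriv X U T x"
    using U f left_inv_deriv_commute[OF U f(1), of V X x] by (simp add: T_def left_inv_deriv_diff in_rules)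
  have CX: "contraction_field m n V U (even_action X U F) x = Ext (left_inv_deriv X U M x - l * M x) (n x * left_inv_deriv X U T x)
      (- (m x * left_inv_deriv X U T x)) (left_inv_deriv V U (left_inv_deriv X U M) x - l * left_inv_deriv V U M x)"
    using U MT by (simp add: XF contraction_field_def M T left_inv_deriv_diff left_inv_deriv_cmult in_rules)
  show "even_action X U (contraction_field m n V U F) x =
      (contraction_field m n V U (even_action X U F) + smul l (contraction_field m n V U F)) x"
    using U MT sh left_inv_deriv_commute[OF U MT(1), of V X x]
    by (simp add: CX, simp add: C even_action_def section_deriv_def smul_def ext_eq_iff left_inv_deriv_uminus
        left_inv_deriv_mult_global in_rules m n)
      (simp add: algebra_simps)
qed

lemma contraction_field_kernel:
  assumes "contraction_field m n V U F x = 0" "contraction_field m' n' W U F x = 0"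
    and K: "m x * n' x - n x * m' x \<noteq> 0"
  shows "x_C (F x) = 0" "x_D (F x) = 0" "x_CD (F x) = left_inv_deriv V U (\<lambda>x. x_one (F x)) x"
proof -
  note e = assms(1,2)[unfolded contraction_field_def ext_eq_iff, simplified]
  let ?K = "m x * n' x - n x * m' x"
  have "?K * x_C (F x) = 0" "?K * x_D (F x) = 0" using e by algebra+
  then show "x_C (F x) = 0" "x_D (F x) = 0" using K by auto
  have "\<not> (m x = 0 \<and> n x = 0)" using K by auto
  then show "x_CD (F x) = left_inv_deriv V U (\<lambda>x. x_one (F x)) x" using e by auto
qed

section \<open>The structure with given parameters\<close>

text \<open>The covectors \<open>(a, b v\<^sup>2)\<close> and \<open>(c v\<^sup>-\<^sup>2, d)\<close> are the only ones of the weights of \<open>C\<close> and \<open>D\<close> with the prescribed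
  values at the unit. Their determinant \<open>a d - b c\<close> is constant.\<close>

definition act_C :: "'k parameters \<Rightarrow> 'k sheaf_op" where
  "act_C t = contraction_field (\<lambda>_. pc_C t) (\<lambda>x. pc_D t * antidiag_char 2 x) (mat2 (pcz t) 0 0 (pcw t))"

definition act_D :: "'k parameters \<Rightarrow> 'k sheaf_op" where
  "act_D t = contraction_field (\<lambda>x. pd_C t * antidiag_char (-2) x) (\<lambda>_. pd_D t) (mat2 (pdz t) 0 0 (pdw t))"

definition act :: "'k parameters \<Rightarrow> 'k^2^2 \<Rightarrow> 'k sheaf_op" where
  "act t X U F = even_action X U F + (smul (X$1$2) (act_C t U F) + smul (X$2$1) (act_D t U F))"

lemma antidiag_char_cmult_in:
  "(\<lambda>x. c * antidiag_char j x) \<in> Sh UNIV"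
  by (simp add: cmult_in)

lemma act_C_D_in:
  assumes "open U" "F \<in> superfunctions Sh U"
  shows "act_C t U F \<in> superfunctions Sh U" "act_D t U F \<in> superfunctions Sh U"
  using assms by (simp_all add: act_C_def act_D_def contraction_field_in antidiag_char_cmult_in)

lemma act_C_D_eq_super_field:
  assumes "open U" "F \<in> superfunctions Sh U"
  shows "act_C t U F = super_field (weight_section 1 (Ext 0 (pc_D t * pcz t) (- (pc_C t * pcz t)) 0))
      (weight_section 1 (Ext 0 (pc_D t * pcw t) (- (pc_C t * pcw t)) 0)) (weight_section 0 (Ext (pc_C t) 0 0 0))
      (weight_section 2 (Ext (pc_D t) 0 0 (2 * pc_D t * (pcz t - pcw t)))) U F"
    "act_D t U F = super_field (weight_section (-1) (Ext 0 (pd_D t * pdz t) (- (pd_C t * pdz t)) 0))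
      (weight_section (-1) (Ext 0 (pd_D t * pdw t) (- (pd_C t * pdw t)) 0))
      (weight_section (-2) (Ext (pd_C t) 0 0 (- (2 * pd_C t * (pdz t - pdw t))))) (weight_section 0 (Ext (pd_D t) 0 0 0)) U F"
  unfolding act_C_def act_D_def using assms
  by (simp_all add: super_field_contraction[symmetric] antidiag_char_cmult_in left_inv_deriv_const
      left_inv_deriv_cmult left_inv_deriv_antidiag_char weight_section_def algebra_simps)

lemma super_field_sum:
  "super_field (\<lambda>x. X x + (scal r (X' x) + scal s (X'' x))) (\<lambda>x. Y x + (scal r (Y' x) + scal s (Y'' x)))
    (\<lambda>x. \<Xi> x + (scal r (\<Xi>' x) + scal s (\<Xi>'' x))) (\<lambda>x. H x + (scal r (H' x) + scal s (H'' x))) U F =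
  super_field X Y \<Xi> H U F + (smul r (super_field X' Y' \<Xi>' H' U F) + smul s (super_field X'' Y'' \<Xi>'' H'' U F))"
proof -
  have "scal r \<omega> * \<eta> = scal r (\<omega> * \<eta>)" for r and \<omega> \<eta> :: "'k ext" by (auto simp: ext_eq_iff algebra_simps)
  then show ?thesis by (auto simp: super_field_def smul_def scal_distrib algebra_simps)
qed

lemma as_morphism_cong:
  "(\<And>U F. open U \<Longrightarrow> F \<in> superfunctions Sh U \<Longrightarrow> S U F = T U F) \<Longrightarrow> as_morphism S = as_morphism T"
  by (intro ext) (simp add: as_morphism_def restrict_def)

text \<open>Super vector fields depend linearly on their coefficients. This also covers matrices that are not
  homogeneous, which act by sheaf endomorphisms without being superderivations of one degree.\<close>

lemma act_super_field:
  obtains A B G H where "as_morphism (act t X) = as_morphism (super_field A B G H)"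
    "A \<in> superfunctions Sh UNIV" "B \<in> superfunctions Sh UNIV" "G \<in> superfunctions Sh UNIV" "H \<in> superfunctions Sh UNIV"
    "\<And>p x. X \<in> gl_part p \<Longrightarrow> A x \<in> ext_part p \<and> B x \<in> ext_part p \<and> G x \<in> ext_part (Suc p) \<and> H x \<in> ext_part (Suc p)"
proof -
  note in_rules = superfunctions_const weight_section_in
  have sum_in: "(\<lambda>x. F x + (scal r (G x) + scal s (H x))) \<in> superfunctions Sh UNIV"
    if "F \<in> superfunctions Sh UNIV" "G \<in> superfunctions Sh UNIV" "H \<in> superfunctions Sh UNIV" for F G H r s
    using that by (simp add: superfunctions_iff add_in cmult_in)
  show thesis
    by (rule that, rule as_morphism_cong, unfold act_def act_C_D_eq_super_field super_field_even[symmetric],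
        rule super_field_sum[symmetric], (rule sum_in; rule in_rules)+)
      (auto simp: ext_part_def gl_part_iff weight_section_def split: if_splits)
qed

lemma act_linear:
  assumes "open U" "F \<in> superfunctions Sh U"
  shows "act t (X + Y) U F = act t X U F + act t Y U F"
    and "act t (\<chi> i j. a * X$i$j) U F = smul a (act t X U F)"
proof -
  have "even_action (X + Y) U F = even_action X U F + even_action Y U F"
    "even_action (\<chi> i j. a * X$i$j) U F = smul a (even_action X U F)"
    using assms by (auto simp: superfunctions_iff even_action_def section_deriv_def smul_def fun_eq_iff ext_eq_iff
        left_inv_deriv_entries[of U _ "X + Y"] left_inv_deriv_entries[of U _ "\<chi> i j. a * X$i$j"]
        left_inv_deriv_entries[of U _ X] left_inv_deriv_entries[of U _ Y] algebra_simps)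
  then show "act t (X + Y) U F = act t X U F + act t Y U F"
    "act t (\<chi> i j. a * X$i$j) U F = smul a (act t X U F)"
    by (auto simp: act_def smul_def fun_eq_iff ext_eq_iff algebra_simps)
qed

lemma act_bracket:
  assumes t: "admissible t" and U: "open U" and F: "F \<in> superfunctions Sh U"
    and X: "X \<in> gl_part p" and Y: "Y \<in> gl_part q"
  shows "act t (scomm X Y) U F = act t X U (act t Y U F) - (- 1) ^ (p * q) * act t Y U (act t X U F)"
proof -
  note CD_in = act_C_D_in[OF U F, of t]
  let ?C = "act_C t U F" and ?D = "act_D t U F"
  have C_lin: "act_C t U (smul r G + smul s H) = smul r (act_C t U G) + smul s (act_C t U H)"
    and D_lin: "act_D t U (smul r G + smul s H) = smul r (act_D t U G) + smul s (act_D t U H)"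
    if "G \<in> superfunctions Sh U" "H \<in> superfunctions Sh U" for r s G H
    using U that by (simp_all add: act_C_def act_D_def contraction_field_linear antidiag_char_cmult_in)
  have even_C: "even_action Z U ?C = act_C t U (even_action Z U F) + smul (Z$1$1 - Z$2$2) ?C"
    and even_D: "even_action Z U ?D = act_D t U (even_action Z U F) + smul (Z$2$2 - Z$1$1) ?D" for Z
    unfolding act_C_def act_D_def
    by (rule even_action_contraction_field[OF U F];
        simp add: antidiag_char_cmult_in left_inv_deriv_const left_inv_deriv_cmult left_inv_deriv_antidiag_char algebra_simps)+
  have sq: "act_C t U ?C = 0" "act_D t U ?D = 0"
    by (simp_all add: act_C_def act_D_def contraction_field_square)
  have anti: "act_C t U ?D + act_D t U ?C = section_deriv (mat2 1 0 0 1) U F"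
  proof -
    define K where "K = pc_C t * pd_D t - pc_D t * pd_C t"
    define l where "l = pdz t - pcz t"
    have l: "K * l = 1" "pdw t = pcw t + l" "pdz t = pcz t + l"
    proof -
      have adm: "K * (pdz t - pcz t) = 1" "K * (pdw t - pcw t) = 1"
        using t by (simp_all add: admissible_def det_2 K_def)
      then show "K * l = 1" "pdz t = pcz t + l" by (simp_all add: l_def)
      have "K \<noteq> 0" using adm by auto
      moreover have "K * (pdw t - pcw t) = K * l" using adm by (simp add: l_def)
      ultimately have "pdw t - pcw t = l" by simp
      then show "pdw t = pcw t + l" by (simp add: diff_eq_eq add.commute)
    qed
    have v: "antidiag_char 2 x * antidiag_char (-2) x = 1" for x by (simp add: antidiag_char_mult)
    have K: "pc_C t * pd_D t - pc_D t * antidiag_char 2 x * (pd_C t * antidiag_char (- 2) x) = K" for x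
    proof -
      have "pc_D t * antidiag_char 2 x * (pd_C t * antidiag_char (- 2) x) = pc_D t * pd_C t * (antidiag_char 2 x * antidiag_char (-2) x)"
        by (simp only: ac_simps)
      then show ?thesis by (simp add: K_def v)
    qed
    show ?thesis
      unfolding act_C_def act_D_def
      by (rule contraction_field_anticommute[OF U F, where K = K and l = l])
        (simp_all add: antidiag_char_cmult_in left_inv_deriv_const left_inv_deriv_cmult left_inv_deriv_antidiag_char K l)
  qed
  have act_even: "act t Z U G = even_action Z U G" if "Z \<in> gl_part 0" for Z G
    using that by (auto simp: act_def gl_part_iff smul_def fun_eq_iff ext_eq_iff)
  have act_odd: "act t Z U G = smul (Z$1$2) (act_C t U G) + smul (Z$2$1) (act_D t U G)"
    if "Z \<in> gl_part 1" "G \<in> superfunctions Sh U" for Z G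
    using that left_inv_deriv_entries[OF U, of _ Z] by (auto simp: act_def even_action_def section_deriv_def gl_part_iff smul_def
        fun_eq_iff ext_eq_iff superfunctions_iff)
  have gl0: "gl_part n = gl_part 0" if "even n" for n using that by (simp add: gl_part_def)
  have gl1: "gl_part n = gl_part 1" if "odd n" for n using that by (simp add: gl_part_def)
  have lin_in: "smul r ?C + smul s ?D \<in> superfunctions Sh U" for r s
    using U CD_in by (simp add: superfunctions_add superfunctions_smul)
  have mixed: "even_action X' U (smul r ?C + smul s ?D) =
      (smul r (act_C t U (even_action X' U F)) + smul s (act_D t U (even_action X' U F)))
      + (smul ((X'$1$1 - X'$2$2) * r) ?C + smul ((X'$2$2 - X'$1$1) * s) ?D)" for X' r s
    using CD_in by (simp add: even_action_linear[OF U] even_C even_D) (auto simp: smul_def fun_eq_iff ext_eq_iff algebra_simps)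
  show ?thesis
  proof (cases "even p"; cases "even q")
    assume pq: "even p" "even q"
    then have "X \<in> gl_part 0" "Y \<in> gl_part 0" using X Y gl0 by auto
    moreover from this have Z: "scomm X Y = (\<chi> i j. 0 * gA$i$j)"
      by (simp add: gl_part_iff mat_eq_iff scomm_entries)
    have "act t (scomm X Y) U F = 0"
      unfolding Z act_linear(2)[OF U F] by (simp add: smul_def fun_eq_iff ext_eq_iff)
    ultimately show ?thesis using pq U F
      by (simp add: act_even even_action_commute[of U F X Y])
  next
    assume pq: "even p" "odd q"
    then have X': "X \<in> gl_part 0" and Y': "Y \<in> gl_part 1" using X Y gl0 gl1 by auto
    then have Z: "scomm X Y \<in> gl_part 1" "scomm X Y $ 1 $ 2 = (X$1$1 - X$2$2) * Y$1$2" "scomm X Y $ 2 $ 1 = (X$2$2 - X$1$1) * Y$2$1"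
      by (simp_all add: gl_part_iff scomm_entries)
    show ?thesis using pq U F
      by (simp add: act_even[OF X'] act_odd[OF Y'] act_odd[OF Z(1)] Z(2,3) even_action_in mixed)
  next
    assume pq: "odd p" "even q"
    then have X': "X \<in> gl_part 1" and Y': "Y \<in> gl_part 0" using X Y gl0 gl1 by auto
    then have Z: "scomm X Y \<in> gl_part 1" "scomm X Y $ 1 $ 2 = - ((Y$1$1 - Y$2$2) * X$1$2)" "scomm X Y $ 2 $ 1 = - ((Y$2$2 - Y$1$1) * X$2$1)"
      by (simp_all add: gl_part_iff scomm_entries)
    show ?thesis using pq U F
      by (simp add: act_even[OF Y'] act_odd[OF X'] act_odd[OF Z(1)] Z(2,3) even_action_in mixed)
        (auto simp: smul_def fun_eq_iff ext_eq_iff algebra_simps)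
  next
    assume pq: "odd p" "odd q"
    then have X': "X \<in> gl_part 1" and Y': "Y \<in> gl_part 1" using X Y gl1 by auto
    let ?l = "X$1$2 * Y$2$1 + Y$1$2 * X$2$1"
    have Z: "scomm X Y = (\<chi> i j. ?l * mat2 1 0 0 1 $ i $ j)"
      using X' Y' by (simp add: gl_part_iff mat_eq_iff scomm_entries)
    have I: "mat2 1 0 0 1 \<in> gl_part 0" by (simp add: gl_part_iff)
    have "act t (scomm X Y) U F = smul ?l (act_C t U ?D + act_D t U ?C)"
      unfolding Z act_linear(2)[OF U F] act_even[OF I] anti
      by (auto simp: even_action_def smul_def fun_eq_iff ext_eq_iff)
    also have "\<dots> = act t X U (act t Y U F) + act t Y U (act t X U F)"
      unfolding act_odd[OF X' F] act_odd[OF Y' F] act_odd[OF X' lin_in] act_odd[OF Y' lin_in] C_lin[OF CD_in] D_lin[OF CD_in] sq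
      by (auto simp: smul_def fun_eq_iff ext_eq_iff algebra_simps)
    finally show ?thesis using pq by simp
  qed
qed

definition action :: "'k parameters \<Rightarrow> 'k^2^2 \<Rightarrow> 'k sheaf_op" where
  "action t X = as_morphism (act t X)"

lemma action_apply: "open U \<Longrightarrow> F \<in> superfunctions Sh U \<Longrightarrow> action t X U F = act t X U F"
  by (simp add: action_def as_morphism_apply)

lemma action_sheaf_endo: "action t X \<in> sheaf_endos Sh"
  using act_super_field[of t X] super_field_sheaf_endo unfolding action_def by metis

lemma action_superderivation: "X \<in> gl_part p \<Longrightarrow> action t X \<in> superderivations Sh p"
proof -
  assume X: "X \<in> gl_part p"
  obtain A B G H where "as_morphism (act t X) = as_morphism (super_field A B G H)"
    "A \<in> superfunctions Sh UNIV" "B \<in> superfunctions Sh UNIV" "G \<in> superfunctions Sh UNIV" "H \<in> superfunctions Sh UNIV"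
    "\<And>x. A x \<in> ext_part p \<and> B x \<in> ext_part p \<and> G x \<in> ext_part (Suc p) \<and> H x \<in> ext_part (Suc p)"
    by (rule act_super_field[of t X]) (use X in blast)
  then show ?thesis unfolding action_def
    by (auto intro!: super_field_superderivation simp: superfunctions_part_def)
qed

lemma act_in: "open U \<Longrightarrow> F \<in> superfunctions Sh U \<Longrightarrow> act t X U F \<in> superfunctions Sh U"
  unfolding act_def by (intro superfunctions_add superfunctions_smul even_action_in act_C_D_in)

text \<open>Invariance under \<open>A\<close> and \<open>B\<close> makes the function part constant on a connected set. The contractions \<open>C\<close> and \<open>D\<close> are
  linearly independent at every point, so the two odd coefficients vanish, and then either contraction
  forces the top coefficient to vanish.\<close>

lemma act_invariants:
  assumes t: "admissible t" and U: "open U" "connected U" and F: "F \<in> superfunctions Sh U"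
    and inv: "\<And>X. act t X U F = 0"
  shows "\<exists>c. F = tens (indicator U) (scal c 1)"
proof -
  have basis: "act t gA U F = even_action gA U F" "act t gB U F = even_action gB U F"
    by (auto simp: act_def smul_def fun_eq_iff ext_eq_iff)
  have flat: "left_inv_deriv gA U (\<lambda>x. x_one (F x)) x = 0" "left_inv_deriv gB U (\<lambda>x. x_one (F x)) x = 0" for x
    using fun_cong[OF inv[of gA], of x] fun_cong[OF inv[of gB], of x]
    unfolding basis by (simp_all add: even_action_def section_deriv_def ext_eq_iff)
  have f0: "(\<lambda>x. x_one (F x)) \<in> Sh U" using F by (simp add: superfunctions_iff)
  have "act t gC U F = act_C t U F" "act t gD U F = act_D t U F"
    by (auto simp: act_def smul_def fun_eq_iff ext_eq_iff even_action_def section_deriv_def left_inv_deriv_def)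
  then have CD: "act_C t U F x = 0" "act_D t U F x = 0" for x
    using fun_cong[OF inv[of gC], of x] fun_cong[OF inv[of gD], of x] by simp_all
  have K: "pc_C t * pd_D t - pc_D t * antidiag_char 2 x * (pd_C t * antidiag_char (- 2) x) \<noteq> 0" for x
  proof -
    have "pc_D t * antidiag_char 2 x * (pd_C t * antidiag_char (- 2) x) = pc_D t * pd_C t * (antidiag_char 2 x * antidiag_char (-2) x)"
      by (simp only: ac_simps)
    also have "\<dots> = pc_D t * pd_C t" by (simp add: antidiag_char_mult)
    finally have eq: "pc_D t * antidiag_char 2 x * (pd_C t * antidiag_char (- 2) x) = pc_D t * pd_C t" .
    show ?thesis unfolding eq using t by (auto simp: admissible_def det_2)
  qed
  have "x_C (F x) = 0" "x_D (F x) = 0" "x_CD (F x) = 0" for x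
    using contraction_field_kernel[OF CD(1)[unfolded act_C_def] CD(2)[unfolded act_D_def] K]
      left_inv_deriv_entries[OF U(1) f0, of "mat2 (pcz t) 0 0 (pcw t)"] flat by simp_all
  moreover have "\<exists>c. \<forall>x\<in>U. x_one (F x) = c"
    using constant_if_derivatives_vanish[OF U f0 flat] by blast
  then obtain c where "\<And>x. x \<in> U \<Longrightarrow> x_one (F x) = c" by blast
  ultimately have "F = tens (indicator U) (scal c 1)"
    using superfunctions_vanish[OF F] by (auto simp: tens_indicator restr_def fun_eq_iff ext_eq_iff)
  then show ?thesis ..
qed

theorem action_RTLSG:
  assumes t: "admissible t"
  shows "action t \<in> RTLSG Sh"
  unfolding RTLSG_def mem_Collect_eq Let_def
proof (intro conjI ballI allI impI)
  show "lie_super_rep Sh (action t)"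
    unfolding lie_super_rep_def
    using action_sheaf_endo action_superderivation act_linear act_bracket[OF t]
    by (simp add: action_apply act_in)
next
  fix X :: "'k^2^2" and U :: "('k \<times> 'k) set" assume X: "X \<in> gl_part 0" and U: "open U"
  have even: "action t X U F = even_action X U F" if "F \<in> superfunctions Sh U" for F
    using that U X by (auto simp: action_apply act_def gl_part_iff smul_def fun_eq_iff ext_eq_iff)
  show "action t X U (tens f 1) = tens (left_inv_deriv X U f) 1" if "f \<in> Sh U" for f
    using that U by (simp add: even superfunctions_tens)
      (auto simp: even_action_def section_deriv_def tens_def fun_eq_iff ext_eq_iff left_inv_deriv_const)
  show "action t X U (tens (indicator U) (form_of (odd_functional a b))) =
      tens (indicator U) (form_of (\<lambda>Y. odd_functional a b (scomm Y X)))" for a b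
  proof -
    have r: "restr U (\<lambda>_. Ext 0 a b 0) \<in> superfunctions Sh U"
      using U by (intro superfunctions_restr[of U UNIV] superfunctions_const) auto
    have "section_deriv X U (restr U (\<lambda>_. Ext 0 a b 0)) = restr U (section_deriv X UNIV (\<lambda>_. Ext 0 a b 0))"
      using U by (intro section_deriv_restr superfunctions_const) auto
    then show ?thesis
      unfolding form_of_odd_functional form_of_coadjoint[OF X] tens_indicator even[OF r] even_action_def
      by (auto simp: section_deriv_def restr_def left_inv_deriv_const fun_eq_iff ext_eq_iff algebra_simps)
  qed
next
  fix U F assume "open U \<and> connected U" "F \<in> superfunctions Sh U" "\<forall>X. action t X U F = 0"
  then show "\<exists>c. F = tens (indicator U) (scal c 1)"
    using act_invariants[OF t] by (metis action_apply)
qed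

lemma fnm_eq: "fnm Sh n m = (\<lambda>x. exp (of_int n * fst x + of_int m * snd x))"
  unfolding fnm_def
proof (rule the_equality)
  let ?e = "\<lambda>x. exp (of_int n * fst x + of_int m * snd x) :: 'k"
  show "?e \<in> Sh UNIV \<and> left_inv_deriv gA UNIV ?e = (\<lambda>x. of_int n * ?e x) \<and>
      left_inv_deriv gB UNIV ?e = (\<lambda>x. of_int m * ?e x) \<and> ?e (0, 0) = 1"
    by (auto simp: exp_in left_inv_deriv_exp)
  fix f assume f: "f \<in> Sh UNIV \<and> left_inv_deriv gA UNIV f = (\<lambda>x. of_int n * f x) \<and>
      left_inv_deriv gB UNIV f = (\<lambda>x. of_int m * f x) \<and> f (0, 0) = 1"
  define e' :: "'k \<times> 'k \<Rightarrow> 'k" where "e' = (\<lambda>x. exp (- of_int n * fst x + - of_int m * snd x))"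
  have e': "e' \<in> Sh UNIV" "left_inv_deriv X UNIV e' x = (- of_int n * X$1$1 + - of_int m * X$2$2) * e' x" for X x
    unfolding e'_def by (rule exp_in, rule left_inv_deriv_exp)
  show "f = ?e"
  proof
    fix x
    have "f x * e' x = f (0, 0) * e' (0, 0)"
      by (rule constant_if_derivatives_vanish[where U = UNIV and f = "\<lambda>x. f x * e' x"])
        (use f e' in \<open>simp_all add: left_inv_deriv_mult mult_in convex_connected\<close>)
    then have "f x * e' x * ?e x = ?e x" using f by (simp add: e'_def)
    moreover have "e' x * ?e x = 1" by (simp add: e'_def exp_add[symmetric])
    ultimately show "f x = ?e x" by (simp only: mult.assoc mult_1_right)
  qed
qed

lemma action_parameters: "has_parameters Sh (action t) t"
proof -
  define k where "k = \<lparr>cz_C = pc_D t * pcz t, cz_D = - pc_C t * pcz t, cw_C = pc_D t * pcw t, cw_D = - pc_C t * pcw t,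
    dz_C = pd_D t * pdz t, dz_D = - pd_C t * pdz t, dw_C = pd_D t * pdw t, dw_D = - pd_C t * pdw t,
    c1_C = pc_C t, cwdg_C = 0, c1_D = pc_D t, cwdg_D = 2 * pc_D t * (pcz t - pcw t),
    d1_C = pd_C t, dwdg_C = - (2 * pd_C t * (pdz t - pdw t)), d1_D = pd_D t, dwdg_D = 0\<rparr>"
  have CD: "action t gC UNIV F = act_C t UNIV F" "action t gD UNIV F = act_D t UNIV F"
    if "F \<in> superfunctions Sh UNIV" for F
    using that by (auto simp: action_apply act_def smul_def fun_eq_iff ext_eq_iff even_action_def section_deriv_def left_inv_deriv_def)
  have E: "fnm Sh n m x * antidiag_char j x = fnm Sh (n + j) (m - j) x" for n m j x
    by (simp add: fnm_eq antidiag_char_def exp_add[symmetric] algebra_simps)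
  have V: "antidiag_char j = fnm Sh j (- j)" for j
    by (simp add: fnm_eq antidiag_char_def[abs_def] algebra_simps)
  have f: "fnm Sh n m \<in> Sh UNIV" for n m unfolding fnm_eq by (rule exp_in)
  have df: "left_inv_deriv X UNIV (fnm Sh n m) x = (of_int n * X$1$1 + of_int m * X$2$2) * fnm Sh n m x" for X n m x
    unfolding fnm_eq by (rule left_inv_deriv_exp)
  have [simp]: "antidiag_char 2 x * fnm Sh n m x = fnm Sh (n + 2) (m - 2) x" "antidiag_char (-2) x * fnm Sh n m x = fnm Sh (n - 2) (m + 2) x" for n m x
    using E[of n m x 2] E[of n m x "-2"] by (simp_all add: mult.commute)
  have "has_constants Sh (action t) k"
    unfolding has_constants_def Let_def
  proof (intro conjI)
    show "action t gC UNIV (tens (fnm Sh 1 0) 1) = tens (fnm Sh 3 (- 2)) (scal (cz_C k) Cst) + tens (fnm Sh 1 0) (scal (cz_D k) Dst)"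
      "action t gC UNIV (tens (fnm Sh 0 1) 1) = tens (fnm Sh 2 (- 1)) (scal (cw_C k) Cst) + tens (fnm Sh 0 1) (scal (cw_D k) Dst)"
      "action t gD UNIV (tens (fnm Sh 1 0) 1) = tens (fnm Sh 1 0) (scal (dz_C k) Cst) + tens (fnm Sh (- 1) 2) (scal (dz_D k) Dst)"
      "action t gD UNIV (tens (fnm Sh 0 1) 1) = tens (fnm Sh 0 1) (scal (dw_C k) Cst) + tens (fnm Sh (- 2) 3) (scal (dw_D k) Dst)"
      by (simp_all add: CD superfunctions_tens f)
        (auto simp: act_C_def act_D_def contraction_field_def tens_def df left_inv_deriv_const fun_eq_iff ext_eq_iff k_def E ac_simps)
    show "action t gC UNIV (tens (\<lambda>_. 1) Cst) = tens (\<lambda>_. 1) (scal (c1_C k) 1 + scal (cwdg_C k) (Cst * Dst))"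
      "action t gC UNIV (tens (\<lambda>_. 1) Dst) = tens (fnm Sh 2 (- 2)) (scal (c1_D k) 1 + scal (cwdg_D k) (Cst * Dst))"
      "action t gD UNIV (tens (\<lambda>_. 1) Cst) = tens (fnm Sh (- 2) 2) (scal (d1_C k) 1 + scal (dwdg_C k) (Cst * Dst))"
      "action t gD UNIV (tens (\<lambda>_. 1) Dst) = tens (\<lambda>_. 1) (scal (d1_D k) 1 + scal (dwdg_D k) (Cst * Dst))"
      by (simp_all add: CD superfunctions_tens)
        (auto simp: act_C_def act_D_def contraction_field_def tens_def V df f left_inv_deriv_cmult left_inv_deriv_const
          fun_eq_iff ext_eq_iff k_def algebra_simps)
  qed
  then show ?thesis
    unfolding has_parameters_def by (intro exI[of _ k]) (simp add: k_def M_C_def M_D_def)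
qed

lemma constants_unique:
  assumes "has_constants Sh \<rho> k" "has_constants Sh \<rho> k'"
  shows "k = k'"
proof -
  have one: "fnm Sh n m 0 = 1" for n m by (simp add: fnm_eq)
  have "F = tens f \<omega> + tens g \<eta> \<Longrightarrow> F 0 = scal (f 0) \<omega> + scal (g 0) \<eta>"
    "F = tens f \<omega> \<Longrightarrow> F 0 = scal (f 0) \<omega>" for F :: "'k ssection" and f g \<omega> \<eta>
    by (simp_all add: tens_def)
  note at_unit = this
  note e = assms[unfolded has_constants_def Let_def]
  have "structure_constants.truncate k = structure_constants.truncate k'" if True
    by (rule structure_constants.equality)
      (use e[THEN conjunct1, THEN at_unit(1)]
          e[THEN conjunct2, THEN conjunct1, THEN at_unit(1)]
          e[THEN conjunct2, THEN conjunct2, THEN conjunct1, THEN at_unit(1)]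
          e[THEN conjunct2, THEN conjunct2, THEN conjunct2, THEN conjunct1, THEN at_unit(1)]
          e[THEN conjunct2, THEN conjunct2, THEN conjunct2, THEN conjunct2, THEN conjunct1, THEN at_unit(2)]
          e[THEN conjunct2, THEN conjunct2, THEN conjunct2, THEN conjunct2, THEN conjunct2, THEN conjunct1, THEN at_unit(2)]
          e[THEN conjunct2, THEN conjunct2, THEN conjunct2, THEN conjunct2, THEN conjunct2, THEN conjunct2, THEN conjunct1, THEN at_unit(2)]
          e[THEN conjunct2, THEN conjunct2, THEN conjunct2, THEN conjunct2, THEN conjunct2, THEN conjunct2, THEN conjunct2, THEN at_unit(2)]
        in \<open>simp_all add: one ext_eq_iff structure_constants.defs\<close>)
  then show ?thesis by (simp add: structure_constants.defs)
qed

text \<open>The vectors \<open>(a, b)\<close> and \<open>(c, d)\<close> are rows of an invertible matrix, hence nonzero, and the multiples of them in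
  the rows of \<open>M_C\<close> and \<open>M_D\<close> determine the factors.\<close>

lemma parameters_unique:
  assumes "has_parameters Sh \<rho> t" "has_parameters Sh \<rho> t'" "admissible t"
  shows "t = t'"
proof -
  obtain k where k: "has_constants Sh \<rho> k" "c1_C k = pc_C t" "c1_D k = pc_D t" "d1_C k = pd_C t" "d1_D k = pd_D t"
    "M_C k = mat2 (pc_D t * pcz t) (- pc_C t * pcz t) (pc_D t * pcw t) (- pc_C t * pcw t)"
    "M_D k = mat2 (pd_D t * pdz t) (- pd_C t * pdz t) (pd_D t * pdw t) (- pd_C t * pdw t)"
    using assms(1) unfolding has_parameters_def by blast
  obtain k' where "has_constants Sh \<rho> k'" and k': "c1_C k' = pc_C t'" "c1_D k' = pc_D t'" "d1_C k' = pd_C t'" "d1_D k' = pd_D t'"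
    "M_C k' = mat2 (pc_D t' * pcz t') (- pc_C t' * pcz t') (pc_D t' * pcw t') (- pc_C t' * pcw t')"
    "M_D k' = mat2 (pd_D t' * pdz t') (- pd_C t' * pdz t') (pd_D t' * pdw t') (- pd_C t' * pdw t')"
    using assms(2) unfolding has_parameters_def by blast
  then have [simp]: "k' = k" using constants_unique k(1) by blast
  note k' = k'[simplified]
  have eq: "pc_C t' = pc_C t" "pc_D t' = pc_D t" "pd_C t' = pd_C t" "pd_D t' = pd_D t"
    using k(2-5) k'(1-4) by simp_all
  have nz: "\<not> (pc_C t = 0 \<and> pc_D t = 0)" "\<not> (pd_C t = 0 \<and> pd_D t = 0)"
    using assms(3) by (auto simp: admissible_def det_2)
  have cancel: "x = y" if "v * x = v * y" "- u * x = - u * y" "\<not> (u = 0 \<and> v = 0)" for u v x y :: 'k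
    using that by auto
  have entries: "pc_D t * pcz t = pc_D t * pcz t'" "- pc_C t * pcz t = - pc_C t * pcz t'"
    "pc_D t * pcw t = pc_D t * pcw t'" "- pc_C t * pcw t = - pc_C t * pcw t'"
    "pd_D t * pdz t = pd_D t * pdz t'" "- pd_C t * pdz t = - pd_C t * pdz t'"
    "pd_D t * pdw t = pd_D t * pdw t'" "- pd_C t * pdw t = - pd_C t * pdw t'"
    using k'(5,6)[unfolded k(6,7) eq mat_eq_iff mat2_entries] by simp_all
  have "pcz t = pcz t'" "pcw t = pcw t'" "pdz t = pdz t'" "pdw t = pdw t'"
    using cancel[OF _ _ nz(1)] cancel[OF _ _ nz(2)] entries by blast+
  with eq show ?thesis by (intro parameters.equality) simp_all
qed

lemma sheaf_endos_ext:
  assumes "\<Delta> \<in> sheaf_endos Sh" "\<Delta>' \<in> sheaf_endos Sh"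
    "\<And>U F. open U \<Longrightarrow> F \<in> superfunctions Sh U \<Longrightarrow> \<Delta> U F = \<Delta>' U F"
  shows "\<Delta> = \<Delta>'"
proof (rule PiE_ext)
  show P: "\<Delta> \<in> (\<Pi>\<^sub>E U\<in>{U. open U}. superfunctions Sh U \<rightarrow>\<^sub>E superfunctions Sh U)"
    "\<Delta>' \<in> (\<Pi>\<^sub>E U\<in>{U. open U}. superfunctions Sh U \<rightarrow>\<^sub>E superfunctions Sh U)"
    using assms(1,2) by (simp_all add: sheaf_endos_def)
  fix U :: "('k \<times> 'k) set" assume U: "U \<in> {U. open U}"
  show "\<Delta> U = \<Delta>' U"
    using PiE_mem[OF P(1) U] PiE_mem[OF P(2) U] assms(3) U by (intro PiE_ext) auto
qed

text \<open>The constants of the given structure and those of \<open>action t\<close> agree, so \<open>C\<close> and \<open>D\<close> are the same super vector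
  fields; the even part acts by the same operators in both, and linearity gives all matrices.\<close>

theorem RTLSG_eq_action:
  assumes \<rho>: "\<rho> \<in> RTLSG Sh"
  shows "\<exists>t. admissible t \<and> \<rho> = action t"
proof -
  obtain a b c d p q P Q where gens:
    "\<rho> gC UNIV (tens fst 1) = weight_section 1 (Ext 0 (b * p) (- (a * p)) 0)"
    "\<rho> gC UNIV (tens snd 1) = weight_section 1 (Ext 0 (b * q) (- (a * q)) 0)"
    "\<rho> gC UNIV (\<lambda>_. Cst) = weight_section 0 (Ext a 0 0 0)"
    "\<rho> gC UNIV (\<lambda>_. Dst) = weight_section 2 (Ext b 0 0 (2 * b * (p - q)))"
    "\<rho> gD UNIV (tens fst 1) = weight_section (-1) (Ext 0 (d * P) (- (c * P)) 0)"
    "\<rho> gD UNIV (tens snd 1) = weight_section (-1) (Ext 0 (d * Q) (- (c * Q)) 0)"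
    "\<rho> gD UNIV (\<lambda>_. Cst) = weight_section (-2) (Ext c 0 0 (- (2 * c * (P - Q))))"
    "\<rho> gD UNIV (\<lambda>_. Dst) = weight_section 0 (Ext d 0 0 0)"
    and det: "(a * d - b * c) * (P - p) = 1" "(a * d - b * c) * (Q - q) = 1"
    by (rule RTLSG_constants[OF \<rho>])
  define t where "t = \<lparr>pc_C = a, pc_D = b, pd_C = c, pd_D = d, pcz = p, pcw = q, pdz = P, pdw = Q\<rparr>"
  have t: "pc_C t = a" "pc_D t = b" "pd_C t = c" "pd_D t = d" "pcz t = p" "pcw t = q" "pdz t = P" "pdw t = Q"
    by (simp_all add: t_def)
  have "admissible t" using det by (simp add: admissible_def det_2 t)
  moreover have "\<rho> X = action t X" for X
  proof (rule sheaf_endos_ext[OF _ action_sheaf_endo])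
    show "\<rho> X \<in> sheaf_endos Sh" using \<rho> by (simp add: RTLSG_def lie_super_rep_def)
    fix U F assume U: "open U" and F: "F \<in> superfunctions Sh U"
    have odd: "gC \<in> gl_part 1" "gD \<in> gl_part 1" and E: "even_comp X \<in> gl_part 0" by (simp_all add: gl_part_iff)
    have C: "\<rho> gC U F = act_C t U F"
      unfolding superderivation_eq_super_field[OF RTLSG_superderivation[OF \<rho> odd(1)] U F] act_C_D_eq_super_field[OF U F] gens t ..
    have D: "\<rho> gD U F = act_D t U F"
      unfolding superderivation_eq_super_field[OF RTLSG_superderivation[OF \<rho> odd(2)] U F] act_C_D_eq_super_field[OF U F] gens t ..
    have "\<rho> X U F = \<rho> (even_comp X + ((\<chi> i j. X$1$2 * gC$i$j) + (\<chi> i j. X$2$1 * gD$i$j))) U F"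
      by (rule arg_cong[where f = "\<lambda>X. \<rho> X U F"]) (simp add: mat_eq_iff)
    also have "\<dots> = even_action (even_comp X) U F + (smul (X$1$2) (act_C t U F) + smul (X$2$1) (act_D t U F))"
      unfolding RTLSG_linear[OF \<rho> U F] C D RTLSG_even[OF \<rho> E U F] ..
    also have "even_action (even_comp X) U F = even_action X U F"
      by (simp only: even_action_def section_deriv_def left_inv_deriv_def odd_even_comp_entries)
    finally show "\<rho> X U F = action t X U F" using U F by (simp add: action_apply act_def plus_fun_def)
  qed
  ultimately show ?thesis by blast
qed

theorem RTLSG_parametrization:
  "(\<forall>\<rho>\<in>RTLSG Sh. \<exists>!t. admissible t \<and> has_parameters Sh \<rho> t) \<and>
   (\<forall>t. admissible t \<longrightarrow> (\<exists>!\<rho>. \<rho> \<in> RTLSG Sh \<and> has_parameters Sh \<rho> t))"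
proof (intro conjI ballI allI impI)
  fix \<rho> assume "\<rho> \<in> RTLSG Sh"
  then obtain t where "admissible t" "\<rho> = action t" using RTLSG_eq_action by blast
  then show "\<exists>!t. admissible t \<and> has_parameters Sh \<rho> t"
    using action_parameters parameters_unique by blast
next
  fix t :: "'k parameters" assume t: "admissible t"
  show "\<exists>!\<rho>. \<rho> \<in> RTLSG Sh \<and> has_parameters Sh \<rho> t"
  proof (rule ex1I[of _ "action t"])
    show "action t \<in> RTLSG Sh \<and> has_parameters Sh (action t) t"
      using action_RTLSG[OF t] action_parameters by blast
    fix \<rho> assume \<rho>: "\<rho> \<in> RTLSG Sh \<and> has_parameters Sh \<rho> t"
    then obtain t' where "\<rho> = action t'" using RTLSG_eq_action by blast
    then show "\<rho> = action t" using parameters_unique[OF _ action_parameters t] \<rho> by blast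
  qed
qed

end

section \<open>Averaging along rays\<close>

lemma has_derivative_integral_param:
  fixes \<phi> g h :: "'k \<times> 'k \<Rightarrow> real \<Rightarrow> 'k::{real_normed_field,euclidean_space}"
  assumes V: "open V" "convex V" "x \<in> V"
    and der: "\<And>x t. x \<in> V \<Longrightarrow> t \<in> {0..1} \<Longrightarrow>
      ((\<lambda>x. \<phi> x t) has_derivative (\<lambda>v. g x t * fst v + h x t * snd v)) (at x)"
    and cont_phi: "\<And>x. x \<in> V \<Longrightarrow> continuous_on {0..1} (\<phi> x)"
    and cont_g: "continuous_on (V \<times> {0..1}) (\<lambda>(x, t). g x t)"
    and cont_h: "continuous_on (V \<times> {0..1}) (\<lambda>(x, t). h x t)"
  shows "((\<lambda>x. integral {0..1} (\<phi> x)) has_derivative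
    (\<lambda>v. integral {0..1} (g x) * fst v + integral {0..1} (h x) * snd v)) (at x)"
proof -
  define B :: "'k \<times> 'k \<Rightarrow> real \<Rightarrow> ('k \<times> 'k) \<Rightarrow>\<^sub>L 'k" where
    "B x t = (blinfun_mult_right (g x t) o\<^sub>L fst_blinfun) + (blinfun_mult_right (h x t) o\<^sub>L snd_blinfun)" for x t
  have B_apply: "blinfun_apply (B x t) v = g x t * fst v + h x t * snd v" for x t v
    by (simp add: B_def blinfun.add_left)
  have B_fun: "blinfun_apply (B x t) = (\<lambda>v. g x t * fst v + h x t * snd v)" for x t
    by (rule ext) (rule B_apply)
  have cont_B: "continuous_on (V \<times> {0..1}) (\<lambda>(x, t). B x t)"
    unfolding B_def using cont_g cont_h
    by (auto simp: case_prod_unfold intro!: continuous_intros)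
  have slice: "continuous_on {0..1} (f x)" if "continuous_on (V \<times> {0..1}) (\<lambda>(x, t). f x t)"
    for f :: "'k \<times> 'k \<Rightarrow> real \<Rightarrow> 'c::topological_space"
  proof -
    have "continuous_on {0..1} (\<lambda>t. case (x, t) of (x, t) \<Rightarrow> f x t)"
      by (rule continuous_on_compose2[OF that]) (use V in \<open>auto intro!: continuous_intros\<close>)
    then show ?thesis by simp
  qed
  have "((\<lambda>x. integral (cbox 0 1) (\<phi> x)) has_derivative integral (cbox 0 1) (B x)) (at x within V)"
  proof (rule leibniz_rule)
    show "((\<lambda>x. \<phi> x t) has_derivative blinfun_apply (B x t)) (at x within V)"
      if "x \<in> V" "t \<in> cbox 0 1" for x t
      using der[of x t] that by (simp add: B_fun has_derivative_at_withinI)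
    show "\<phi> x integrable_on cbox 0 1" if "x \<in> V" for x
      using cont_phi[OF that] by (simp add: integrable_continuous_interval)
    show "continuous_on (V \<times> cbox 0 1) (\<lambda>(x, t). B x t)" using cont_B by simp
  qed (use V in auto)
  moreover have "blinfun_apply (integral (cbox 0 1) (B x)) =
      (\<lambda>v. integral {0..1} (g x) * fst v + integral {0..1} (h x) * snd v)"
  proof
    fix v
    have int: "B x integrable_on {0..1}" "g x integrable_on {0..1}" "h x integrable_on {0..1}"
      by (auto intro!: integrable_continuous_interval slice cont_B cont_g cont_h)
    have "blinfun_apply (integral (cbox 0 1) (B x)) v = integral {0..1} (\<lambda>t. blinfun_apply (B x t) v)"
      using int by (simp add: blinfun_apply_integral)
    also have "\<dots> = integral {0..1} (\<lambda>t. g x t * fst v + h x t * snd v)"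
      by (simp add: B_apply)
    also have "\<dots> = integral {0..1} (g x) * fst v + integral {0..1} (h x) * snd v"
      using int by (simp add: integral_add integral_mult_left integrable_on_mult_left)
    finally show "blinfun_apply (integral (cbox 0 1) (B x)) v = \<dots>" .
  qed
  ultimately show ?thesis
    using V by (simp add: at_within_open[of x V])
qed

lemma ray_in_convex:
  fixes p x :: "'a::real_vector"
  assumes "convex V" "p \<in> V" "x \<in> V" "t \<in> {0..1}"
  shows "p + t *\<^sub>R (x - p) \<in> V"
proof -
  have "p + t *\<^sub>R (x - p) = (1 - t) *\<^sub>R p + t *\<^sub>R x" by (simp add: algebra_simps)
  then show ?thesis using assms convexD_alt[of V p x t] by simp
qed

lemma continuous_on_ray:
  fixes F :: "'a::real_normed_vector \<Rightarrow> 'b::real_normed_vector" and w :: "real \<Rightarrow> real"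
  assumes "convex V" "p \<in> V" "continuous_on V F" "continuous_on {0..1} w"
  shows "continuous_on (V \<times> {0..1}) (\<lambda>(x, t). w t *\<^sub>R F (p + t *\<^sub>R (x - p)))"
  unfolding case_prod_unfold
  by (intro continuous_on_scaleR continuous_on_compose2[OF assms(4)]
      continuous_on_compose2[OF assms(3)] continuous_intros)
    (use assms ray_in_convex[OF assms(1,2)] in auto)

lemma continuous_on_along_ray:
  fixes F :: "'a::real_normed_vector \<Rightarrow> 'b::real_normed_vector"
  assumes "continuous_on V F" "convex V" "p \<in> V" "x \<in> V"
  shows "continuous_on {0..1} (\<lambda>t. F (p + t *\<^sub>R (x - p)))"
proof (rule continuous_on_compose2[OF assms(1)])
  show "continuous_on {0..1} (\<lambda>t. p + t *\<^sub>R (x - p))" by (intro continuous_intros)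
qed (use ray_in_convex[OF assms(2-4)] in blast)

text \<open>With weight one and applied to the partial derivatives of \<open>f\<close>, these averages are the factors in
  Hadamard's lemma. Differentiating an average multiplies the weight by \<open>t\<close>, which is why arbitrary weights
  are admitted: the induction on the order of differentiability needs them.\<close>

definition ray_average ::
  "(real \<Rightarrow> real) \<Rightarrow> 'k \<times> 'k \<Rightarrow> ('k \<times> 'k \<Rightarrow> 'k) \<Rightarrow> 'k \<times> 'k \<Rightarrow> 'k::{real_normed_field,euclidean_space}" where
  "ray_average w p F x = integral {0..1} (\<lambda>t. w t *\<^sub>R F (p + t *\<^sub>R (x - p)))"

lemma continuous_on_ray_average:
  assumes "convex V" "p \<in> V" "continuous_on V F" "continuous_on {0..1} w"
  shows "continuous_on V (ray_average w p F)"
  using integral_continuous_on_param[of V 0 1 "\<lambda>x t. w t *\<^sub>R F (p + t *\<^sub>R (x - p))"]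
    continuous_on_ray[OF assms] by (simp add: ray_average_def[abs_def])

lemma has_derivative_ray_average:
  fixes F :: "'k \<times> 'k \<Rightarrow> 'k::{real_normed_field,euclidean_space}"
  assumes V: "open V" "convex V" "p \<in> V" "x \<in> V"
    and der: "\<And>x. x \<in> V \<Longrightarrow> (F has_derivative (\<lambda>v. g x * fst v + h x * snd v)) (at x)"
    and cont: "continuous_on V g" "continuous_on V h" "continuous_on {0..1} w"
  shows "(ray_average w p F has_derivative
    (\<lambda>v. ray_average (\<lambda>t. w t * t) p g x * fst v + ray_average (\<lambda>t. w t * t) p h x * snd v)) (at x)"
  unfolding ray_average_def[abs_def]
proof (rule has_derivative_integral_param[OF V(1,2,4)])
  fix x t assume x: "x \<in> V" and t: "t \<in> {0..1::real}"
  have "((\<lambda>x. F (p + t *\<^sub>R (x - p))) has_derivative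
      (\<lambda>v. g (p + t *\<^sub>R (x - p)) * fst (t *\<^sub>R v) + h (p + t *\<^sub>R (x - p)) * snd (t *\<^sub>R v))) (at x)"
    by (rule has_derivative_compose[where f = "\<lambda>x. p + t *\<^sub>R (x - p)" and g = F, OF _ der[OF ray_in_convex[OF V(2,3) x t]]])
      (auto intro!: derivative_eq_intros)
  from has_derivative_scaleR_right[OF this, of "w t"]
  show "((\<lambda>x. w t *\<^sub>R F (p + t *\<^sub>R (x - p))) has_derivative
      (\<lambda>v. (w t * t) *\<^sub>R g (p + t *\<^sub>R (x - p)) * fst v + (w t * t) *\<^sub>R h (p + t *\<^sub>R (x - p)) * snd v)) (at x)"
    by (rule has_derivative_eq_rhs) (auto simp: algebra_simps scaleR_right_distrib)
next
  have "continuous_on V F"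
    using der by (meson has_derivative_continuous continuous_at_imp_continuous_on)
  then show "continuous_on {0..1} (\<lambda>t. w t *\<^sub>R F (p + t *\<^sub>R (x - p)))" if "x \<in> V" for x
    by (intro continuous_on_scaleR cont(3) continuous_on_along_ray[OF _ V(2) V(3) that])
qed (intro continuous_on_ray V cont continuous_intros)+

text \<open>The fundamental theorem of calculus on the segment from \<open>p\<close> to \<open>x\<close>.\<close>

lemma ray_average_hadamard:
  fixes f :: "'k \<times> 'k \<Rightarrow> 'k::{real_normed_field,euclidean_space}"
  assumes V: "convex V" "p \<in> V" "x \<in> V"
    and der: "\<And>x. x \<in> V \<Longrightarrow> (f has_derivative (\<lambda>v. g x * fst v + h x * snd v)) (at x)"
    and cont: "continuous_on V g" "continuous_on V h"
  shows "f x = f p + (fst x - fst p) * ray_average (\<lambda>_. 1) p g x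
    + (snd x - snd p) * ray_average (\<lambda>_. 1) p h x"
proof -
  let ?r = "\<lambda>t. p + t *\<^sub>R (x - p)"
  have "((\<lambda>t. f (?r t)) has_vector_derivative
      g (?r t) * (fst x - fst p) + h (?r t) * (snd x - snd p)) (at t within {0..1})"
    if "t \<in> {0..1}" for t
  proof -
    have r: "(?r has_derivative (\<lambda>s. s *\<^sub>R (x - p))) (at t within {0..1})"
      by (auto intro!: derivative_eq_intros)
    have "((\<lambda>t. f (?r t)) has_derivative
        (\<lambda>s. g (?r t) * fst (s *\<^sub>R (x - p)) + h (?r t) * snd (s *\<^sub>R (x - p)))) (at t within {0..1})"
      by (rule has_derivative_compose[OF r der[OF ray_in_convex[OF V that]]])
    then show ?thesis
      unfolding has_vector_derivative_def
      by (rule has_derivative_eq_rhs) (auto simp: scaleR_right_distrib)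
  qed
  then have "((\<lambda>t. g (?r t) * (fst x - fst p) + h (?r t) * (snd x - snd p)) has_integral
      f (?r 1) - f (?r 0)) {0..1}"
    by (intro fundamental_theorem_of_calculus) auto
  then have "f x - f p = integral {0..1} (\<lambda>t. g (?r t) * (fst x - fst p) + h (?r t) * (snd x - snd p))"
    by (simp add: integral_unique)
  also have "\<dots> = integral {0..1} (\<lambda>t. g (?r t)) * (fst x - fst p)
      + integral {0..1} (\<lambda>t. h (?r t)) * (snd x - snd p)"
  proof -
    have "(\<lambda>t. F (?r t)) integrable_on {0..1}" if "continuous_on V F" for F :: "'k \<times> 'k \<Rightarrow> 'k"
      by (intro integrable_continuous_interval continuous_on_along_ray[OF that V])
    then show ?thesis using cont
      by (simp add: integral_add integral_mult_left integrable_on_mult_left)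
  qed
  finally show ?thesis by (simp add: ray_average_def algebra_simps)
qed

section \<open>Smooth functions\<close>

lemma Ck_on_cong:
  assumes "open U" "\<And>x. x \<in> U \<Longrightarrow> f x = g x" "Ck_on k U f"
  shows "Ck_on k U g"
proof (cases k)
  case 0
  then show ?thesis using assms continuous_on_cong[of U U f g] by simp
next
  case (Suc n)
  then obtain a b where ab: "\<forall>x\<in>U. (f has_derivative (\<lambda>v. a x * fst v + b x * snd v)) (at x)"
    "Ck_on n U a" "Ck_on n U b" using assms(3) by auto
  have "(g has_derivative (\<lambda>v. a x * fst v + b x * snd v)) (at x)" if "x \<in> U" for x
    using has_derivative_transform_within_open[OF _ assms(1) that] ab(1) that assms(2) by blast
  then show ?thesis unfolding Suc Ck_on.simps using ab(2,3) by blast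
qed

lemma Ck_on_subset: "Ck_on k U f \<Longrightarrow> V \<subseteq> U \<Longrightarrow> Ck_on k V f"
proof (induction k arbitrary: f)
  case 0
  then show ?case by (auto intro: continuous_on_subset)
next
  case (Suc k)
  from Suc.prems(1) obtain a b where "\<forall>x\<in>U. (f has_derivative (\<lambda>v. a x * fst v + b x * snd v)) (at x)"
    "Ck_on k U a" "Ck_on k U b" unfolding Ck_on.simps by blast
  then show ?case unfolding Ck_on.simps using Suc.IH Suc.prems(2) by blast
qed

lemma Ck_on_Suc_imp: "Ck_on (Suc k) U f \<Longrightarrow> Ck_on k U f"
proof (induction k arbitrary: f)
  case 0
  then show ?case by (auto intro!: continuous_at_imp_continuous_on dest: has_derivative_continuous)
next
  case (Suc k)
  from Suc.prems obtain a b where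
    "\<forall>x\<in>U. (f has_derivative (\<lambda>v. a x * fst v + b x * snd v)) (at x)"
    "Ck_on (Suc k) U a" "Ck_on (Suc k) U b" by (subst (asm) Ck_on.simps(2)) auto
  with Suc.IH show ?case unfolding Ck_on.simps(2) by blast
qed

lemma Ck_on_const: "Ck_on k U (\<lambda>_. c)"
proof (induction k arbitrary: c)
  case (Suc k)
  show ?case unfolding Ck_on.simps
    by (intro exI[of _ "\<lambda>_. 0"] conjI ballI Suc.IH) auto
qed simp

lemma Ck_on_add: "Ck_on k U f \<Longrightarrow> Ck_on k U g \<Longrightarrow> Ck_on k U (\<lambda>x. f x + g x)"
proof (induction k arbitrary: f g)
  case (Suc k)
  from Suc.prems obtain a b a' b' where
    "\<forall>x\<in>U. (f has_derivative (\<lambda>v. a x * fst v + b x * snd v)) (at x)" "Ck_on k U a" "Ck_on k U b"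
    "\<forall>x\<in>U. (g has_derivative (\<lambda>v. a' x * fst v + b' x * snd v)) (at x)" "Ck_on k U a'" "Ck_on k U b'"
    by auto
  then show ?case unfolding Ck_on.simps
    by (intro exI[of _ "\<lambda>x. a x + a' x"] exI[of _ "\<lambda>x. b x + b' x"] conjI ballI Suc.IH)
      (auto intro!: derivative_eq_intros simp: algebra_simps)
qed (auto intro: continuous_intros)

lemma Ck_on_mult: "Ck_on k U f \<Longrightarrow> Ck_on k U g \<Longrightarrow> Ck_on k U (\<lambda>x. f x * g x)"
proof (induction k arbitrary: f g)
  case (Suc k)
  from Suc.prems obtain a b a' b' where *:
    "\<forall>x\<in>U. (f has_derivative (\<lambda>v. a x * fst v + b x * snd v)) (at x)" "Ck_on k U a" "Ck_on k U b"
    "\<forall>x\<in>U. (g has_derivative (\<lambda>v. a' x * fst v + b' x * snd v)) (at x)" "Ck_on k U a'" "Ck_on k U b'"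
    by auto
  have "Ck_on k U f" "Ck_on k U g" using Suc.prems Ck_on_Suc_imp by blast+
  with * show ?case unfolding Ck_on.simps
    by (intro exI[of _ "\<lambda>x. a x * g x + f x * a' x"] exI[of _ "\<lambda>x. b x * g x + f x * b' x"]
        conjI ballI Ck_on_add Suc.IH)
      (auto intro!: derivative_eq_intros simp: algebra_simps)
qed (auto intro: continuous_intros)

lemma Ck_on_fst: "Ck_on k U fst" and Ck_on_snd: "Ck_on k U snd"
proof -
  show "Ck_on k U fst"
  proof (cases k)
    case (Suc n)
    show ?thesis unfolding Suc Ck_on.simps
      by (intro exI[of _ "\<lambda>_. 1"] exI[of _ "\<lambda>_. 0"] conjI ballI Ck_on_const)
        (auto intro!: derivative_eq_intros)
  qed (auto intro: continuous_intros)
  show "Ck_on k U snd"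
  proof (cases k)
    case (Suc n)
    show ?thesis unfolding Suc Ck_on.simps
      by (intro exI[of _ "\<lambda>_. 0"] exI[of _ "\<lambda>_. 1"] conjI ballI Ck_on_const)
        (auto intro!: derivative_eq_intros)
  qed (auto intro: continuous_intros)
qed

lemma Ck_on_exp: "Ck_on k U (\<lambda>x. exp (n * fst x + m * snd x))"
proof (induction k)
  case (Suc k)
  show ?case unfolding Ck_on.simps
    by (intro exI[of _ "\<lambda>x. n * exp (n * fst x + m * snd x)"]
        exI[of _ "\<lambda>x. m * exp (n * fst x + m * snd x)"] conjI ballI Ck_on_mult Ck_on_const Suc.IH)
      (auto intro!: derivative_eq_intros simp: algebra_simps)
qed (auto intro!: continuous_intros)

lemma Ck_on_ray_average:
  assumes "open V" "convex V" "p \<in> V"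
  shows "Ck_on k V F \<Longrightarrow> continuous_on {0..1} w \<Longrightarrow> Ck_on k V (ray_average w p F)"
proof (induction k arbitrary: F w)
  case 0
  then show ?case using assms by (simp add: continuous_on_ray_average)
next
  case (Suc k)
  from Suc.prems obtain g h where gh:
    "\<forall>x\<in>V. (F has_derivative (\<lambda>v. g x * fst v + h x * snd v)) (at x)" "Ck_on k V g" "Ck_on k V h"
    by auto
  have cont: "continuous_on V f" if "Ck_on n V f" for f n
    using that by (cases n) (auto intro!: continuous_at_imp_continuous_on dest: has_derivative_continuous)
  have w: "continuous_on {0..1} (\<lambda>t. w t * t)"
    using Suc.prems by (intro continuous_intros)
  show ?case unfolding Ck_on.simps
  proof (rule exI[of _ "ray_average (\<lambda>t. w t * t) p g"], rule exI[of _ "ray_average (\<lambda>t. w t * t) p h"],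
        intro conjI ballI Suc.IH gh w)
    fix x assume "x \<in> V"
    with gh cont Suc.prems(2) show "(ray_average w p F has_derivative (\<lambda>v. ray_average (\<lambda>t. w t * t) p g x * fst v +
      ray_average (\<lambda>t. w t * t) p h x * snd v)) (at x)"
      by (intro has_derivative_ray_average[where V = V] assms) simp_all
  qed
qed

lemma partials_unique:
  fixes f :: "'k::real_normed_field \<times> 'k \<Rightarrow> 'k"
  assumes "(f has_derivative (\<lambda>v. a * fst v + b * snd v)) (at x)" "(f has_derivative (\<lambda>v. c * fst v + d * snd v)) (at x)"
  shows "a = c" "b = d"
  using fun_cong[OF has_derivative_unique[OF assms], of "(1, 0)"] fun_cong[OF has_derivative_unique[OF assms], of "(0, 1)"]
  by simp_all

lemma smooth_extension: "open U \<Longrightarrow> (\<And>k. Ck_on k U f) \<Longrightarrow> (\<lambda>x. if x \<in> U then f x else 0) \<in> smooth_functions U"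
  by (auto simp: smooth_functions_def intro: Ck_on_cong[of U f])

text \<open>The definition of smoothness allows different derivatives at each order; uniqueness of partial
  derivatives glues them into one pair.\<close>

lemma smooth_partials:
  assumes U: "open U" and f: "f \<in> smooth_functions U"
  shows "\<exists>g\<in>smooth_functions U. \<exists>h\<in>smooth_functions U. \<forall>x\<in>U. (f has_derivative (\<lambda>v. g x * fst v + h x * snd v)) (at x)"
proof -
  have "\<exists>g h. (\<forall>x\<in>U. (f has_derivative (\<lambda>v. g x * fst v + h x * snd v)) (at x)) \<and> Ck_on k U g \<and> Ck_on k U h" for k
    using f by (simp add: smooth_functions_def flip: Ck_on.simps(2))
  then obtain g h where gh: "\<And>k x. x \<in> U \<Longrightarrow> (f has_derivative (\<lambda>v. g k x * fst v + h k x * snd v)) (at x)"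
    "\<And>k. Ck_on k U (g k)" "\<And>k. Ck_on k U (h k)" by metis
  have eq: "g k x = g 0 x" "h k x = h 0 x" if "x \<in> U" for k x
    using partials_unique[OF gh(1)[OF that, of k] gh(1)[OF that, of 0]] by simp_all
  have Ck: "Ck_on k U (g 0)" "Ck_on k U (h 0)" for k
    using Ck_on_cong[OF U eq(1) gh(2)] Ck_on_cong[OF U eq(2) gh(3)] by blast+
  show ?thesis
    by (intro bexI[OF _ smooth_extension[OF U Ck(2)]] bexI[OF _ smooth_extension[OF U Ck(1)]]) (simp add: gh)
qed

interpretation smooth: function_sheaf smooth_functions
proof
  show "f x = 0" if "f \<in> smooth_functions U" "x \<notin> U" for f U x
    using that unfolding smooth_functions_def by blast
  show "(\<lambda>x. if x \<in> U then c else 0) \<in> smooth_functions U" if "open U" for U c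
    by (rule smooth_extension[OF that Ck_on_const])
  show "(\<lambda>x. f x + g x) \<in> smooth_functions U" "(\<lambda>x. f x * g x) \<in> smooth_functions U"
    if "f \<in> smooth_functions U" "g \<in> smooth_functions U" for f g U
    using that by (simp_all add: smooth_functions_def Ck_on_add Ck_on_mult)
  show "(\<lambda>x. if x \<in> V then f x else 0) \<in> smooth_functions V"
    if "open V" "V \<subseteq> U" "f \<in> smooth_functions U" for V U f
    using that by (intro smooth_extension) (auto simp: smooth_functions_def intro: Ck_on_subset)
  show "fst \<in> smooth_functions UNIV" "snd \<in> smooth_functions UNIV"
    "(\<lambda>x. exp (n * fst x + m * snd x)) \<in> smooth_functions UNIV" for n m
    by (simp_all add: smooth_functions_def Ck_on_fst Ck_on_snd Ck_on_exp)
  show "\<exists>g\<in>smooth_functions U. \<exists>h\<in>smooth_functions U. \<forall>x\<in>U. (f has_derivative (\<lambda>v. g x * fst v + h x * snd v)) (at x)"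
    if "open U" "f \<in> smooth_functions U" for U f
    using smooth_partials that .
  show "\<exists>V. open V \<and> p \<in> V \<and> V \<subseteq> U \<and> (\<exists>g\<in>smooth_functions V. \<exists>h\<in>smooth_functions V. \<forall>x\<in>V.
        f x = f p + (fst x - fst p) * g x + (snd x - snd p) * h x)"
    if U: "open U" and f: "f \<in> smooth_functions U" and p: "p \<in> U" for U f p
  proof -
    obtain e where "e > 0" and sub: "ball p e \<subseteq> U" using U p open_contains_ball by blast
    let ?V = "ball p e"
    have V: "open ?V" "convex ?V" "p \<in> ?V" using \<open>e > 0\<close> by simp_all
    obtain g h where gh: "g \<in> smooth_functions U" "h \<in> smooth_functions U"
      and der: "\<And>x. x \<in> U \<Longrightarrow> (f has_derivative (\<lambda>v. g x * fst v + h x * snd v)) (at x)"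
      using smooth_partials[OF U f] by blast
    have Ck: "Ck_on k ?V g" "Ck_on k ?V h" for k
      using gh by (auto simp: smooth_functions_def intro: Ck_on_subset[OF _ sub])
    have "Ck_on k ?V (ray_average (\<lambda>_. 1) p g)" "Ck_on k ?V (ray_average (\<lambda>_. 1) p h)" for k
      by (rule Ck_on_ray_average[OF V]; simp add: Ck)+
    note G = smooth_extension[OF V(1) this(1)] and H = smooth_extension[OF V(1) this(2)]
    have "f x = f p + (fst x - fst p) * ray_average (\<lambda>_. 1) p g x + (snd x - snd p) * ray_average (\<lambda>_. 1) p h x"
      if "x \<in> ?V" for x
      using Ck[of 0] sub by (intro ray_average_hadamard[OF V(2,3) that]) (auto intro: der)
    then show ?thesis
      by (intro exI[of _ ?V] conjI bexI[OF _ H] bexI[OF _ G] V sub) simp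
  qed
qed

section \<open>Holomorphic functions of two variables\<close>

text \<open>Cauchy's formula in the first variable with the second one fixed. The integrand depends on the point
  through elementary functions and through \<open>f\<close> in its second argument only.\<close>

lemma Cauchy_partial_derivative:
  fixes f :: "complex \<times> complex \<Rightarrow> complex"
  assumes sub: "cball p1 r \<times> ball p2 r \<subseteq> U" and r: "r > 0"
    and x: "x \<in> ball p1 r \<times> ball p2 r"
    and der: "\<And>x. x \<in> U \<Longrightarrow> (f has_derivative (\<lambda>v. a x * fst v + b x * snd v)) (at x)"
  shows "a x = integral {0..1} (\<lambda>t. of_real r * exp (2 * of_real pi * \<i> * of_real t) *
    f (p1 + of_real r * exp (2 * of_real pi * \<i> * of_real t), snd x) /
      (p1 + of_real r * exp (2 * of_real pi * \<i> * of_real t) - fst x)\<^sup>2)"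
proof -
  let ?f = "\<lambda>s. f (s, snd x)"
  have d: "(?f has_field_derivative a (s, snd x)) (at s)" if "s \<in> cball p1 r" for s
  proof -
    have "(?f has_derivative (\<lambda>v. a (s, snd x) * fst (v, 0::complex) + b (s, snd x) * snd (v, 0::complex))) (at s)"
      by (rule has_derivative_compose[OF _ der])
        (use that sub x in \<open>auto intro!: derivative_eq_intros\<close>)
    then show ?thesis by (simp add: has_field_derivative_def)
  qed
  have "continuous_on (cball p1 r) ?f"
    using d by (meson DERIV_isCont continuous_at_imp_continuous_on)
  moreover have "?f holomorphic_on ball p1 r"
    using d by (auto simp: holomorphic_on_def field_differentiable_def
        intro: has_field_derivative_at_within) (meson DERIV_subset has_field_derivative_at_within less_imp_le subset_UNIV)
  ultimately have "(?f has_field_derivative (1 / (2 * of_real pi * \<i>) *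
      contour_integral (circlepath p1 r) (\<lambda>u. ?f u / (u - fst x)^2))) (at (fst x))"
    using x by (intro Cauchy_derivative_integral_circlepath) auto
  moreover have "(?f has_field_derivative a x) (at (fst x))"
    using d[of "fst x"] x by auto
  ultimately have "a x = 1 / (2 * of_real pi * \<i>) *
      contour_integral (circlepath p1 r) (\<lambda>u. ?f u / (u - fst x)^2)"
    by (rule DERIV_unique[symmetric])
  also have "\<dots> = integral {0..1} (\<lambda>t. 1 / (2 * of_real pi * \<i>) *
      (?f (circlepath p1 r t) / (circlepath p1 r t - fst x)^2 * vector_derivative (circlepath p1 r) (at t)))"
    by (simp only: contour_integral_integral integral_mult_right)
  also have "\<dots> = integral {0..1} (\<lambda>t. of_real r * exp (2 * of_real pi * \<i> * of_real t) *
    f (p1 + of_real r * exp (2 * of_real pi * \<i> * of_real t), snd x) /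
      (p1 + of_real r * exp (2 * of_real pi * \<i> * of_real t) - fst x)\<^sup>2)"
    by (intro integral_cong) (simp add: vector_derivative_circlepath, simp add: circlepath mult.left_commute)
  finally show ?thesis .
qed

lemma bidisc_in_open:
  fixes p :: "'a::metric_space \<times> 'b::metric_space"
  assumes "open U" "p \<in> U"
  obtains r where "r > 0" "cball (fst p) r \<times> cball (snd p) r \<subseteq> U"
proof -
  obtain A B where AB: "open A" "open B" "p \<in> A \<times> B" "A \<times> B \<subseteq> U"
    using assms by (rule open_prod_elim)
  then have "fst p \<in> A" "snd p \<in> B" by auto
  then obtain s t where "s > 0" "cball (fst p) s \<subseteq> A" "t > 0" "cball (snd p) t \<subseteq> B"
    using AB(1,2) unfolding open_contains_cball by blast
  then have "cball (fst p) (min s t) \<times> cball (snd p) (min s t) \<subseteq> A \<times> B"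
    by (intro Sigma_mono) auto
  then have "cball (fst p) (min s t) \<times> cball (snd p) (min s t) \<subseteq> U" using AB by blast
  with \<open>s > 0\<close> \<open>t > 0\<close> that[of "min s t"] show ?thesis by auto
qed

lemma circle_not_in_ball:
  "x \<in> ball p r \<Longrightarrow> p + of_real r * exp (2 * of_real pi * \<i> * of_real t) - x \<noteq> (0::complex)"
proof
  assume x: "x \<in> ball p r" and "p + of_real r * exp (2 * of_real pi * \<i> * of_real t) - x = 0"
  then have "x = p + of_real r * exp (2 * of_real pi * \<i> * of_real t)" by simp
  then have "dist p x = \<bar>r\<bar>" by (simp add: dist_norm norm_mult)
  with x show False by simp
qed

lemma circle_in_cball:
  "r > 0 \<Longrightarrow> p + of_real r * exp (2 * of_real pi * \<i> * of_real t) \<in> cball p r"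
  by (simp add: dist_norm norm_mult)

text \<open>The integrand in Cauchy's formula is jointly continuous, because \<open>f\<close> is. No continuity of the derivatives is
  assumed in the definition of holomorphic functions, so this has to come before differentiation under the
  integral sign.\<close>

lemma holomorphic_partial_continuous:
  fixes f :: "complex \<times> complex \<Rightarrow> complex"
  assumes U: "open U"
    and der: "\<And>x. x \<in> U \<Longrightarrow> (f has_derivative (\<lambda>v. a x * fst v + b x * snd v)) (at x)"
  shows "continuous_on U a"
proof (rule continuous_at_imp_continuous_on, rule ballI)
  fix p assume "p \<in> U"
  then obtain r where r: "r > 0" "cball (fst p) r \<times> cball (snd p) r \<subseteq> U"
    using bidisc_in_open[OF U] by blast
  let ?V = "ball (fst p) r \<times> ball (snd p) r"
  have sub: "cball (fst p) r \<times> ball (snd p) r \<subseteq> U" using r by force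
  have contf: "continuous_on U f"
    using der by (meson has_derivative_continuous continuous_at_imp_continuous_on)
  have "continuous_on ?V (\<lambda>x. integral (cbox 0 1) (\<lambda>t. of_real r * exp (2 * of_real pi * \<i> * of_real t) *
    f (fst p + of_real r * exp (2 * of_real pi * \<i> * of_real t), snd x) /
      (fst p + of_real r * exp (2 * of_real pi * \<i> * of_real t) - fst x)\<^sup>2))"
    by (rule integral_continuous_on_param)
      (use sub r circle_not_in_ball circle_in_cball in \<open>auto simp: case_prod_unfold simp del: mem_cball
        intro!: continuous_intros continuous_on_compose2[OF contf]\<close>)
  then have "continuous_on ?V a"
    by (rule continuous_on_eq) (simp add: Cauchy_partial_derivative[OF sub r(1) _ der])
  moreover have "open ?V" "p \<in> ?V" using r by (auto simp: open_Times mem_Times_iff)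
  ultimately show "isCont a p" using continuous_on_eq_continuous_at by blast
qed

lemma has_derivative_swap: "(prod.swap has_derivative prod.swap) (at x)"
  unfolding prod.swap_def[abs_def] by (intro derivative_intros)

lemma swap_partials:
  fixes f :: "'k::real_normed_field \<times> 'k \<Rightarrow> 'k"
  shows "open U \<Longrightarrow> open (prod.swap -` U :: ('k \<times> 'k) set)"
    and "(\<And>x. x \<in> U \<Longrightarrow> (f has_derivative (\<lambda>v. a x * fst v + b x * snd v)) (at x)) \<Longrightarrow> x \<in> prod.swap -` U \<Longrightarrow>
      ((\<lambda>x. f (prod.swap x)) has_derivative (\<lambda>v. b (prod.swap x) * fst v + a (prod.swap x) * snd v)) (at x)"
proof -
  have "continuous_on UNIV (prod.swap :: 'k \<times> 'k \<Rightarrow> _)"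
    unfolding prod.swap_def[abs_def] by (intro continuous_intros)
  then show "open U \<Longrightarrow> open (prod.swap -` U :: ('k \<times> 'k) set)" by (simp add: open_vimage)
next
  assume der: "\<And>x. x \<in> U \<Longrightarrow> (f has_derivative (\<lambda>v. a x * fst v + b x * snd v)) (at x)" and "x \<in> prod.swap -` U"
  then have "((\<lambda>x. f (prod.swap x)) has_derivative
      (\<lambda>v. a (prod.swap x) * fst (prod.swap v) + b (prod.swap x) * snd (prod.swap v))) (at x)"
    by (intro has_derivative_compose[OF has_derivative_swap der]) auto
  then show "((\<lambda>x. f (prod.swap x)) has_derivative (\<lambda>v. b (prod.swap x) * fst v + a (prod.swap x) * snd v)) (at x)"
    by (simp add: add.commute)
qed

lemma holomorphic_partial_continuous_snd:
  fixes f :: "complex \<times> complex \<Rightarrow> complex"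
  assumes U: "open U"
    and der: "\<And>x. x \<in> U \<Longrightarrow> (f has_derivative (\<lambda>v. a x * fst v + b x * snd v)) (at x)"
  shows "continuous_on U b"
proof -
  let ?s = "prod.swap :: complex \<times> complex \<Rightarrow> _"
  have *: "continuous_on (?s -` U) (\<lambda>x. b (?s x))"
    by (rule holomorphic_partial_continuous[OF swap_partials(1)[OF U] swap_partials(2)[OF der]])
  have "continuous_on U (\<lambda>x. b (?s (?s x)))"
    by (rule continuous_on_compose2[OF *]) (auto simp: prod.swap_def[abs_def] intro!: continuous_intros)
  then show ?thesis by simp
qed

lemma has_field_derivative_Cauchy_kernel:
  fixes c u z :: complex
  assumes "u \<noteq> z"
  shows "((\<lambda>z. c / (u - z)\<^sup>2) has_field_derivative 2 * c / (u - z) ^ 3) (at z)"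
proof -
  have "((\<lambda>z. c * inverse (u - z) ^ 2) has_field_derivative
      2 * (c * (inverse (u - z) * (inverse (u - z) * inverse (u - z))))) (at z)"
    using assms by (auto intro!: derivative_eq_intros)
  then show ?thesis
    by (simp add: power2_eq_square power3_eq_cube divide_inverse mult.assoc inverse_mult_distrib)
qed

text \<open>Differentiate Cauchy's formula under the integral sign: the derivative of the integrand in the second
  variable involves \<open>\<partial>\<^sub>y f\<close>, which is continuous by the previous step.\<close>

lemma holomorphic_partial_holomorphic:
  fixes f :: "complex \<times> complex \<Rightarrow> complex"
  assumes U: "open U" "p \<in> U"
    and der: "\<And>x. x \<in> U \<Longrightarrow> (f has_derivative (\<lambda>v. a x * fst v + b x * snd v)) (at x)"
  shows "\<exists>c d. (a has_derivative (\<lambda>v. c * fst v + d * snd v)) (at p)"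
proof -
  obtain r where r: "r > 0" "cball (fst p) r \<times> cball (snd p) r \<subseteq> U"
    using bidisc_in_open[OF U] by blast
  let ?V = "ball (fst p) r \<times> ball (snd p) r"
  have sub: "cball (fst p) r \<times> ball (snd p) r \<subseteq> U" using r by force
  have contf: "continuous_on U f"
    using der by (meson has_derivative_continuous continuous_at_imp_continuous_on)
  have contb: "continuous_on U b" by (rule holomorphic_partial_continuous_snd[OF U(1) der])
  define \<gamma> where "\<gamma> t = fst p + of_real r * exp (2 * of_real pi * \<i> * of_real t)" for t :: real
  define w where "w t = of_real r * exp (2 * of_real pi * \<i> * of_real t)" for t :: real
  have \<gamma>_off: "\<gamma> t - x \<noteq> 0" if "x \<in> ball (fst p) r" for x t
    unfolding \<gamma>_def by (rule circle_not_in_ball[OF that])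
  have \<gamma>_in: "(\<gamma> t, y) \<in> U" if "y \<in> ball (snd p) r" for t y
    using circle_in_cball[OF r(1), of "fst p" t] sub that unfolding \<gamma>_def by blast
  have cw: "continuous_on A w" "continuous_on A \<gamma>" for A
    unfolding w_def \<gamma>_def by (auto intro!: continuous_intros)
  have V: "open ?V" "convex ?V" "p \<in> ?V" using r by (auto simp: open_Times mem_Times_iff convex_Times)
  note ci = continuous_intros continuous_on_compose2[OF contf] continuous_on_compose2[OF contb]
    continuous_on_compose2[OF cw(1)[of UNIV]] continuous_on_compose2[OF cw(2)[of UNIV]]
  let ?\<phi> = "\<lambda>x t. w t * f (\<gamma> t, snd x) / (\<gamma> t - fst x)\<^sup>2"
  let ?g = "\<lambda>x t. 2 * w t * f (\<gamma> t, snd x) / (\<gamma> t - fst x) ^ 3"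
  let ?h = "\<lambda>x t. w t * b (\<gamma> t, snd x) / (\<gamma> t - fst x)\<^sup>2"
  have "((\<lambda>x. integral {0..1} (?\<phi> x)) has_derivative
      (\<lambda>v. integral {0..1} (?g p) * fst v + integral {0..1} (?h p) * snd v)) (at p)"
  proof (rule has_derivative_integral_param[OF V])
    fix x t assume x: "x \<in> ?V" and "t \<in> {0..1::real}"
    then have U': "(\<gamma> t, snd x) \<in> U" and nz: "\<gamma> t - fst x \<noteq> 0" using \<gamma>_in \<gamma>_off by auto
    have "((\<lambda>x. f (\<gamma> t, snd x)) has_derivative
        (\<lambda>v. a (\<gamma> t, snd x) * fst (0::complex, snd v) + b (\<gamma> t, snd x) * snd (0::complex, snd v))) (at x)"
      by (rule has_derivative_compose[where f = "\<lambda>x. (\<gamma> t, snd x)" and g = f, OF _ der[OF U']])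
        (auto intro!: derivative_eq_intros)
    then have f': "((\<lambda>x. f (\<gamma> t, snd x)) has_derivative (\<lambda>v. b (\<gamma> t, snd x) * snd v)) (at x)"
      by simp
    have "((\<lambda>s. w t / (\<gamma> t - s)\<^sup>2) has_field_derivative 2 * w t / (\<gamma> t - fst x) ^ 3) (at (fst x))"
      using has_field_derivative_Cauchy_kernel nz by auto
    then have q': "((\<lambda>x. w t / (\<gamma> t - fst x)\<^sup>2) has_derivative (\<lambda>v. 2 * w t / (\<gamma> t - fst x) ^ 3 * fst v)) (at x)"
      unfolding has_field_derivative_def
      by (rule has_derivative_compose[where f = fst, rotated]) (auto intro!: derivative_eq_intros)
    from has_derivative_mult[OF q' f']
    show "((\<lambda>x. ?\<phi> x t) has_derivative (\<lambda>v. ?g x t * fst v + ?h x t * snd v)) (at x)"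
      by (simp add: algebra_simps)
  next
    fix x assume x: "x \<in> ?V"
    show "continuous_on {0..1} (?\<phi> x)"
      by (intro continuous_on_divide continuous_on_mult continuous_on_power continuous_on_diff
          continuous_on_const cw continuous_on_compose2[OF contf] continuous_on_Pair)
        (use x \<gamma>_in \<gamma>_off in auto)
  next
    have cf: "continuous_on (?V \<times> {0..1}) (\<lambda>z. F (\<gamma> (snd z), snd (fst z)))"
      if "continuous_on U F" for F :: "complex \<times> complex \<Rightarrow> complex"
      by (rule continuous_on_compose2[OF that], intro continuous_on_Pair continuous_on_compose2[OF cw(2)[of UNIV]]
        continuous_on_snd continuous_on_fst continuous_on_id) (use \<gamma>_in in auto)
    have cw': "continuous_on (?V \<times> {0..1}) (\<lambda>z. w (snd z))"
      "continuous_on (?V \<times> {0..1}) (\<lambda>z. \<gamma> (snd z) - fst (fst z))"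
      by (intro continuous_on_diff continuous_on_compose2[OF cw(1)[of UNIV]] continuous_on_compose2[OF cw(2)[of UNIV]]
        continuous_on_snd continuous_on_fst continuous_on_id subset_UNIV)+
    show "continuous_on (?V \<times> {0..1}) (\<lambda>(x, t). ?g x t)" unfolding case_prod_unfold
      by (intro continuous_on_divide continuous_on_mult continuous_on_power
          continuous_on_const cw' cf contf) (use \<gamma>_off in auto)
    show "continuous_on (?V \<times> {0..1}) (\<lambda>(x, t). ?h x t)" unfolding case_prod_unfold
      by (intro continuous_on_divide continuous_on_mult continuous_on_power
          continuous_on_const cw' cf contb) (use \<gamma>_off in auto)
  qed
  moreover have "integral {0..1} (?\<phi> x) = a x" if "x \<in> ?V" for x
    unfolding w_def \<gamma>_def by (rule Cauchy_partial_derivative[OF sub r(1) that der, symmetric])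
  ultimately have "(a has_derivative
      (\<lambda>v. integral {0..1} (?g p) * fst v + integral {0..1} (?h p) * snd v)) (at p)"
    by (rule has_derivative_transform_within_open[OF _ V(1,3)])
  then show ?thesis by blast
qed

lemma holomorphic_partial_holomorphic_snd:
  fixes f :: "complex \<times> complex \<Rightarrow> complex"
  assumes U: "open U" "p \<in> U"
    and der: "\<And>x. x \<in> U \<Longrightarrow> (f has_derivative (\<lambda>v. a x * fst v + b x * snd v)) (at x)"
  shows "\<exists>c d. (b has_derivative (\<lambda>v. c * fst v + d * snd v)) (at p)"
proof -
  let ?s = "prod.swap :: complex \<times> complex \<Rightarrow> _"
  have "\<exists>c d. ((\<lambda>x. b (?s x)) has_derivative (\<lambda>v. c * fst v + d * snd v)) (at (?s p))"
    by (rule holomorphic_partial_holomorphic[OF swap_partials(1)[OF U(1)] _ swap_partials(2)[OF der]]) (simp add: U)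
  then obtain c d where "((\<lambda>x. b (?s x)) has_derivative (\<lambda>v. c * fst v + d * snd v)) (at (?s p))" by blast
  from has_derivative_compose[OF has_derivative_swap this]
  have "(b has_derivative (\<lambda>v. d * fst v + c * snd v)) (at p)" by (simp add: add.commute)
  then show ?thesis by blast
qed

lemma holomorphic_extension:
  assumes U: "open U" and f: "\<And>x. x \<in> U \<Longrightarrow> \<exists>a b. (f has_derivative (\<lambda>v. a * fst v + b * snd v)) (at x)"
  shows "(\<lambda>x. if x \<in> U then f x else 0) \<in> holomorphic_functions U"
  unfolding holomorphic_functions_def
proof (intro CollectI conjI ballI allI impI)
  fix x assume x: "x \<in> U"
  then obtain a b where "(f has_derivative (\<lambda>v. a * fst v + b * snd v)) (at x)" using f by blast
  then have "((\<lambda>x. if x \<in> U then f x else 0) has_derivative (\<lambda>v. a * fst v + b * snd v)) (at x)"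
    by (rule has_derivative_transform_within_open[OF _ U x]) simp
  then show "\<exists>a b. ((\<lambda>x. if x \<in> U then f x else 0) has_derivative (\<lambda>v. a * fst v + b * snd v)) (at x)" by blast
qed simp

lemma holomorphic_partials:
  assumes U: "open U" and f: "f \<in> holomorphic_functions U"
  shows "\<exists>g\<in>holomorphic_functions U. \<exists>h\<in>holomorphic_functions U. \<forall>x\<in>U.
    (f has_derivative (\<lambda>v. g x * fst v + h x * snd v)) (at x)"
proof -
  have "\<forall>x\<in>U. \<exists>a b. (f has_derivative (\<lambda>v. a * fst v + b * snd v)) (at x)"
    using f by (simp add: holomorphic_functions_def)
  then obtain g h where gh: "\<And>x. x \<in> U \<Longrightarrow> (f has_derivative (\<lambda>v. g x * fst v + h x * snd v)) (at x)" by metis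
  note G = holomorphic_extension[OF U holomorphic_partial_holomorphic[OF U _ gh]]
    and H = holomorphic_extension[OF U holomorphic_partial_holomorphic_snd[OF U _ gh]]
  show ?thesis by (intro bexI[OF _ H] bexI[OF _ G]) (simp_all add: gh)
qed

lemma holomorphic_ray_average:
  fixes g :: "complex \<times> complex \<Rightarrow> complex"
  assumes V: "open V" "convex V" "p \<in> V" "x \<in> V" and U: "open U" "V \<subseteq> U" and g: "g \<in> holomorphic_functions U"
  shows "\<exists>a b. (ray_average (\<lambda>_. 1) p g has_derivative (\<lambda>v. a * fst v + b * snd v)) (at x)"
proof -
  obtain a b where ab: "\<And>x. x \<in> U \<Longrightarrow> (g has_derivative (\<lambda>v. a x * fst v + b x * snd v)) (at x)"
    using holomorphic_partials[OF U(1) g] by blast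
  have "continuous_on V a" "continuous_on V b"
    using holomorphic_partial_continuous[OF U(1) ab] holomorphic_partial_continuous_snd[OF U(1) ab] U(2)
    by (auto intro: continuous_on_subset)
  from has_derivative_ray_average[OF V ab this continuous_on_const] U(2) show ?thesis by blast
qed

interpretation holomorphic: function_sheaf holomorphic_functions
proof
  show "f x = 0" if "f \<in> holomorphic_functions U" "x \<notin> U" for f U x
    using that unfolding holomorphic_functions_def by blast
  have const: "((\<lambda>_. c) has_derivative (\<lambda>v. 0 * fst v + 0 * snd v)) (at x)" for c :: complex and x :: "complex \<times> complex"
    by simp
  show "(\<lambda>x. if x \<in> U then c else 0) \<in> holomorphic_functions U" if "open U" for U c
    using const by (intro holomorphic_extension[OF that]) blast
  show "(\<lambda>x. f x + g x) \<in> holomorphic_functions U" "(\<lambda>x. f x * g x) \<in> holomorphic_functions U"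
    if fg: "f \<in> holomorphic_functions U" "g \<in> holomorphic_functions U" for f g U
  proof -
    have "\<exists>a b. ((\<lambda>x. f x + g x) has_derivative (\<lambda>v. a * fst v + b * snd v)) (at x)"
      "\<exists>a b. ((\<lambda>x. f x * g x) has_derivative (\<lambda>v. a * fst v + b * snd v)) (at x)" if "x \<in> U" for x
    proof -
      have "\<exists>a b. (F has_derivative (\<lambda>v. a * fst v + b * snd v)) (at x)" if "F \<in> holomorphic_functions U" for F
        using that \<open>x \<in> U\<close> by (simp add: holomorphic_functions_def)
      from this[OF fg(1)] this[OF fg(2)]
      obtain a b c d where f': "(f has_derivative (\<lambda>v. a * fst v + b * snd v)) (at x)"
        and g': "(g has_derivative (\<lambda>v. c * fst v + d * snd v)) (at x)"
        by (elim exE) (rule that)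
      have "((\<lambda>x. f x + g x) has_derivative (\<lambda>v. (a + c) * fst v + (b + d) * snd v)) (at x)"
        using has_derivative_add[OF f' g'] by (simp add: algebra_simps)
      moreover have "((\<lambda>x. f x * g x) has_derivative (\<lambda>v. (f x * c + a * g x) * fst v + (f x * d + b * g x) * snd v)) (at x)"
        using has_derivative_mult[OF f' g'] by (simp add: algebra_simps)
      ultimately show "\<exists>a b. ((\<lambda>x. f x + g x) has_derivative (\<lambda>v. a * fst v + b * snd v)) (at x)"
        "\<exists>a b. ((\<lambda>x. f x * g x) has_derivative (\<lambda>v. a * fst v + b * snd v)) (at x)" by blast+
    qed
    then show "(\<lambda>x. f x + g x) \<in> holomorphic_functions U" "(\<lambda>x. f x * g x) \<in> holomorphic_functions U"
      using fg by (simp_all add: holomorphic_functions_def)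
  qed
  show "(\<lambda>x. if x \<in> V then f x else 0) \<in> holomorphic_functions V"
    if "open V" "V \<subseteq> U" "f \<in> holomorphic_functions U" for V U f
    using that by (intro holomorphic_extension) (auto simp: holomorphic_functions_def)
  show "fst \<in> holomorphic_functions UNIV" "snd \<in> holomorphic_functions UNIV"
    "(\<lambda>x. exp (n * fst x + m * snd x)) \<in> holomorphic_functions UNIV" for n m
  proof -
    have "(fst has_derivative (\<lambda>v. 1 * fst v + 0 * snd v)) (at x)" "(snd has_derivative (\<lambda>v. 0 * fst v + 1 * snd v)) (at x)"
      for x :: "complex \<times> complex"
      using has_derivative_fst[OF has_derivative_ident, of "at x"] has_derivative_snd[OF has_derivative_ident, of "at x"]
      by simp_all
    then show "fst \<in> holomorphic_functions UNIV" "snd \<in> holomorphic_functions UNIV"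
      unfolding holomorphic_functions_def by blast+
    show "(\<lambda>x. exp (n * fst x + m * snd x)) \<in> holomorphic_functions UNIV"
      unfolding holomorphic_functions_def using has_derivative_exp_linear by blast
  qed
  show "\<exists>g\<in>holomorphic_functions U. \<exists>h\<in>holomorphic_functions U. \<forall>x\<in>U. (f has_derivative (\<lambda>v. g x * fst v + h x * snd v)) (at x)"
    if "open U" "f \<in> holomorphic_functions U" for U f
    using holomorphic_partials that .
  show "\<exists>V. open V \<and> p \<in> V \<and> V \<subseteq> U \<and> (\<exists>g\<in>holomorphic_functions V. \<exists>h\<in>holomorphic_functions V. \<forall>x\<in>V.
        f x = f p + (fst x - fst p) * g x + (snd x - snd p) * h x)"
    if U: "open U" and f: "f \<in> holomorphic_functions U" and p: "p \<in> U" for U f p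
  proof -
    obtain e where "e > 0" and sub: "ball p e \<subseteq> U" using U p open_contains_ball by blast
    let ?V = "ball p e"
    have V: "open ?V" "convex ?V" "p \<in> ?V" using \<open>e > 0\<close> by simp_all
    obtain g h where gh: "g \<in> holomorphic_functions U" "h \<in> holomorphic_functions U"
      and der: "\<And>x. x \<in> U \<Longrightarrow> (f has_derivative (\<lambda>v. g x * fst v + h x * snd v)) (at x)"
      using holomorphic_partials[OF U f] by blast
    note G = holomorphic_extension[OF V(1) holomorphic_ray_average[OF V _ U sub gh(1)]]
      and H = holomorphic_extension[OF V(1) holomorphic_ray_average[OF V _ U sub gh(2)]]
    have cont: "continuous_on ?V g" "continuous_on ?V h"
      using holomorphic_partial_continuous[OF U der] holomorphic_partial_continuous_snd[OF U der] sub
      by (auto intro: continuous_on_subset)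
    have "f x = f p + (fst x - fst p) * ray_average (\<lambda>_. 1) p g x + (snd x - snd p) * ray_average (\<lambda>_. 1) p h x"
      if "x \<in> ?V" for x
      using sub by (intro ray_average_hadamard[OF V(2,3) that] cont) (auto intro: der)
    then show ?thesis
      by (intro exI[of _ ?V] conjI bexI[OF _ H] bexI[OF _ G] V sub) simp_all
  qed
qed

section \<open>The parametrization\<close>

theorem proposition1:
  shows "((\<forall>\<rho>\<in>RTLSG smooth_functions.
            \<exists>!t :: real parameters. admissible t \<and> has_parameters smooth_functions \<rho> t) \<and>
          (\<forall>t :: real parameters. admissible t \<longrightarrow>
            (\<exists>!\<rho>. \<rho> \<in> RTLSG smooth_functions \<and> has_parameters smooth_functions \<rho> t))) \<and>
         ((\<forall>\<rho>\<in>RTLSG holomorphic_functions.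
            \<exists>!t :: complex parameters. admissible t \<and> has_parameters holomorphic_functions \<rho> t) \<and>
          (\<forall>t :: complex parameters. admissible t \<longrightarrow>
            (\<exists>!\<rho>. \<rho> \<in> RTLSG holomorphic_functions \<and> has_parameters holomorphic_functions \<rho> t)))"
  using smooth.RTLSG_parametrization holomorphic.RTLSG_parametrization by (rule conjI)

end
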